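(* Let $p$ be a prime number. The completion of the multivalued ring $$(\mathscr{E}^{\mathrm{bd}},\{\|\cdot\|_{p^r\mathbb{Z}_p}\}_{r\in\mathbb{Z}})\quad\text{(resp. }(\mathscr{E}^\circ,\{\|\cdot\|_{p^r\mathbb{Z}_p}\}_{r\in\mathbb{Z}})\text{)}$$ is the Fréchet $\mathbb{Q}_p$-algebra $\mathscr{C}(\mathbb{Q}_p,\mathbb{Q}_p)$ (resp. the Fréchet $\mathbb{Z}_p$-algebra $\mathscr{C}(\mathbb{Q}_p,\mathbb{Z}_p)$).
   Context: $\Psi=\Psi_p\in T + T^2\mathbb{Z}[[T]]$ is the unique power series of this form satisfying $\sum_{j=0}^\infty p^{-j}\Psi(p^jT)^{p^j} = T$; it is $p$-adically entire and $\Psi(\mathbb{Q}_p)\subset\mathbb{Z}_p$. $\mathbb{Q}_p\{x\}$ is the ring of entire functions over $\mathbb{Q}_p$ (power series over $\mathbb{Q}_p$ converging on all of $\mathbb{C}_p$) with its standard Fréchet topology, defined by the valuations $w_r(f)=\inf_{x\in p^{-r}\mathbb{C}_p^\circ}v_p(f(x))$, $r\in\mathbb{Z}$, where $\mathbb{C}_p^\circ$ is the closed unit disc of $\mathbb{C}_p$. $\mathscr{E}^\circ$ is the closure in $\mathbb{Q}_p\{x\}$ of $\mathbb{Z}_p[\Psi(\lambda^{-1}p^jx)\mid j=0,1,\dots,\ \lambda\in\mathbb{Q}_p^\times]$, and $\mathscr{E}^{\mathrm{bd}}=\mathscr{E}^\circ[1/p]$. For a set $X$, $\|f\|_X=\sup_{x\in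 X}|f(x)|$; the elements of $\mathscr{E}^{\mathrm{bd}}$ are regarded as functions on $\mathbb{Q}_p$ by restriction. $\mathscr{C}(\mathbb{Q}_p,\mathbb{Q}_p)$ (resp. $\mathscr{C}(\mathbb{Q}_p,\mathbb{Z}_p)$) is the algebra of continuous functions $\mathbb{Q}_p\to\mathbb{Q}_p$ (resp. $\mathbb{Q}_p\to\mathbb{Z}_p$) with the topology of uniform convergence on compact subsets of $\mathbb{Q}_p$. *)

theory Defs
  imports
    "HOL-Analysis.T1_Spaces"
    "HOL-Computational_Algebra.Computational_Algebra"
    "HOL-Algebra.Module"
    "HOL-Algebra.Generated_Rings"
    "HOL-Library.Extended_Nonnegative_Real"
begin

section \<open>Multivalued rings, Frechet algebras, completions\<close>

text \<open>The group topology on \<open>R\<close> in which the finite intersections of the balls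
  \<open>{z. q i z < e}\<close>, \<open>i \<in> I\<close>, \<open>e > 0\<close>, form a neighbourhood basis of zero.\<close>

definition seminorm_topology ::
  "('a, 'm) ring_scheme \<Rightarrow> 'i set \<Rightarrow> ('i \<Rightarrow> 'a \<Rightarrow> ennreal) \<Rightarrow> 'a topology" where
  "seminorm_topology R I q = topology (\<lambda>U. U \<subseteq> carrier R \<and>
     (\<forall>x\<in>U. \<exists>F e. finite F \<and> F \<subseteq> I \<and> e > 0 \<and>
        {y \<in> carrier R. \<forall>i\<in>F. q i (y \<ominus>\<^bsub>R\<^esub> x) < e} \<subseteq> U))"

text \<open>The additive counterpart, for a family of valuations \<open>w i\<close> with values in the
  extended reals: here large values of \<open>w i\<close> mean small elements.\<close>

definition valuation_topology ::
  "('a, 'm) ring_scheme \<Rightarrow> 'i set \<Rightarrow> ('i \<Rightarrow> 'a \<Rightarrow> ereal) \<Rightarrow> 'a topology" where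
  "valuation_topology R I w = topology (\<lambda>U. U \<subseteq> carrier R \<and>
     (\<forall>x\<in>U. \<exists>F M. finite F \<and> F \<subseteq> I \<and>
        {y \<in> carrier R. \<forall>i\<in>F. w i (y \<ominus>\<^bsub>R\<^esub> x) > ereal M} \<subseteq> U))"

lemma istopology_nbhds:
  assumes int: "\<And>a b x. a \<in> J \<Longrightarrow> b \<in> J \<Longrightarrow> \<exists>c\<in>J. B c x \<subseteq> B a x \<inter> B b x"
  shows "istopology (\<lambda>U. U \<subseteq> C \<and> (\<forall>x\<in>U. \<exists>a\<in>J. B a x \<subseteq> U))"
  unfolding istopology_def
proof (intro conjI allI impI ballI)
  fix S T x
  assume S: "S \<subseteq> C \<and> (\<forall>x\<in>S. \<exists>a\<in>J. B a x \<subseteq> S)" and T: "T \<subseteq> C \<and> (\<forall>x\<in>T. \<exists>a\<in>J. B a x \<subseteq> T)"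
  show "S \<inter> T \<subseteq> C" using S by blast
  assume x: "x \<in> S \<inter> T"
  obtain a where a: "a \<in> J" "B a x \<subseteq> S" using S x by blast
  obtain b where b: "b \<in> J" "B b x \<subseteq> T" using T x by blast
  obtain c where c: "c \<in> J" "B c x \<subseteq> B a x \<inter> B b x" using int[OF a(1) b(1)] by blast
  have "B c x \<subseteq> S \<inter> T" using a(2) b(2) c(2) by blast
  with c(1) show "\<exists>a\<in>J. B a x \<subseteq> S \<inter> T" by blast
next
  fix \<K> assume K: "\<forall>K\<in>\<K>. K \<subseteq> C \<and> (\<forall>x\<in>K. \<exists>a\<in>J. B a x \<subseteq> K)"
  then show "\<Union>\<K> \<subseteq> C" by blast
  fix x assume "x \<in> \<Union>\<K>"
  then obtain V where V: "V \<in> \<K>" "x \<in> V" by blast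
  with K obtain a where a: "a \<in> J" "B a x \<subseteq> V" by blast
  have "B a x \<subseteq> \<Union>\<K>" using a(2) V(1) by blast
  with a(1) show "\<exists>a\<in>J. B a x \<subseteq> \<Union>\<K>" by blast
qed

lemma openin_seminorm_topology:
  "openin (seminorm_topology R I q) U \<longleftrightarrow> U \<subseteq> carrier R \<and>
     (\<forall>x\<in>U. \<exists>F e. finite F \<and> F \<subseteq> I \<and> e > 0 \<and>
        {y \<in> carrier R. \<forall>i\<in>F. q i (y \<ominus>\<^bsub>R\<^esub> x) < e} \<subseteq> U)"
proof -
  define J where "J = {(F, e :: ennreal). finite F \<and> F \<subseteq> I \<and> e > 0}"
  define B where "B = (\<lambda>(F, e) x. {y \<in> carrier R. \<forall>i\<in>F. q i (y \<ominus>\<^bsub>R\<^esub> x) < e})"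
  have "istopology (\<lambda>U. U \<subseteq> carrier R \<and> (\<forall>x\<in>U. \<exists>a\<in>J. B a x \<subseteq> U))"
  proof (rule istopology_nbhds)
    fix a b x assume "a \<in> J" "b \<in> J"
    then have "(fst a \<union> fst b, min (snd a) (snd b)) \<in> J" by (auto simp: J_def)
    moreover have "B (fst a \<union> fst b, min (snd a) (snd b)) x \<subseteq> B a x \<inter> B b x"
      by (auto simp: B_def split: prod.splits)
    ultimately show "\<exists>c\<in>J. B c x \<subseteq> B a x \<inter> B b x" by (rule rev_bexI)
  qed
  note * = topology_inverse'[OF this]
  have eq: "(\<exists>a\<in>J. B a x \<subseteq> U) \<longleftrightarrow> (\<exists>F e. finite F \<and> F \<subseteq> I \<and> e > 0 \<and>
        {y \<in> carrier R. \<forall>i\<in>F. q i (y \<ominus>\<^bsub>R\<^esub> x) < e} \<subseteq> U)" for x U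
    unfolding J_def B_def by (simp add: Bex_def)
  show ?thesis using * unfolding eq seminorm_topology_def by simp
qed

lemma openin_valuation_topology:
  "openin (valuation_topology R I w) U \<longleftrightarrow> U \<subseteq> carrier R \<and>
     (\<forall>x\<in>U. \<exists>F M. finite F \<and> F \<subseteq> I \<and>
        {y \<in> carrier R. \<forall>i\<in>F. w i (y \<ominus>\<^bsub>R\<^esub> x) > ereal M} \<subseteq> U)"
proof -
  define J where "J = {(F, M :: real). finite F \<and> F \<subseteq> I}"
  define B where "B = (\<lambda>(F, M) x. {y \<in> carrier R. \<forall>i\<in>F. w i (y \<ominus>\<^bsub>R\<^esub> x) > ereal M})"
  have "istopology (\<lambda>U. U \<subseteq> carrier R \<and> (\<forall>x\<in>U. \<exists>a\<in>J. B a x \<subseteq> U))"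
  proof (rule istopology_nbhds)
    fix a b x assume "a \<in> J" "b \<in> J"
    then have "(fst a \<union> fst b, max (snd a) (snd b)) \<in> J" by (auto simp: J_def)
    moreover have "B (fst a \<union> fst b, max (snd a) (snd b)) x \<subseteq> B a x \<inter> B b x"
      by (auto simp: B_def split: prod.splits)
    ultimately show "\<exists>c\<in>J. B c x \<subseteq> B a x \<inter> B b x" by (rule rev_bexI)
  qed
  note * = topology_inverse'[OF this]
  have eq: "(\<exists>a\<in>J. B a x \<subseteq> U) \<longleftrightarrow> (\<exists>F M. finite F \<and> F \<subseteq> I \<and>
        {y \<in> carrier R. \<forall>i\<in>F. w i (y \<ominus>\<^bsub>R\<^esub> x) > ereal M} \<subseteq> U)" for x U
    unfolding J_def B_def by (simp add: Bex_def)
  show ?thesis using * unfolding eq valuation_topology_def by simp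
qed

text \<open>Completeness of a topological abelian group: every Cauchy filter converges.\<close>

definition complete_group_topology :: "('a, 'm) ring_scheme \<Rightarrow> 'a topology \<Rightarrow> bool" where
  "complete_group_topology R T \<longleftrightarrow>
     (\<forall>F. F \<noteq> bot \<and> eventually (\<lambda>x. x \<in> carrier R) F \<and>
        (\<forall>U. openin T U \<and> \<zero>\<^bsub>R\<^esub> \<in> U \<longrightarrow>
           (\<exists>P. eventually P F \<and> (\<forall>x y. P x \<and> P y \<longrightarrow> x \<ominus>\<^bsub>R\<^esub> y \<in> U)))
      \<longrightarrow> (\<exists>l. limitin T (\<lambda>x. x) l F))"

text \<open>A commutative ring with a family of finite, non-archimedean, submultiplicative seminorms.\<close>

definition multivalued_ring ::
  "('a, 'm) ring_scheme \<Rightarrow> 'i set \<Rightarrow> ('i \<Rightarrow> 'a \<Rightarrow> ennreal) \<Rightarrow> bool" where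
  "multivalued_ring R I q \<longleftrightarrow> cring R \<and>
     (\<forall>i\<in>I. q i \<zero>\<^bsub>R\<^esub> = 0 \<and> q i \<one>\<^bsub>R\<^esub> \<le> 1 \<and>
        (\<forall>x\<in>carrier R. q i x < \<infinity>) \<and>
        (\<forall>x\<in>carrier R. \<forall>y\<in>carrier R. q i (x \<ominus>\<^bsub>R\<^esub> y) \<le> max (q i x) (q i y)) \<and>
        (\<forall>x\<in>carrier R. \<forall>y\<in>carrier R. q i (x \<otimes>\<^bsub>R\<^esub> y) \<le> q i x * q i y))"

text \<open>\<open>is_completion A I q B q' \<iota>\<close>: the multivalued ring \<open>(B, q')\<close> is separated and complete,
  and \<open>\<iota>\<close> is a ring homomorphism from \<open>A\<close> onto a dense subring of \<open>B\<close> which preserves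
  every seminorm of the family.\<close>

definition is_completion ::
  "('a, 'm) ring_scheme \<Rightarrow> 'i set \<Rightarrow> ('i \<Rightarrow> 'a \<Rightarrow> ennreal) \<Rightarrow>
   ('b, 'n) ring_scheme \<Rightarrow> ('i \<Rightarrow> 'b \<Rightarrow> ennreal) \<Rightarrow> ('a \<Rightarrow> 'b) \<Rightarrow> bool" where
  "is_completion A I q B q' \<iota> \<longleftrightarrow>
     multivalued_ring A I q \<and> multivalued_ring B I q' \<and>
     \<iota> \<in> ring_hom A B \<and>
     (\<forall>i\<in>I. \<forall>a\<in>carrier A. q' i (\<iota> a) = q i a) \<and>
     seminorm_topology B I q' closure_of (\<iota> ` carrier A) = carrier B \<and>
     Hausdorff_space (seminorm_topology B I q') \<and>
     complete_group_topology B (seminorm_topology B I q')"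

section \<open>The fields of p-adic numbers\<close>

definition vabs :: "'c :: {zero, metric_space} \<Rightarrow> real" where
  "vabs x = dist x 0"

definition Qp :: "'c :: {field_char_0, metric_space} set" where
  "Qp = closure (range of_rat)"

definition Zp :: "'c :: {field_char_0, metric_space} set" where
  "Zp = {x \<in> Qp. vabs x \<le> 1}"

text \<open>The type \<open>'c\<close>, with its metric, is the completion of an algebraic closure of \<open>Q_p\<close>, with
  the absolute value normalized by \<open>|p| = 1/p\<close>. By the sort constraint, \<open>'c\<close> is an
  algebraically closed field of characteristic 0 and is complete. As the absolute value
  restricts to the p-adic one on the rational numbers, the closure \<open>Qp\<close> of the latter is
  their p-adic completion.\<close>

definition is_Cp :: "nat \<Rightarrow> 'c :: {alg_closed_field, field_char_0, complete_space} itself \<Rightarrow> bool"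
  where
  "is_Cp p _ \<longleftrightarrow>
     (\<forall>x y :: 'c. dist x y = vabs (x - y)) \<and>
     (\<forall>x y :: 'c. vabs (x * y) = vabs x * vabs y) \<and>
     (\<forall>x y :: 'c. vabs (x + y) \<le> max (vabs x) (vabs y)) \<and>
     vabs (of_nat p :: 'c) = 1 / real p \<and>
     closure {x :: 'c. \<exists>f. f \<noteq> 0 \<and> (\<forall>n. Polynomial.coeff f n \<in> Qp) \<and> Polynomial.poly f x = 0} = UNIV"

definition vp :: "nat \<Rightarrow> 'c :: {zero, metric_space} \<Rightarrow> ereal" where
  "vp p x = (if x = 0 then \<infinity> else ereal (- log (real p) (vabs x)))"

definition pball :: "nat \<Rightarrow> int \<Rightarrow> 'c :: {field_char_0, metric_space} set" where
  "pball p r = (\<lambda>x. of_nat p powi r * x) ` Zp"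

definition Qp_ring :: "'c :: {field_char_0, metric_space} ring" where
  "Qp_ring = \<lparr>carrier = Qp, mult = (*), one = 1, zero = 0, add = (+)\<rparr>"

definition Zp_ring :: "'c :: {field_char_0, metric_space} ring" where
  "Zp_ring = \<lparr>carrier = Zp, mult = (*), one = 1, zero = 0, add = (+)\<rparr>"

definition supnorm :: "'x set \<Rightarrow> ('x \<Rightarrow> 'c :: {zero, metric_space}) \<Rightarrow> ennreal" where
  "supnorm X f = (SUP x\<in>X. ennreal (vabs (f x)))"

text \<open>A Frechet algebra over a subring \<open>R\<close> of the valued field \<open>'c\<close>: a complete separated
  topological \<open>R\<close>-algebra whose topology is defined by a countable family of seminorms.\<close>

definition Frechet_algebra ::
  "('c :: {zero, metric_space}, 'm) ring_scheme \<Rightarrow> ('c, 'b, 'n) module_scheme \<Rightarrow> 'b topology \<Rightarrow> bool"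
  where
  "Frechet_algebra R B T \<longleftrightarrow> Module.algebra R B \<and>
     (\<exists>q :: nat \<Rightarrow> 'b \<Rightarrow> ennreal. multivalued_ring B UNIV q \<and>
        (\<forall>n. \<forall>a\<in>carrier R. \<forall>x\<in>carrier B. q n (a \<odot>\<^bsub>B\<^esub> x) \<le> ennreal (vabs a) * q n x) \<and>
        T = seminorm_topology B UNIV q) \<and>
     Hausdorff_space T \<and> complete_group_topology B T"

section \<open>Entire functions\<close>

definition fps_eval :: "'c :: {field, metric_space} fps \<Rightarrow> 'c \<Rightarrow> 'c" where
  "fps_eval f x = (\<Sum>n. fps_nth f n * x ^ n)"

text \<open>The type \<open>'c\<close> plays the role of \<open>C_p\<close>, so the series converge on all of \<open>C_p\<close>.\<close>

definition entire_alg :: "('c, 'c :: {field_char_0, metric_space} fps) module" where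
  "entire_alg = \<lparr>
     carrier = {f. (\<forall>n. fps_nth f n \<in> Qp) \<and> (\<forall>x. summable (\<lambda>n. fps_nth f n * x ^ n))},
     mult = (*), one = 1, zero = 0, add = (+),
     smult = (\<lambda>c f. fps_const c * f)\<rparr>"

definition w_val :: "nat \<Rightarrow> int \<Rightarrow> 'c :: {field_char_0, metric_space} fps \<Rightarrow> ereal" where
  "w_val p r f = (INF x \<in> (\<lambda>x. of_nat p powi (- r) * x) ` {x :: 'c. vabs x \<le> 1}. vp p (fps_eval f x))"

definition entire_topology :: "nat \<Rightarrow> 'c :: {field_char_0, metric_space} fps topology" where
  "entire_topology p = valuation_topology entire_alg UNIV (w_val p)"

section \<open>The function Psi and the rings generated by it\<close>

definition fps_scale :: "'a :: comm_ring_1 \<Rightarrow> 'a fps \<Rightarrow> 'a fps" where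
  "fps_scale c f = f oo (fps_const c * fps_X)"

definition fps_of_int :: "int fps \<Rightarrow> 'a :: ring_1 fps" where
  "fps_of_int f = Abs_fps (\<lambda>n. of_int (fps_nth f n))"

text \<open>The infinite sum is taken in the T-adic topology of the ring of formal power series
  over the rational numbers (the metric topology which the library puts on type \<open>fps\<close>).\<close>

definition is_Psi :: "nat \<Rightarrow> int fps \<Rightarrow> bool" where
  "is_Psi p f \<longleftrightarrow> fps_nth f 0 = 0 \<and> fps_nth f 1 = 1 \<and>
     (\<lambda>j. fps_const (1 / of_nat p ^ j) *
        fps_scale (of_nat p ^ j) (fps_of_int f) ^ (p ^ j)) sums (fps_X :: rat fps)"

definition Psi :: "nat \<Rightarrow> int fps" where
  "Psi p = (THE f. is_Psi p f)"

definition E_gens :: "nat \<Rightarrow> 'c :: {field_char_0, metric_space} fps set" where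
  "E_gens p = {fps_scale (inverse l * of_nat p ^ j) (fps_of_int (Psi p)) | l j. l \<in> Qp \<and> l \<noteq> 0}"

definition E_int :: "nat \<Rightarrow> 'c :: {field_char_0, metric_space} fps set" where
  "E_int p = entire_topology p closure_of
     generate_ring entire_alg (fps_const ` Zp \<union> E_gens p)"

definition E_bd :: "nat \<Rightarrow> 'c :: {field_char_0, metric_space} fps set" where
  "E_bd p = {fps_const (1 / of_nat p ^ n) * f | n f. f \<in> E_int p}"

definition E_int_alg :: "nat \<Rightarrow> ('c, 'c :: {field_char_0, metric_space} fps) module" where
  "E_int_alg p = entire_alg\<lparr>carrier := E_int p\<rparr>"

definition E_bd_alg :: "nat \<Rightarrow> ('c, 'c :: {field_char_0, metric_space} fps) module" where
  "E_bd_alg p = entire_alg\<lparr>carrier := E_bd p\<rparr>"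

section \<open>Continuous functions\<close>

text \<open>Functions on \<open>Qp\<close> are represented as extensional functions on \<open>'c\<close>.\<close>

definition cont_alg ::
  "'c set \<Rightarrow> ('c, 'c \<Rightarrow> 'c :: {field_char_0, metric_space}) module" where
  "cont_alg Y = \<lparr>
     carrier = {f \<in> Qp \<rightarrow>\<^sub>E Y. continuous_on Qp f},
     mult = (\<lambda>f g. \<lambda>x\<in>Qp. f x * g x), one = (\<lambda>x\<in>Qp. 1),
     zero = (\<lambda>x\<in>Qp. 0), add = (\<lambda>f g. \<lambda>x\<in>Qp. f x + g x),
     smult = (\<lambda>c f. \<lambda>x\<in>Qp. c * f x)\<rparr>"

text \<open>The topology of uniform convergence on compact subsets of \<open>Qp\<close>.\<close>

definition cont_topology ::
  "'c set \<Rightarrow> ('c \<Rightarrow> 'c :: {field_char_0, metric_space}) topology" where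
  "cont_topology Y = seminorm_topology (cont_alg Y) {K. compact K \<and> K \<subseteq> Qp} supnorm"

definition restr :: "'c fps \<Rightarrow> 'c \<Rightarrow> 'c :: {field_char_0, metric_space}" where
  "restr f = (\<lambda>x\<in>Qp. fps_eval f x)"

text \<open>\<open>E\<close> is an \<open>R\<close>-algebra of entire functions and \<open>cont_alg Y\<close> is a Frechet \<open>R\<close>-algebra
  for the topology of uniform convergence on compact subsets; restriction to \<open>Qp\<close> is
  \<open>R\<close>-linear and exhibits \<open>cont_alg Y\<close> as the completion of \<open>E\<close> with respect to the sup-norms
  on the balls \<open>p^r Z_p\<close>; and the topology which \<open>cont_alg Y\<close> thereby receives is again that of
  uniform convergence on compact subsets.\<close>

definition completion_is_cont_alg ::
  "nat \<Rightarrow> 'c ring \<Rightarrow> ('c, 'c fps) module \<Rightarrow> 'c :: {field_char_0, metric_space} set \<Rightarrow> bool" where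
  "completion_is_cont_alg p R E Y \<longleftrightarrow>
     Module.algebra R E \<and>
     Frechet_algebra R (cont_alg Y) (cont_topology Y) \<and>
     is_completion E UNIV (\<lambda>r :: int. \<lambda>f. supnorm (pball p r) (fps_eval f))
       (cont_alg Y) (\<lambda>r. supnorm (pball p r)) restr \<and>
     (\<forall>c\<in>carrier R. \<forall>f\<in>carrier E.
        restr (c \<odot>\<^bsub>E\<^esub> f) = c \<odot>\<^bsub>cont_alg Y\<^esub> restr f) \<and>
     seminorm_topology (cont_alg Y) UNIV (\<lambda>r :: int. supnorm (pball p r)) = cont_topology Y"

end

(*
  Write a_j = Psi (p^j x). Comparing the functional equation of Psi at x, multiplied by p, with the
  one at p x expresses p a_0 as a sum of terms (a^(p^j) - a^(p^(j-1))) / p^(j-1), all divisible by p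
  as soon as a_1, a_2, ... are integral; hence Psi (Q_p) is contained in Z_p. Similarly, if
  Psi (p^j x) = Psi (p^j y) modulo p for all j >= 1, then x - y = Psi x - Psi y modulo p. So for x in
  p^(-k) Z_p the residues of a_0, ..., a_k modulo p determine, and are determined by, the class of x
  modulo p. By Fermat's little theorem the indicator function of a coset of a small ball is therefore
  congruent modulo p, on a larger ball, to a polynomial in rescaled copies of Psi. This approximates
  continuous Z_p-valued functions modulo p on a ball, and iteration approximates them modulo p^N.
*)

theory Submission
  imports Defs "HOL-Number_Theory.Residues" "HOL-Analysis.Elementary_Metric_Spaces"
begin

unbundle fps_syntax

section \<open>Existence and uniqueness of \<open>\<Psi>\<close>\<close>

text \<open>Congruences modulo p^N are expressed as inequalities |.| <= 1 / p^N. What drives both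
  arguments about values of Psi is a gain of one factor: raising to the power p^j turns a congruence
  modulo p into one modulo p^(j+1), whereas the functional equation divides by p^j only. The
  equation itself is used in truncated form, with an explicit error. That Psi is entire is derived
  from it as well: the j-th term at radius p^k involves Psi at radius p^(k-j) only, which allows
  strong induction on the radius. Density is obtained inside the ring of polynomials in rescaled
  copies of Psi, before any closure is taken; a function with values in Q_p is reduced to this case
  by clearing a power of p on one ball. The topological half rests on two facts: the balls p^(-k)
  Z_p are cofinal among the compact subsets of Q_p, and limits that are uniform on each of these
  balls stay continuous, with values in the same closed subring.\<close>

lemma fps_nth_power_eq_0:
  fixes f :: "'a::comm_ring_1 fps"
  assumes "f $ 0 = 0" "n < k"
  shows "(f ^ k) $ n = 0"
  using startsby_zero_power_prefix[OF assms(1)] assms(2) by blast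

text \<open>In f^k - g^k = (f - g) S every summand of S has a factor with zero constant term,
  because k >= 2. So coefficient n of f - g is multiplied by 0. This turns the functional equation
  into a recursion for the coefficients.\<close>

lemma fps_nth_power_cong:
  fixes f g :: "'a::comm_ring_1 fps"
  assumes 0: "f $ 0 = 0" "g $ 0 = 0" and eq: "\<And>m. m < n \<Longrightarrow> f $ m = g $ m" and k: "k \<ge> 2"
  shows "(f ^ k) $ n = (g ^ k) $ n"
proof -
  define S where "S = (\<Sum>i<k. g ^ (k - Suc i) * f ^ i)"
  have "(g ^ (k - Suc i) * f ^ i) $ 0 = 0" if "i < k" for i
    using that k 0 by (cases "i = 0") (auto simp: fps_power_zeroth power_0_left)
  then have S0: "S $ 0 = 0"
    unfolding S_def fps_sum_nth by (intro sum.neutral) auto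
  have "f ^ k - g ^ k = (f - g) * S"
    unfolding S_def by (rule power_diff_sumr2)
  then have "(f ^ k - g ^ k) $ n = (\<Sum>i=0..n. (f - g) $ i * S $ (n - i))"
    by (simp add: fps_mult_nth)
  also have "\<dots> = 0"
  proof (intro sum.neutral ballI)
    fix i assume "i \<in> {0..n}"
    then show "(f - g) $ i * S $ (n - i) = 0"
      using eq S0 by (cases "i = n") auto
  qed
  finally show ?thesis by simp
qed

lemma less_power: "(n::nat) < p ^ j" if "p \<ge> 2" "n < j"
  using that less_exp[of j] power_mono[of 2 p j] by linarith

lemma fps_scale_nth: "fps_scale c f $ n = c ^ n * f $ n"
  unfolding fps_scale_def by (simp add: fps_compose_linear)

lemma fps_scale_power: "fps_scale c f ^ k = fps_scale (c::'a::idom) (f ^ k)"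
  unfolding fps_scale_def by (simp add: fps_compose_power)

lemma fps_of_int_nth [simp]: "fps_of_int f $ n = of_int (f $ n)"
  by (simp add: fps_of_int_def)

lemma fps_of_int_power: "fps_of_int (f ^ k) = (fps_of_int f :: 'a::comm_ring_1 fps) ^ k"
proof (induction k)
  case 0
  show ?case by (rule fps_ext) simp
next
  case (Suc k)
  have "fps_of_int (f * g) = (fps_of_int f * fps_of_int g :: 'a fps)" for f g
    by (rule fps_ext) (simp add: fps_mult_nth)
  with Suc show ?case by simp
qed

text \<open>Coefficient n of the j-th summand carries p^(jn) from the rescaling and p^(-j) from the
  factor in front, hence the integral weight p^(j(n-1)). Summands with j > n contribute nothing, as
  their order is at least p^j > n; so the convergent series amounts to a family of finite integer
  identities.\<close>

lemma is_Psi_iff: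
  assumes p: "p \<ge> 2"
  shows "is_Psi p f \<longleftrightarrow> f $ 0 = 0 \<and> f $ 1 = 1 \<and>
    (\<forall>n\<ge>1. (\<Sum>j\<le>n. int p ^ (j * (n - 1)) * (f ^ (p ^ j)) $ n) = (if n = 1 then 1 else 0))"
proof (cases "f $ 0 = 0")
  case f0: True
  define t :: "nat \<Rightarrow> rat fps" where
    "t j = fps_const (1 / of_nat p ^ j) * fps_scale (of_nat p ^ j) (fps_of_int f) ^ (p ^ j)" for j
  have p0: "(of_nat p :: rat) \<noteq> 0" using p by auto
  have t: "t j $ n = of_int (int p ^ (j * (n - 1)) * (f ^ (p ^ j)) $ n)" if "n \<ge> 1" for j n
  proof -
    have "(of_nat p ^ j) ^ n = (of_nat p ^ j * of_nat p ^ (j * (n - 1)) :: rat)"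
      using that by (cases n) (auto simp: power_mult power_add simp flip: power_mult power_Suc)
    then show ?thesis using p0
      by (simp add: t_def fps_scale_power fps_scale_nth flip: fps_of_int_power)
  qed
  have t0: "t j $ 0 = 0" for j
    using f0 p by (simp add: t_def fps_scale_power fps_scale_nth flip: fps_of_int_power)
  have tz: "t j $ n = 0" if "j > n" for j n
  proof (cases "n = 0")
    case False
    have "n < p ^ j" using that less_power[OF p] by blast
    then show ?thesis using False f0 by (simp add: t fps_nth_power_eq_0)
  qed (simp add: t0)
  have stab: "(\<Sum>j<N. t j $ n) = (\<Sum>j\<le>n. t j $ n)" if "N > n" for N n
    by (rule sum.mono_neutral_right) (use that tz in auto)
  \<comment> \<open>Convergence in the metric of \<open>fps\<close> means that each coefficient is
    eventually constant; by \<open>stab\<close> coefficient n is constant from N = n + 1 on.\<close>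
  have lim: "t sums fps_X \<longleftrightarrow> (\<forall>n. (\<Sum>j\<le>n. t j $ n) = fps_X $ n)"
  proof
    assume "t sums fps_X"
    then have *: "\<forall>n. \<forall>\<^sub>F N in sequentially. (\<Sum>j<N. t j $ n) = fps_X $ n"
      unfolding sums_def tendsto_fps_iff by (simp add: fps_sum_nth)
    show "\<forall>n. (\<Sum>j\<le>n. t j $ n) = fps_X $ n"
    proof
      fix n
      have "\<forall>\<^sub>F N in sequentially. (\<Sum>j\<le>n. t j $ n) = fps_X $ n"
        using *[rule_format, of n] eventually_gt_at_top[of n]
        by eventually_elim (simp add: stab)
      then show "(\<Sum>j\<le>n. t j $ n) = fps_X $ n" by simp
    qed
  next
    assume *: "\<forall>n. (\<Sum>j\<le>n. t j $ n) = fps_X $ n"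
    have "\<forall>\<^sub>F N in sequentially. (\<Sum>j<N. t j $ n) = fps_X $ n" for n
      using eventually_gt_at_top[of n] by eventually_elim (simp add: stab *)
    then show "t sums fps_X"
      unfolding sums_def tendsto_fps_iff by (simp add: fps_sum_nth)
  qed
  have eq: "((\<Sum>j\<le>n. t j $ n) = fps_X $ n) \<longleftrightarrow>
     (\<Sum>j\<le>n. int p ^ (j * (n - 1)) * (f ^ (p ^ j)) $ n) = (if n = 1 then 1 else 0)" if "n \<ge> 1" for n
  proof -
    have "(\<Sum>j\<le>n. t j $ n) = of_int (\<Sum>j\<le>n. int p ^ (j * (n - 1)) * (f ^ (p ^ j)) $ n)"
      using that by (simp add: t)
    moreover have "(fps_X $ n :: rat) = of_int (if n = 1 then 1 else 0)"
      by (simp add: fps_X_def)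
    ultimately show ?thesis by (simp only: of_int_eq_iff)
  qed
  have "(\<forall>n. (\<Sum>j\<le>n. t j $ n) = fps_X $ n) \<longleftrightarrow> (\<forall>n\<ge>1. (\<Sum>j\<le>n. t j $ n) = fps_X $ n)"
    (is "_ \<longleftrightarrow> ?R")
  proof
    assume R: ?R
    show "\<forall>n. (\<Sum>j\<le>n. t j $ n) = fps_X $ n"
    proof
      fix n show "(\<Sum>j\<le>n. t j $ n) = fps_X $ n"
        using R by (cases "n = 0") (auto simp: t0)
    qed
  qed auto
  then show ?thesis
    unfolding is_Psi_def using lim eq f0 unfolding t_def by auto
qed (simp add: is_Psi_def)

text \<open>The recursion obtained by comparing coefficients of \<open>T\<^sup>n\<close> in the functional equation. It is
  integral because the power of \<open>p\<close> occurring in the \<open>j\<close>-th summand is \<open>p\<^bsup>jn - j\<^esup>\<close>.\<close>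

function psi_coeff :: "nat \<Rightarrow> nat \<Rightarrow> int" where
  "psi_coeff p n = (if n \<le> 1 then int n
     else - (\<Sum>j=1..n. int p ^ (j * (n - 1)) *
       (Abs_fps (\<lambda>m. if m < n then psi_coeff p m else 0) ^ (p ^ j)) $ n))"
  by auto
termination by (relation "measure snd") auto

declare psi_coeff.simps [simp del]

lemma ex_Psi:
  assumes p: "p \<ge> 2"
  shows "is_Psi p (Abs_fps (psi_coeff p))"
proof -
  define f where "f = Abs_fps (psi_coeff p)"
  have f0: "f $ 0 = 0" and f1: "f $ 1 = 1" by (simp_all add: f_def psi_coeff.simps)
  have "(\<Sum>j\<le>n. int p ^ (j * (n - 1)) * (f ^ (p ^ j)) $ n) = (if n = 1 then 1 else 0)" if n: "n \<ge> 1" for n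
  proof -
    have split: "(\<Sum>j\<le>n. int p ^ (j * (n - 1)) * (f ^ (p ^ j)) $ n)
        = f $ n + (\<Sum>j=1..n. int p ^ (j * (n - 1)) * (f ^ (p ^ j)) $ n)"
      by (simp add: atMost_atLeast0 sum.atLeast_Suc_atMost)
    \<comment> \<open>The truncation occurring in the recursion of \<open>psi_coeff\<close>.
      Replacing \<open>f\<close> by it leaves coefficient n of the powers unchanged, since the
      exponents p^j with j >= 1 are at least 2.\<close>
    define g where "g = Abs_fps (\<lambda>m. if m < n then psi_coeff p m else 0)"
    have pj: "p ^ j \<ge> 2" if "j \<ge> 1" for j
      using power_increasing[OF that, of p] p by simp
    have cong: "(f ^ (p ^ j)) $ n = (g ^ (p ^ j)) $ n" if "j \<ge> 1" for j
      by (rule fps_nth_power_cong) (use pj[OF that] n in \<open>auto simp: f_def g_def psi_coeff.simps\<close>)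
    show ?thesis
    proof (cases "n = 1")
      case True
      \<comment> \<open>For n = 1 the value of \<open>psi_coeff\<close> does not come from the
        recursion, so the identity is checked directly: f^p starts in degree p > 1.\<close>
      have "(f ^ (p ^ 1)) $ 1 = 0" using p f0 by (intro fps_nth_power_eq_0) auto
      with True show ?thesis using split f1 by simp
    next
      case False
      with n have "f $ n = - (\<Sum>j=1..n. int p ^ (j * (n - 1)) * (g ^ (p ^ j)) $ n)"
        unfolding f_def g_def fps_nth_Abs_fps by (subst psi_coeff.simps) simp
      with split False show ?thesis by (simp add: cong)
    qed
  qed
  with f0 f1 show ?thesis
    unfolding f_def[symmetric] is_Psi_iff[OF p] by auto
qed

text \<open>The summand j = 0 is the coefficient itself, and the others see only lower coefficients
  by \<open>fps_nth_power_cong\<close>.\<close>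

lemma Psi_unique:
  assumes p: "p \<ge> 2" and f: "is_Psi p f" and g: "is_Psi p g"
  shows "f = g"
proof (rule fps_ext)
  fix n
  show "f $ n = g $ n"
  proof (induction n rule: less_induct)
    case (less n)
    show ?case
    proof (cases "n = 0")
      case True
      with f g show ?thesis by (simp add: is_Psi_def)
    next
      case False
      then have n: "n \<ge> 1" by simp
      have split: "(\<Sum>j\<le>n. int p ^ (j * (n - 1)) * (f ^ (p ^ j)) $ n)
        = f $ n + (\<Sum>j=1..n. int p ^ (j * (n - 1)) * (f ^ (p ^ j)) $ n)" for f
        by (simp add: atMost_atLeast0 sum.atLeast_Suc_atMost)
      have pj: "p ^ j \<ge> 2" if "j \<ge> 1" for j
        using power_increasing[OF that, of p] p by simp
      have "(f ^ (p ^ j)) $ n = (g ^ (p ^ j)) $ n" if "j \<ge> 1" for j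
        by (rule fps_nth_power_cong) (use pj[OF that] less f g in \<open>auto simp: is_Psi_def\<close>)
      then have "(\<Sum>j=1..n. int p ^ (j * (n - 1)) * (f ^ (p ^ j)) $ n)
          = (\<Sum>j=1..n. int p ^ (j * (n - 1)) * (g ^ (p ^ j)) $ n)"
        by (intro sum.cong) auto
      moreover have "(\<Sum>j\<le>n. int p ^ (j * (n - 1)) * (f ^ (p ^ j)) $ n) =
          (\<Sum>j\<le>n. int p ^ (j * (n - 1)) * (g ^ (p ^ j)) $ n)"
        using f g n unfolding is_Psi_iff[OF p] by simp
      ultimately show ?thesis
        by (simp only: split add_right_cancel)
    qed
  qed
qed

lemma is_Psi_Psi: "p \<ge> 2 \<Longrightarrow> is_Psi p (Psi p)"
  unfolding Psi_def by (rule theI[of "is_Psi p", OF ex_Psi]) (auto intro: Psi_unique ex_Psi)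

lemma Psi_0 [simp]: "p \<ge> 2 \<Longrightarrow> Psi p $ 0 = 0"
  using is_Psi_Psi[of p] by (auto simp: is_Psi_def)

text \<open>A single bound N serves all degrees n <= N at once, as a truncation of the series at j =
  N requires. The additional summands vanish because p^j > n.\<close>

lemma Psi_coeff_identity:
  assumes p: "p \<ge> 2" and "n \<ge> 1" and N: "n \<le> N"
  shows "(\<Sum>j\<le>N. int p ^ (j * (n - 1)) * (Psi p ^ (p ^ j)) $ n) = (if n = 1 then 1 else 0)"
proof -
  have "(\<Sum>j\<le>N. int p ^ (j * (n - 1)) * (Psi p ^ (p ^ j)) $ n) =
      (\<Sum>j\<le>n. int p ^ (j * (n - 1)) * (Psi p ^ (p ^ j)) $ n)"
  proof (rule sum.mono_neutral_right)
    show "\<forall>j\<in>{..N} - {..n}. int p ^ (j * (n - 1)) * (Psi p ^ (p ^ j)) $ n = 0"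
    proof
      fix j assume "j \<in> {..N} - {..n}"
      then have "n < p ^ j" using less_power[OF p] by simp
      then show "int p ^ (j * (n - 1)) * (Psi p ^ (p ^ j)) $ n = 0"
        using p by (simp add: fps_nth_power_eq_0)
    qed
  qed (use N in auto)
  then show ?thesis
    using is_Psi_Psi[OF p] assms unfolding is_Psi_iff[OF p] by simp
qed

section \<open>The valued field\<close>

text \<open>The sort provides a complete metric and a field, without relating them; the relation
  comes from \<open>dist_vabs\<close> and the ultrametric axioms. Continuity of the field operations
  is therefore derived from the absolute value below.\<close>

locale padic_field =
  fixes p :: nat and C :: "'c :: {field_char_0, complete_space} itself"
  assumes prime_p: "prime p"
    and dist_vabs: "dist (x :: 'c) y = vabs (x - y)"
    and vabs_mult: "vabs ((x :: 'c) * y) = vabs x * vabs y"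
    and vabs_add: "vabs ((x :: 'c) + y) \<le> max (vabs x) (vabs y)"
    and vabs_p: "vabs (of_nat p :: 'c) = 1 / real p"
begin

abbreviation v :: "'c \<Rightarrow> real" where "v \<equiv> vabs"
abbreviation Q :: "'c set" where "Q \<equiv> Qp"
abbreviation Z :: "'c set" where "Z \<equiv> Zp"

lemma p_ge_2: "p \<ge> 2"
  using prime_p by (rule prime_ge_2_nat)

lemma p_pos [simp]: "0 < p" and p_gt_1 [simp]: "1 < p" and p_neq_0 [simp]: "p \<noteq> 0"
  using p_ge_2 by auto

lemma real_p_ge_2: "real p \<ge> 2"
  using p_ge_2 by simp

lemma v_nonneg [simp]: "0 \<le> v x"
  and v_0 [simp]: "v 0 = 0"
  and v_eq_0 [simp]: "v x = 0 \<longleftrightarrow> x = 0"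
  by (auto simp: vabs_def)

lemma v_pos [simp]: "0 < v x \<longleftrightarrow> x \<noteq> 0"
  by (auto simp: vabs_def)

lemma v_1 [simp]: "v 1 = 1"
proof -
  have "v 1 * v 1 = v 1" using vabs_mult[of 1 1] by simp
  then show ?thesis by simp
qed

lemma v_minus [simp]: "v (- x) = v x"
proof -
  have "v (- 1) * v (- 1) = 1" using vabs_mult[of "-1" "-1"] by simp
  then have "v (- 1) ^ 2 = 1" by (simp only: power2_eq_square)
  then have "v (- 1) = 1" using v_nonneg[of "-1"] by (simp add: power2_eq_1_iff)
  then show ?thesis using vabs_mult[of "-1" x] by simp
qed

lemma v_commute: "v (x - y) = v (y - x)"
  using v_minus[of "x - y"] by simp

lemma v_diff: "v (x - y) \<le> max (v x) (v y)"
  using vabs_add[of x "- y"] by simp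

lemma v_add_le: "v x \<le> B \<Longrightarrow> v y \<le> B \<Longrightarrow> v (x + y) \<le> B"
  using vabs_add[of x y] by linarith

lemma v_diff_le: "v x \<le> B \<Longrightarrow> v y \<le> B \<Longrightarrow> v (x - y) \<le> B"
  using v_diff[of x y] by linarith

lemma v_trans_le: "v (x - y) \<le> B \<Longrightarrow> v (y - z) \<le> B \<Longrightarrow> v (x - z) \<le> B"
  using v_add_le[of "x - y" B "y - z"] by simp

lemma v_trans_less: "v (x - y) < B \<Longrightarrow> v (y - z) < B \<Longrightarrow> v (x - z) < B"
  using vabs_add[of "x - y" "y - z"] by simp

lemma v_power: "v (x ^ n) = v x ^ n"
  by (induction n) (auto simp: vabs_mult)

lemma v_inverse: "v (inverse x) = inverse (v x)"
proof (cases "x = 0")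
  case False
  then have "v x * v (inverse x) = 1" by (simp flip: vabs_mult)
  with False show ?thesis by (simp add: field_simps)
qed simp

lemma v_divide: "v (x / y) = v x / v y"
  by (simp add: divide_inverse vabs_mult v_inverse)

lemma v_powi: "v (x powi n) = v x powi n"
  by (simp add: power_int_def v_power v_inverse)

lemma v_sum_le:
  assumes "\<And>i. i \<in> A \<Longrightarrow> v (f i) \<le> B" "0 \<le> B"
  shows "v (sum f A) \<le> B"
  using assms by (induction A rule: infinite_finite_induct) (auto intro!: v_add_le)

lemma v_prod_le:
  assumes "\<And>i. i \<in> A \<Longrightarrow> v (f i) \<le> 1"
  shows "v (prod f A) \<le> 1"
  using assms by (induction A rule: infinite_finite_induct) (auto simp: vabs_mult mult_le_one)

lemma v_of_nat_le: "v (of_nat n) \<le> 1"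
  by (induction n) (auto intro: v_add_le)

lemma v_of_int_le: "v (of_int n) \<le> 1"
  by (cases n rule: int_cases2) (auto simp: v_of_nat_le)

lemma v_eqI:
  assumes "\<And>e. e > 0 \<Longrightarrow> v (x - y) \<le> e"
  shows "x = y"
proof -
  have "v (x - y) \<le> 0" by (rule field_le_epsilon) (use assms in auto)
  then have "v (x - y) = 0" using v_nonneg[of "x - y"] by linarith
  then show ?thesis by simp
qed

lemma v_isosceles: "v (x - y) < v x \<Longrightarrow> v y = v x"
  using v_diff[of x "x - y"] vabs_add[of "x - y" y] by auto

lemma v_of_int_dvd:
  assumes "int p ^ k dvd n" shows "v (of_int n) \<le> 1 / real p ^ k"
proof -
  from assms obtain m where "n = int p ^ k * m" by blast
  then have "v (of_int n) = (1 / real p) ^ k * v (of_int m)"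
    by (simp add: vabs_mult v_power vabs_p)
  also have "\<dots> \<le> (1 / real p) ^ k * 1"
    by (rule mult_left_mono) (auto simp: v_of_int_le)
  finally show ?thesis by (simp add: power_one_over)
qed

lemma inv_p_less_1: "1 / real p < 1"
  using real_p_ge_2 by (simp add: field_simps)

lemma inv_p_power_le_1: "1 / real p ^ k \<le> 1"
  using real_p_ge_2 by (simp add: field_simps)

text \<open>The absolute value is prescribed at p only, and Bezout determines it on integers prime
  to p: if |n| < 1, both summands of a p + b n = 1 would have absolute value below 1.\<close>

lemma v_of_int_coprime:
  assumes "\<not> int p dvd n" shows "v (of_int n) = 1"
proof (rule ccontr)
  assume "v (of_int n) \<noteq> 1"
  then have less: "v (of_int n) < 1" using v_of_int_le[of n] by simp
  have "coprime (int p) n" using assms prime_p by (intro prime_imp_coprime) auto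
  then obtain a b where "a * int p + b * n = 1"
    by (metis bezout_int coprime_iff_gcd_eq_1)
  then have "(of_int (a * int p + b * n) :: 'c) = 1" by simp
  then have 1: "of_int a * of_nat p + of_int b * of_int n = (1 :: 'c)" by simp
  have "v (of_int a * of_nat p) \<le> 1 / real p"
    using mult_right_mono[OF v_of_int_le[of a], of "1 / real p"] by (simp add: vabs_mult vabs_p)
  moreover have "v (of_int b * of_int n) \<le> v (of_int n)"
    using mult_right_mono[OF v_of_int_le[of b], of "v (of_int n)"] by (simp add: vabs_mult)
  ultimately have "v 1 < 1"
    using vabs_add[of "of_int a * of_nat p" "of_int b * of_int n"] less inv_p_less_1 unfolding 1 by linarith
  then show False by simp
qed

section \<open>Q_p as a closed subfield and Z_p as its unit ball\<close>

lemma Qp_approx: "x \<in> Q \<longleftrightarrow> (\<forall>e>0. \<exists>q. v (x - of_rat q) < e)"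
proof -
  have "v (of_rat q - x) = v (x - of_rat q)" for q by (rule v_commute)
  then show ?thesis unfolding Qp_def closure_approachable by (auto simp: dist_vabs)
qed

lemma Qp_of_rat [simp]: "of_rat q \<in> Q"
  unfolding Qp_def by (rule subsetD[OF closure_subset]) (rule rangeI)

lemma Qp_of_int [simp]: "of_int n \<in> Q"
  using Qp_of_rat[of "of_int n"] by simp

lemma Qp_of_nat [simp]: "of_nat n \<in> Q"
  using Qp_of_rat[of "of_nat n"] by simp

lemma Qp_0 [simp]: "0 \<in> Q" and Qp_1 [simp]: "1 \<in> Q"
  using Qp_of_nat[of 0] Qp_of_nat[of 1] by simp_all

lemma Qp_add [simp]: assumes "x \<in> Q" "y \<in> Q" shows "x + y \<in> Q"
  unfolding Qp_approx
proof (intro allI impI)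
  fix e :: real assume "e > 0"
  then obtain a b where ab: "v (x - of_rat a) < e" "v (y - of_rat b) < e"
    using assms unfolding Qp_approx by blast
  have eq: "x + y - of_rat (a + b) = (x - of_rat a) + (y - of_rat b)" by (simp add: of_rat_add)
  have "v (x + y - of_rat (a + b)) < e"
    using ab vabs_add[of "x - of_rat a" "y - of_rat b"] unfolding eq by linarith
  then show "\<exists>q. v (x + y - of_rat q) < e" by blast
qed

lemma Qp_minus [simp]: assumes "x \<in> Q" shows "- x \<in> Q"
  unfolding Qp_approx
proof (intro allI impI)
  fix e :: real assume "e > 0"
  then obtain a where a: "v (x - of_rat a) < e" using assms unfolding Qp_approx by blast
  have "v (- x - of_rat (- a)) = v (x - of_rat a)"
    using v_minus[of "x - of_rat a"] by (simp add: of_rat_minus)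
  with a show "\<exists>q. v (- x - of_rat q) < e" by metis
qed

lemma Qp_diff [simp]: "x \<in> Q \<Longrightarrow> y \<in> Q \<Longrightarrow> x - y \<in> Q"
  using Qp_add[of x "- y"] by simp

lemma Qp_mult [simp]: assumes "x \<in> Q" "y \<in> Q" shows "x * y \<in> Q"
  unfolding Qp_approx
proof (intro allI impI)
  fix e :: real assume e: "e > 0"
  \<comment> \<open>The 1 in the minimum bounds the approximation b of y by |x| + |y| + 1; the
    quotient then makes both error terms smaller than e.\<close>
  define d where "d = min 1 (e / (v x + v y + 1))"
  have pos: "v x + v y + 1 > 0" using v_nonneg[of x] v_nonneg[of y] by linarith
  then have d: "d > 0" using e by (simp add: d_def)
  then obtain a b where ab: "v (x - of_rat a) < d" "v (y - of_rat b) < d"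
    using assms unfolding Qp_approx by blast
  have eq: "x * y - of_rat (a * b) = x * (y - of_rat b) + (x - of_rat a) * of_rat b"
    by (simp add: of_rat_mult algebra_simps)
  have vb: "v (of_rat b) \<le> v x + v y + 1"
  proof -
    have "v (y - (y - of_rat b)) \<le> max (v y) (v (y - of_rat b))" by (rule v_diff)
    then have "v (of_rat b) \<le> max (v y) (v (y - of_rat b))" by simp
    moreover have "v (y - of_rat b) \<le> 1" using ab by (simp add: d_def)
    ultimately show ?thesis using v_nonneg[of x] v_nonneg[of y] by linarith
  qed
  have de: "d * (v x + v y + 1) \<le> e"
  proof -
    have "d \<le> e / (v x + v y + 1)" by (simp add: d_def)
    then show ?thesis using pos by (simp only: pos_le_divide_eq)
  qed
  have "v (x * (y - of_rat b)) \<le> (v x + v y + 1) * v (y - of_rat b)"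
    unfolding vabs_mult by (rule mult_right_mono) (auto simp: add_nonneg_nonneg)
  also have "\<dots> < (v x + v y + 1) * d" using ab pos by simp
  finally have 1: "v (x * (y - of_rat b)) < e" using de by (simp add: mult.commute)
  have "v ((x - of_rat a) * of_rat b) \<le> v (x - of_rat a) * (v x + v y + 1)"
    unfolding vabs_mult by (rule mult_left_mono) (use vb in auto)
  also have "\<dots> < d * (v x + v y + 1)" using ab pos by simp
  finally have 2: "v ((x - of_rat a) * of_rat b) < e" using de by simp
  show "\<exists>q. v (x * y - of_rat q) < e"
    using 1 2 vabs_add[of "x * (y - of_rat b)" "(x - of_rat a) * of_rat b"] unfolding eq[symmetric]
    by (intro exI[of _ "a * b"]) linarith
qed

lemma Qp_inverse [simp]: assumes "x \<in> Q" shows "inverse x \<in> Q"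
proof (cases "x = 0")
  case x: False
  show ?thesis unfolding Qp_approx
  proof (intro allI impI)
    fix e :: real assume e: "e > 0"
    \<comment> \<open>An approximation a closer to x than |x| satisfies |a| = |x|, and then |1/x -
      1/a| = |x - a| / |x|^2.\<close>
    have "min (v x) (e * v x ^ 2) > 0" using e x by simp
    then obtain a where a: "v (x - of_rat a) < v x" "v (x - of_rat a) < e * v x ^ 2"
      using assms unfolding Qp_approx by fastforce
    have va: "v (of_rat a) = v x" using a by (intro v_isosceles) auto
    then have a0: "(of_rat a :: 'c) \<noteq> 0" using x by (metis v_eq_0)
    have "inverse x - of_rat (inverse a) = (of_rat a - x) / (x * of_rat a)"
      unfolding of_rat_inverse using x a0 by (simp add: field_simps)
    then have "v (inverse x - of_rat (inverse a)) = v (x - of_rat a) / (v x ^ 2)"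
      by (simp add: v_divide vabs_mult va power2_eq_square v_commute)
    also have "\<dots> < e" using a x by (simp add: pos_divide_less_eq)
    finally show "\<exists>q. v (inverse x - of_rat q) < e" by blast
  qed
qed simp

lemma Qp_divide [simp]: "x \<in> Q \<Longrightarrow> y \<in> Q \<Longrightarrow> x / y \<in> Q"
  by (simp add: divide_inverse)

lemma Qp_power [simp]: "x \<in> Q \<Longrightarrow> x ^ n \<in> Q"
  by (induction n) auto

lemma Qp_powi [simp]: "x \<in> Q \<Longrightarrow> x powi n \<in> Q"
  by (simp add: power_int_def)

lemma Qp_sum: "(\<And>i. i \<in> A \<Longrightarrow> f i \<in> Q) \<Longrightarrow> sum f A \<in> Q"
  by (induction A rule: infinite_finite_induct) auto

lemma Zp_iff: "x \<in> Z \<longleftrightarrow> x \<in> Q \<and> v x \<le> 1"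
  by (simp add: Zp_def)

lemma Zp_0 [simp]: "0 \<in> Z" and Zp_1 [simp]: "1 \<in> Z"
  and Zp_add [simp]: "x \<in> Z \<Longrightarrow> y \<in> Z \<Longrightarrow> x + y \<in> Z"
  and Zp_minus [simp]: "x \<in> Z \<Longrightarrow> - x \<in> Z"
  and Zp_mult [simp]: "x \<in> Z \<Longrightarrow> y \<in> Z \<Longrightarrow> x * y \<in> Z"
  and Zp_of_int [simp]: "of_int n \<in> Z" and Zp_of_nat [simp]: "of_nat m \<in> Z"
  by (auto simp: Zp_iff v_add_le vabs_mult mult_le_one v_of_int_le v_of_nat_le)

lemma closed_Qp: "closed Q"
  by (simp add: Qp_def)

lemma closed_v_le: "closed {x :: 'c. v x \<le> B}"
proof -
  have "{x :: 'c. v x \<le> B} = cball 0 B" by (auto simp: vabs_def dist_commute)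
  then show ?thesis by simp
qed

lemma closed_Zp: "closed Z"
proof -
  have "Z = Q \<inter> {x. v x \<le> 1}" by (auto simp: Zp_iff)
  then show ?thesis using closed_Int[OF closed_Qp closed_v_le] by metis
qed

text \<open>In lowest terms the denominator is prime to p, since otherwise the absolute value would
  exceed 1. Multiplying the numerator by an inverse of the denominator modulo p^N gives the
  integer.\<close>

lemma rat_int_approx:
  assumes "v (of_rat q) \<le> 1"
  shows "\<exists>m::int. v (of_rat q - of_int m) \<le> 1 / real p ^ N"
proof -
  obtain a b where q: "q = of_int a / of_int b" "b > 0" "coprime a b"
    by (metis Fract_of_int_quotient Rat_cases)
  have vq: "v (of_rat q) = v (of_int a) / v (of_int b)"
    by (simp add: q(1) of_rat_divide v_divide)
  have b: "\<not> int p dvd b"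
  proof
    assume pb: "int p dvd b"
    then have "\<not> int p dvd a" using q(3) prime_p
      by (metis coprime_common_divisor not_prime_unit prime_nat_int_transfer)
    then have "v (of_rat q) = 1 / v (of_int b)" by (simp add: vq v_of_int_coprime)
    moreover have "v (of_int b) \<le> 1 / real p" using v_of_int_dvd[of 1 b] pb by simp
    moreover have "v (of_int b) > 0" using q(2) by simp
    ultimately have "1 \<le> v (of_int b)" using assms by (simp add: field_simps)
    then show False using \<open>v (of_int b) \<le> 1 / real p\<close> inv_p_less_1 by linarith
  qed
  then have vb: "v (of_int b) = 1" by (rule v_of_int_coprime)
  have "coprime b (int p ^ N)"
    using b prime_p by (metis coprime_commute coprime_power_right_iff prime_imp_coprime prime_nat_int_transfer)
  then obtain c where "[b * c = 1] (mod int p ^ N)" using cong_solve_coprime_int by blast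
  then have "[b * c * a = 1 * a] (mod int p ^ N)" by (rule cong_scalar_right)
  then have dvd: "int p ^ N dvd a - b * (c * a)"
    by (metis cong_iff_dvd_diff cong_sym mult.assoc mult_1)
  have "of_rat q - of_int (c * a) = (of_int (a - b * (c * a)) / of_int b :: 'c)"
    using q(2) by (simp add: q(1) of_rat_divide field_simps)
  then have "v (of_rat q - of_int (c * a)) = v (of_int (a - b * (c * a)))"
    using vb by (simp only: v_divide div_by_1)
  also have "\<dots> \<le> 1 / real p ^ N" by (rule v_of_int_dvd[OF dvd])
  finally show ?thesis by blast
qed

lemma Zp_int_approx:
  assumes "x \<in> Z" shows "\<exists>m::int. v (x - of_int m) \<le> 1 / real p ^ N"
proof -
  obtain q where q: "v (x - of_rat q) < 1 / real p ^ N"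
    using assms unfolding Zp_iff Qp_approx by (metis p_pos of_nat_0_less_iff zero_less_divide_1_iff zero_less_power)
  have "v (x - of_rat q) \<le> 1" using q inv_p_power_le_1[of N] by linarith
  then have "v (of_rat q) \<le> 1"
    using assms v_diff_le[of x 1 "x - of_rat q"] by (simp add: Zp_iff)
  then obtain m where "v (of_rat q - of_int m) \<le> 1 / real p ^ N"
    using rat_int_approx by blast
  then show ?thesis using v_trans_le[OF less_imp_le[OF q]] by blast
qed

text \<open>The p^N residues form the finite net in the proof that Z_p is compact, and they label
  the cosets on which continuous functions are approximated.\<close>

lemma Zp_nat_approx:
  assumes "x \<in> Z" shows "\<exists>m<p ^ N. v (x - of_nat m) \<le> 1 / real p ^ N"
proof -
  obtain m :: int where m: "v (x - of_int m) \<le> 1 / real p ^ N" using Zp_int_approx[OF assms] by blast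
  define k where "k = nat (m mod int p ^ N)"
  have k: "int k = m mod int p ^ N" by (simp add: k_def)
  have "k < p ^ N" by (metis k of_nat_less_iff of_nat_power p_pos pos_mod_bound of_nat_0_less_iff zero_less_power)
  moreover have "v (of_int m - of_int (int k)) \<le> 1 / real p ^ N"
    using v_of_int_dvd[of N "m - int k"] by (simp add: k)
  then have "v (x - of_nat k) \<le> 1 / real p ^ N" using m v_trans_le[of x "of_int m"] by simp
  ultimately show ?thesis by blast
qed

section \<open>Congruences between powers, and Fermat's little theorem in Z_p\<close>

lemma v_power_diff_le:
  assumes "v a \<le> 1" "v b \<le> 1" shows "v (a ^ i - b ^ i) \<le> v (a - b)"
proof -
  have "v (\<Sum>k<i. b ^ (i - Suc k) * a ^ k) \<le> 1"
    using assms by (intro v_sum_le) (auto simp: vabs_mult v_power power_le_one mult_le_one)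
  then have "v (a - b) * v (\<Sum>k<i. b ^ (i - Suc k) * a ^ k) \<le> v (a - b) * 1"
    by (rule mult_left_mono) auto
  then show ?thesis by (simp add: power_diff_sumr2[of a i b] vabs_mult)
qed

text \<open>A p-th power gains a factor p: modulo a - b the cofactor of a - b in a^p - b^p is p
  b^(p-1), so it is divisible by p as soon as a - b is.\<close>

lemma v_power_p_diff_le:
  assumes ab: "v a \<le> 1" "v b \<le> 1" and "v (a - b) \<le> 1 / real p" "v (a - b) \<le> B"
  shows "v (a ^ p - b ^ p) \<le> B / real p"
proof -
  define S where "S = (\<Sum>k<p. b ^ (p - Suc k) * a ^ k)"
  have "S = (\<Sum>k<p. b ^ (p - Suc k) * (a ^ k - b ^ k) + b ^ (p - 1))"
    unfolding S_def by (intro sum.cong) (auto simp: algebra_simps simp flip: power_add)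
  also have "\<dots> = (\<Sum>k<p. b ^ (p - Suc k) * (a ^ k - b ^ k)) + of_nat p * b ^ (p - 1)"
    by (simp add: sum.distrib)
  finally have S: "S = \<dots>" .
  have "v S \<le> 1 / real p" unfolding S
  proof (intro v_add_le v_sum_le)
    fix k
    have "v (b ^ (p - Suc k)) * v (a ^ k - b ^ k) \<le> 1 * (1 / real p)"
      using v_power_diff_le[OF ab, of k] assms
      by (intro mult_mono) (auto simp: v_power power_le_one)
    then show "v (b ^ (p - Suc k) * (a ^ k - b ^ k)) \<le> 1 / real p" by (simp add: vabs_mult)
  next
    show "v (of_nat p * b ^ (p - 1)) \<le> 1 / real p"
      using ab mult_left_mono[OF power_le_one[of "v b" "p - 1"], of "1 / real p"]
      by (simp add: vabs_mult vabs_p v_power)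
  qed simp
  then have "v (a - b) * v S \<le> B * (1 / real p)"
    using assms v_nonneg[of "a - b"] by (intro mult_mono) (linarith | simp)+
  then show ?thesis by (simp add: power_diff_sumr2[of a p b] vabs_mult S_def)
qed

text \<open>Each of the j successive p-th powers gains a factor p. The final exponent exceeds by one
  that of the denominator p^j in the functional equation, and this excess is what both applications
  use.\<close>

lemma v_power_p_power_diff_le:
  assumes "v a \<le> 1" "v b \<le> 1" "v (a - b) \<le> 1 / real p"
  shows "v (a ^ (p ^ j) - b ^ (p ^ j)) \<le> 1 / real p ^ Suc j"
proof (induction j)
  case 0
  then show ?case using assms by simp
next
  case (Suc j)
  have "1 / real p ^ Suc j \<le> 1 / real p"
    using real_p_ge_2 by (intro divide_left_mono) (auto simp: self_le_power)
  then have "v ((a ^ (p ^ j)) ^ p - (b ^ (p ^ j)) ^ p) \<le> (1 / real p ^ Suc j) / real p"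
    using assms Suc by (intro v_power_p_diff_le) (auto simp: v_power power_le_one)
  then show ?case by (simp add: power_mult[symmetric] mult.commute)
qed

text \<open>Modulo p every element of Z_p is an integer below p. The dichotomy makes 1 - d^(p-1) an
  indicator, modulo p, of the condition that p divides d.\<close>

lemma Zp_fermat:
  assumes "a \<in> Z" shows "v a \<le> 1 / real p \<or> v (a ^ (p - 1) - 1) \<le> 1 / real p"
proof -
  obtain m where m: "m < p" "v (a - of_nat m) \<le> 1 / real p" using Zp_nat_approx[OF assms, of 1] by auto
  show ?thesis
  proof (cases "m = 0")
    case False
    then have "[m ^ (p - 1) = 1] (mod p)" using m prime_p by (intro fermat_theorem) (auto dest: dvd_imp_le)
    then have "int p dvd int m ^ (p - 1) - 1"
      by (metis cong_iff_dvd_diff cong_int_iff of_nat_1 of_nat_power)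
    then have "v (of_nat m ^ (p - 1) - 1) \<le> 1 / real p"
      using v_of_int_dvd[of 1 "int m ^ (p - 1) - 1"] by simp
    moreover have "v (a ^ (p - 1) - of_nat m ^ (p - 1)) \<le> 1 / real p"
      using v_power_diff_le[of a "of_nat m" "p - 1"] assms m by (simp add: Zp_iff v_of_nat_le)
    ultimately show ?thesis using v_trans_le by blast
  qed (use m in simp)
qed

lemma Zp_power_p_diff:
  assumes "a \<in> Z" shows "v (a ^ p - a) \<le> 1 / real p"
proof -
  have "a ^ p = a * a ^ (p - 1)" by (simp add: power_eq_if)
  then have eq: "a ^ p - a = a * (a ^ (p - 1) - 1)" by (simp add: algebra_simps)
  have a: "v a \<le> 1" using assms by (simp add: Zp_iff)
  have "v (a ^ (p - 1) - 1) \<le> 1" using a by (intro v_diff_le) (auto simp: v_power power_le_one)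
  with Zp_fermat[OF assms] a show ?thesis
    using mult_mono[of "v a" "1 / real p" "v (a ^ (p - 1) - 1)" 1]
      mult_mono[of "v a" 1 "v (a ^ (p - 1) - 1)" "1 / real p"] by (auto simp: eq vabs_mult)
qed

section \<open>Balls of Q_p and their compactness\<close>

lemma v_p_powi: "v (of_nat p powi r) = real p powi (- r)"
  by (simp add: v_powi vabs_p power_int_minus flip: power_int_inverse inverse_eq_divide)

lemma pball_eq: "(pball p r :: 'c set) = {x \<in> Q. v x \<le> real p powi (- r)}"
proof (intro equalityI subsetI)
  fix x :: 'c assume "x \<in> pball p r"
  then obtain y where "x = of_nat p powi r * y" "y \<in> Q" "v y \<le> 1"
    by (auto simp: pball_def Zp_iff)
  then show "x \<in> {x \<in> Q. v x \<le> real p powi (- r)}"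
    using mult_left_mono[of "v y" 1 "real p powi (- r)"] by (simp add: vabs_mult v_p_powi)
next
  fix x assume "x \<in> {x \<in> Q. v x \<le> real p powi (- r)}"
  then have x: "x \<in> Q" "v x \<le> real p powi (- r)" by auto
  define y where "y = of_nat p powi (- r) * x"
  have "v y = real p powi r * v x" by (simp add: y_def vabs_mult v_p_powi)
  also have "\<dots> \<le> real p powi r * real p powi (- r)" using x by (intro mult_left_mono) auto
  also have "\<dots> = 1" by (simp add: power_int_minus)
  finally have "y \<in> Z" using x by (auto simp: Zp_iff y_def)
  moreover have "x = of_nat p powi r * y" by (simp add: y_def power_int_minus)
  ultimately show "x \<in> pball p r" by (auto simp: pball_def)
qed

lemma pball_neg: "(pball p (- int k) :: 'c set) = {x \<in> Q. v x \<le> real p ^ k}"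
  by (simp add: pball_eq)

lemma inv_p_power_small:
  assumes "e > 0" obtains N where "1 / real p ^ N < e"
proof -
  obtain N where "(1 / real p) ^ N < e" using real_arch_pow_inv[OF assms inv_p_less_1] by blast
  then show thesis using that by (simp add: power_one_over)
qed

lemma p_power_large: obtains k where "B \<le> real p ^ k"
  using real_arch_pow[of "real p" B] by (metis less_le of_nat_1 of_nat_less_iff p_gt_1)

lemma continuous_on_mult_left_v: "continuous_on S (\<lambda>x :: 'c. c * x)"
proof (cases "c = 0")
  case False
  show ?thesis unfolding continuous_on_iff
  proof (intro ballI allI impI)
    fix x e assume "e > (0::real)"
    then show "\<exists>d>0. \<forall>x'\<in>S. dist x' x < d \<longrightarrow> dist (c * x') (c * x) < e"
      using False by (intro exI[of _ "e / v c"])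
        (auto simp: dist_vabs vabs_mult pos_less_divide_eq mult.commute[of "v c"] simp flip: right_diff_distrib)
  qed
qed auto

lemma compact_Zp: "compact Z"
  unfolding compact_eq_totally_bounded
proof (intro conjI allI impI)
  show "complete Z" using closed_Zp by (simp add: complete_eq_closed)
  fix e :: real assume "e > 0"
  then obtain N where N: "1 / real p ^ N < e" by (rule inv_p_power_small)
  have "Z \<subseteq> (\<Union>x\<in>of_nat ` {..<p ^ N}. ball x e)"
    using Zp_nat_approx[of _ N] N by (fastforce simp: dist_vabs v_commute)
  then show "\<exists>k. finite k \<and> Z \<subseteq> (\<Union>x\<in>k. ball x e)" by blast
qed

lemma compact_pball: "compact (pball p r :: 'c set)"
  unfolding pball_def by (rule compact_continuous_image[OF continuous_on_mult_left_v compact_Zp])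

lemma pball_subset_Qp: "(pball p r :: 'c set) \<subseteq> Q"
  by (auto simp: pball_eq)

lemma compact_v_bounded:
  assumes "compact (K :: 'c set)" obtains b where "\<And>x. x \<in> K \<Longrightarrow> v x \<le> b"
  using compact_imp_bounded[OF assms] unfolding bounded_any_center[of K 0]
  by (auto simp: vabs_def dist_commute)

lemma compact_subset_pball:
  assumes "compact K" "K \<subseteq> Q" shows "\<exists>k. K \<subseteq> pball p (- int k)"
proof -
  obtain B where B: "\<And>x. x \<in> K \<Longrightarrow> v x \<le> B" using compact_v_bounded[OF assms(1)] by blast
  obtain k where "B \<le> real p ^ k" by (rule p_power_large)
  with B assms(2) show ?thesis unfolding pball_neg by (intro exI[of _ k]) force
qed

lemma pball_mono: "r \<le> s \<Longrightarrow> pball p s \<subseteq> (pball p r :: 'c set)"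
  using real_p_ge_2 by (force simp: pball_eq intro: order_trans power_int_increasing)

lemma Qp_bounded_mem: assumes "x \<in> Q" shows "\<exists>k. x \<in> pball p (- int k)"
  using p_power_large[of "v x"] assms by (auto simp: pball_neg)

section \<open>Entire functions\<close>

lemma v_lim_mem_le:
  assumes "(f \<longlonglongrightarrow> l)" "\<forall>\<^sub>F n in sequentially. v (f n - a) \<le> B"
  shows "v (l - a) \<le> B"
proof (rule field_le_epsilon)
  fix e :: real assume "e > 0"
  then have "\<forall>\<^sub>F n in sequentially. v (f n - l) < e"
    using assms(1) by (simp add: tendsto_iff dist_vabs)
  with assms(2) have "\<forall>\<^sub>F n in sequentially. v (f n - l) < e \<and> v (f n - a) \<le> B"
    by eventually_elim auto
  then obtain n where n: "v (f n - l) < e" "v (f n - a) \<le> B"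
    by (auto dest: eventually_happens)
  have "v (l - a) \<le> max (v (l - f n)) (v (f n - a))" using vabs_add[of "l - f n" "f n - a"] by simp
  moreover have "0 \<le> B" using n(2) v_nonneg order_trans by blast
  ultimately show "v (l - a) \<le> B + e" using n v_commute[of l "f n"] \<open>e > 0\<close> by linarith
qed

lemma v_sum_diff_le:
  fixes f :: "nat \<Rightarrow> 'c"
  assumes "\<And>n. n \<ge> N \<Longrightarrow> v (f n) \<le> B" "0 \<le> B" "N \<le> n"
  shows "v (sum f {..<n} - sum f {..<N}) \<le> B"
proof -
  have "sum f {..<n} - sum f {..<N} = sum f {N..<n}"
    using sum.atLeastLessThan_concat[of 0 N n f] assms(3) by (simp add: atLeast0LessThan algebra_simps)
  then show ?thesis using assms by (auto intro!: v_sum_le)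
qed

lemma summableI_v:
  assumes "(\<lambda>n. v (f n)) \<longlonglongrightarrow> 0" shows "summable f"
proof -
  have "Cauchy (\<lambda>n. sum f {..<n})" unfolding Cauchy_def
  proof (intro allI impI)
    fix e :: real assume e: "e > 0"
    then obtain N where N: "\<And>n. n \<ge> N \<Longrightarrow> v (f n) < e / 2"
      using order_tendstoD(2)[OF assms, of "e / 2"] unfolding eventually_sequentially by auto
    have "v (sum f {..<n} - sum f {..<N}) < e" if "n \<ge> N" for n
      using v_sum_diff_le[of N f "e / 2" n] N e that by (force simp: less_imp_le)
    then show "\<exists>M. \<forall>m\<ge>M. \<forall>n\<ge>M. dist (sum f {..<m}) (sum f {..<n}) < e"
      unfolding dist_vabs using v_trans_less v_commute by metis
  qed
  then show ?thesis by (auto simp: summable_def sums_def dest: Cauchy_convergent convergentD)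
qed

lemma summable_imp_v:
  assumes "summable f" shows "(\<lambda>n. v (f n)) \<longlonglongrightarrow> 0"
  unfolding tendsto_iff
proof (intro allI impI)
  fix e :: real assume e: "e > 0"
  obtain s where "(\<lambda>n. sum f {..<n}) \<longlonglongrightarrow> s" using assms by (auto simp: summable_def sums_def)
  then obtain N where N: "\<And>n. n \<ge> N \<Longrightarrow> v (sum f {..<n} - s) < e"
    using e unfolding tendsto_iff eventually_sequentially dist_vabs by blast
  have "v (f n) < e" if "n \<ge> N" for n
  proof -
    have "f n = sum f {..<Suc n} - sum f {..<n}" by simp
    then show ?thesis
      using v_trans_less[of "sum f {..<Suc n}" s e "sum f {..<n}"] N[of n] N[of "Suc n"] that
      by (simp add: v_commute[of s])
  qed
  then show "\<forall>\<^sub>F n in sequentially. dist (v (f n)) 0 < e"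
    unfolding eventually_sequentially by auto
qed

lemma suminf_approx:
  assumes "(\<lambda>n. v (f n)) \<longlonglongrightarrow> 0" "\<And>n. n \<ge> N \<Longrightarrow> v (f n) \<le> B" "0 \<le> B"
  shows "v (suminf f - sum f {..<N}) \<le> B"
proof (rule v_lim_mem_le)
  show "(\<lambda>n. sum f {..<n}) \<longlonglongrightarrow> suminf f"
    using summable_sums[OF summableI_v[OF assms(1)]] by (simp add: sums_def)
  show "\<forall>\<^sub>F n in sequentially. v (sum f {..<n} - sum f {..<N}) \<le> B"
    using eventually_ge_at_top[of N] by eventually_elim (intro v_sum_diff_le assms)
qed

text \<open>A is an upper bound for the Gauss norm of \<open>f\<close> at radius R. Carrying bounds
  instead of the supremum keeps the question of its finiteness out of the statements.\<close>

definition gauss_le :: "real \<Rightarrow> 'c fps \<Rightarrow> real \<Rightarrow> bool" where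
  "gauss_le R f A \<longleftrightarrow> (\<forall>n. v (f $ n) * R ^ n \<le> A)"

text \<open>A bound at a larger radius forces geometric decay of the terms at a smaller one, so
  bounds at all radii p^k amount to convergence everywhere; see
  \<open>entire_iff_summable\<close>.\<close>

definition entire :: "'c fps \<Rightarrow> bool" where
  "entire f \<longleftrightarrow> (\<forall>k. \<exists>A. gauss_le (real p ^ k) f A)"

lemma gauss_le_nonneg: "gauss_le R f A \<Longrightarrow> 0 \<le> A"
  unfolding gauss_le_def using v_nonneg[of "f $ 0"] by (metis mult.right_neutral order_trans power_0)

lemma gauss_le_mono: "gauss_le R f A \<Longrightarrow> A \<le> B \<Longrightarrow> gauss_le R f B"
  unfolding gauss_le_def using order_trans by blast

lemma gauss_le_const: "gauss_le R (fps_const c) (v c)"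
  by (auto simp: gauss_le_def)

lemma gauss_le_X: "0 \<le> R \<Longrightarrow> gauss_le R fps_X R"
  by (auto simp: gauss_le_def fps_X_def)

lemma gauss_le_add:
  assumes R: "0 \<le> R" and "gauss_le R f A" "gauss_le R g A" shows "gauss_le R (f + g) A"
  unfolding gauss_le_def
proof
  fix n
  have "v ((f + g) $ n) * R ^ n \<le> max (v (f $ n)) (v (g $ n)) * R ^ n"
    using vabs_add[of "f $ n" "g $ n"] R by (intro mult_right_mono) auto
  also have "\<dots> \<le> A" using assms by (auto simp: gauss_le_def max_def)
  finally show "v ((f + g) $ n) * R ^ n \<le> A" .
qed

lemma gauss_le_uminus: "gauss_le R f A \<Longrightarrow> gauss_le R (- f) A"
  by (simp add: gauss_le_def)

lemma gauss_le_sum: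
  assumes "0 \<le> R" "0 \<le> A" "\<And>i. i \<in> S \<Longrightarrow> gauss_le R (f i) A" shows "gauss_le R (sum f S) A"
  using assms(3)
proof (induction S rule: infinite_finite_induct)
  case (insert x F)
  then show ?case by (simp add: gauss_le_add assms(1))
qed (auto simp: gauss_le_def assms(2))

lemma gauss_le_mult:
  assumes R: "0 \<le> R" and f: "gauss_le R f A" and g: "gauss_le R g B"
  shows "gauss_le R (f * g) (A * B)"
  unfolding gauss_le_def
proof
  fix n
  have "v ((f * g) $ n) * R ^ n = v (\<Sum>i=0..n. f $ i * g $ (n - i)) * R ^ n"
    by (simp add: fps_mult_nth)
  also have "\<dots> \<le> A * B"
  \<comment> \<open>R = 0 is a permitted radius, so division by R^n needs a separate case.\<close>
  proof (cases "R ^ n = 0")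
    case True
    have "0 \<le> A * B" using gauss_le_nonneg[OF f] gauss_le_nonneg[OF g] by simp
    then show ?thesis by (simp only: True mult_zero_right)
  next
    case False
    then have Rn: "R ^ n > 0" using zero_le_power[OF R, of n] by linarith
    have "v (\<Sum>i=0..n. f $ i * g $ (n - i)) \<le> A * B / R ^ n"
    proof (rule v_sum_le)
      fix i assume i: "i \<in> {0..n}"
      have "(v (f $ i) * R ^ i) * (v (g $ (n - i)) * R ^ (n - i)) \<le> A * B"
        using f g R gauss_le_nonneg[OF f] by (intro mult_mono) (auto simp: gauss_le_def)
      moreover have "R ^ n = R ^ i * R ^ (n - i)" using i by (simp flip: power_add)
      ultimately show "v (f $ i * g $ (n - i)) \<le> A * B / R ^ n"
        using Rn by (simp add: pos_le_divide_eq vabs_mult mult_ac)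
    qed (use gauss_le_nonneg f g Rn in auto)
    then show ?thesis using Rn by (simp add: pos_le_divide_eq)
  qed
  finally show "v ((f * g) $ n) * R ^ n \<le> A * B" .
qed

lemma gauss_le_power:
  assumes "0 \<le> R" "gauss_le R f A" shows "gauss_le R (f ^ m) (A ^ m)"
proof (induction m)
  case 0
  then show ?case using gauss_le_const[of R 1] by simp
next
  case (Suc m)
  then show ?case using gauss_le_mult[OF assms] by simp
qed

lemma gauss_le_scale: "gauss_le (v c * R) f A \<Longrightarrow> gauss_le R (fps_scale c f) A"
  by (auto simp: gauss_le_def fps_scale_nth vabs_mult v_power power_mult_distrib mult_ac)

lemma entire_obtain:
  assumes "entire f" obtains A where "A \<ge> 1" "gauss_le (real p ^ k) f A"
  using assms gauss_le_mono unfolding entire_def by (metis linorder_linear)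

lemma entireI: "(\<And>k. \<exists>A. gauss_le (real p ^ k) f A) \<Longrightarrow> entire f"
  by (simp add: entire_def)

lemma entire_const [simp]: "entire (fps_const c)"
  using gauss_le_const entireI by blast

lemma entire_0 [simp]: "entire 0" and entire_1 [simp]: "entire 1"
  using entire_const[of 0] entire_const[of 1] by simp_all

lemma entire_X [simp]: "entire fps_X"
  using gauss_le_X[of "real p ^ _"] entireI by (metis of_nat_0_le_iff zero_le_power)

lemma entire_add [simp]: assumes "entire f" "entire g" shows "entire (f + g)"
proof (rule entireI)
  fix k
  obtain A B where "gauss_le (real p ^ k) f A" "gauss_le (real p ^ k) g B"
    using assms by (metis entire_def)
  then have "gauss_le (real p ^ k) (f + g) (max A B)"
    by (intro gauss_le_add) (auto intro: gauss_le_mono)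
  then show "\<exists>A. gauss_le (real p ^ k) (f + g) A" ..
qed

lemma entire_minus [simp]: "entire f \<Longrightarrow> entire (- f)"
  unfolding entire_def using gauss_le_uminus by blast

lemma entire_diff [simp]: "entire f \<Longrightarrow> entire g \<Longrightarrow> entire (f - g)"
  using entire_add[of f "- g"] by simp

lemma entire_mult [simp]: assumes "entire f" "entire g" shows "entire (f * g)"
proof (rule entireI)
  fix k
  obtain A B where "gauss_le (real p ^ k) f A" "gauss_le (real p ^ k) g B"
    using assms by (metis entire_def)
  then have "gauss_le (real p ^ k) (f * g) (A * B)"
    by (intro gauss_le_mult) auto
  then show "\<exists>A. gauss_le (real p ^ k) (f * g) A" ..
qed

lemma entire_power [simp]: "entire f \<Longrightarrow> entire (f ^ m)"
  by (induction m) auto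

lemma entire_sum [simp]: "(\<And>i. i \<in> S \<Longrightarrow> entire (f i)) \<Longrightarrow> entire (sum f S)"
  by (induction S rule: infinite_finite_induct) auto

lemma entire_prod [simp]: "(\<And>i. i \<in> S \<Longrightarrow> entire (f i)) \<Longrightarrow> entire (prod f S)"
  by (induction S rule: infinite_finite_induct) auto

lemma gauss_le_radius_mono:
  assumes "0 \<le> R" "R \<le> R'" "gauss_le R' f A" shows "gauss_le R f A"
  unfolding gauss_le_def
proof
  fix n
  have "v (f $ n) * R ^ n \<le> v (f $ n) * R' ^ n"
    using assms by (intro mult_left_mono power_mono) auto
  also have "\<dots> \<le> A" using assms(3) by (simp add: gauss_le_def)
  finally show "v (f $ n) * R ^ n \<le> A" .
qed

lemma entire_scale [simp]: assumes "entire f" shows "entire (fps_scale c f)"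
proof (rule entireI)
  fix k
  obtain m where "v c * real p ^ k \<le> real p ^ m" by (rule p_power_large)
  moreover obtain A where "gauss_le (real p ^ m) f A" using assms by (auto simp: entire_def)
  ultimately have "gauss_le (v c * real p ^ k) f A" 
    using gauss_le_radius_mono[of "v c * real p ^ k" "real p ^ m" f A] by simp
  then show "\<exists>A. gauss_le (real p ^ k) (fps_scale c f) A" using gauss_le_scale by blast
qed

lemma entire_tendsto:
  assumes "entire f" shows "(\<lambda>n. v (f $ n * x ^ n)) \<longlonglongrightarrow> 0"
proof -
  obtain k where k: "v x \<le> real p ^ k" by (rule p_power_large)
  \<comment> \<open>The bound is taken at p times the radius needed; the surplus gives the factor
    (1/p)^n.\<close>
  obtain A where A: "A \<ge> 1" "gauss_le (real p ^ Suc k) f A" using assms by (rule entire_obtain)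
  have "v (f $ n * x ^ n) \<le> A * (1 / real p) ^ n" for n
  proof -
    have "v (f $ n * x ^ n) \<le> v (f $ n) * (real p ^ k) ^ n"
      unfolding vabs_mult v_power using k by (intro mult_left_mono power_mono) auto
    also have "\<dots> = (v (f $ n) * (real p ^ Suc k) ^ n) * (1 / real p) ^ n"
      by (simp add: power_mult_distrib field_simps)
    also have "\<dots> \<le> A * (1 / real p) ^ n"
      using A(2) by (intro mult_right_mono) (auto simp: gauss_le_def)
    finally show ?thesis .
  qed
  moreover have "(\<lambda>n. A * (1 / real p) ^ n) \<longlonglongrightarrow> 0"
    using LIMSEQ_power_zero[of "1 / real p"] inv_p_less_1 by (auto intro!: tendsto_mult_right_zero)
  ultimately show ?thesis

    using tendsto_sandwich[of "\<lambda>_. 0" "\<lambda>n. v (f $ n * x ^ n)" sequentially "\<lambda>n. A * (1 / real p) ^ n" 0]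
    by simp
qed

lemma entire_iff_summable: "entire f \<longleftrightarrow> (\<forall>x. summable (\<lambda>n. f $ n * x ^ n))"
proof
  show "entire f \<Longrightarrow> \<forall>x. summable (\<lambda>n. f $ n * x ^ n)"
    by (intro allI summableI_v entire_tendsto)
  assume *: "\<forall>x. summable (\<lambda>n. f $ n * x ^ n)"
  show "entire f"
  proof (rule entireI)
    fix k
    \<comment> \<open>The test point p^(-k) has absolute value p^k, so that boundedness of the terms
      there is a bound on the Gauss norm at radius p^k.\<close>
    have "(\<lambda>n. v (f $ n * (inverse (of_nat p ^ k)) ^ n)) \<longlonglongrightarrow> 0"
      using * by (intro summable_imp_v) blast
    then have "Bseq (\<lambda>n. v (f $ n * (inverse (of_nat p ^ k)) ^ n))"
      by (intro convergent_imp_Bseq convergentI)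
    then obtain A where "\<And>n. v (f $ n * (inverse (of_nat p ^ k)) ^ n) \<le> A"
      unfolding Bseq_def by auto
    then show "\<exists>A. gauss_le (real p ^ k) f A"
      by (auto simp: gauss_le_def vabs_mult v_power v_inverse v_divide vabs_p power_one_over inverse_eq_divide)
  qed
qed

lemma carrier_entire_alg: "carrier entire_alg = {f. (\<forall>n. f $ n \<in> Q) \<and> entire f}"
  by (simp add: entire_alg_def entire_iff_summable)

section \<open>Evaluation of entire series: compatibility with the ring operations,
  continuity\<close>

lemma eval_approx:
  assumes "entire f" "\<And>n. n \<ge> N \<Longrightarrow> v (f $ n * x ^ n) \<le> B" "0 \<le> B"
  shows "v (fps_eval f x - (\<Sum>n<N. f $ n * x ^ n)) \<le> B"
  unfolding fps_eval_def using assms by (intro suminf_approx entire_tendsto)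

lemma gauss_le_term: "gauss_le R f A \<Longrightarrow> v x \<le> R \<Longrightarrow> v (f $ n * x ^ n) \<le> A"
  unfolding gauss_le_def vabs_mult v_power
  by (metis (no_types) mult_left_mono order_trans power_mono v_nonneg)

lemma eval_le:
  assumes "entire f" "gauss_le R f A" "v x \<le> R" shows "v (fps_eval f x) \<le> A"
  using eval_approx[of f 0 x A] gauss_le_term[OF assms(2,3)] gauss_le_nonneg[OF assms(2)] assms(1) by simp

lemma eval_approx_eventually:
  assumes "entire f" "e > 0"
  shows "\<forall>\<^sub>F N in sequentially. v (fps_eval f x - (\<Sum>n<N. f $ n * x ^ n)) \<le> e \<and> (\<forall>n\<ge>N. v (f $ n * x ^ n) \<le> e)"
proof -
  obtain M where M: "\<And>n. n \<ge> M \<Longrightarrow> v (f $ n * x ^ n) < e"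
    using order_tendstoD(2)[OF entire_tendsto[OF assms(1)] assms(2)] unfolding eventually_sequentially by auto
  show ?thesis using eventually_ge_at_top[of M]
  proof eventually_elim
    case (elim N)
    then have "\<forall>n\<ge>N. v (f $ n * x ^ n) \<le> e" using M by (meson less_imp_le order_trans)
    then show ?case using eval_approx[OF assms(1)] assms(2) by simp
  qed
qed

lemma eval_const [simp]: "fps_eval (fps_const c) x = c"
  unfolding fps_eval_def by (subst suminf_finite[of "{0}"]) auto

lemma eval_0 [simp]: "fps_eval 0 (x :: 'c) = 0" and eval_1 [simp]: "fps_eval 1 (x :: 'c) = 1"
  using eval_const[of 0] eval_const[of 1] by simp_all

lemma eval_X [simp]: "fps_eval fps_X (x :: 'c) = x"
  unfolding fps_eval_def by (subst suminf_finite[of "{1}"]) (auto simp: fps_X_def)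

lemma eval_scale [simp]: "fps_eval (fps_scale c f) x = fps_eval f ((c :: 'c) * x)"
  unfolding fps_eval_def by (simp add: fps_scale_nth power_mult_distrib mult_ac)

lemma eval_add [simp]:
  assumes "entire f" "entire g" shows "fps_eval (f + g) x = fps_eval f x + fps_eval g x"
proof (rule v_eqI)
  fix e :: real assume e: "e > 0"
  let ?s = "\<lambda>f N. \<Sum>n<N. f $ n * x ^ n"
  have "\<forall>\<^sub>F N in sequentially. v (fps_eval f x - ?s f N) \<le> e \<and> v (fps_eval g x - ?s g N) \<le> e
     \<and> v (fps_eval (f + g) x - ?s (f + g) N) \<le> e"
    using eval_approx_eventually[OF assms(1) e, of x] eval_approx_eventually[OF assms(2) e, of x]
      eval_approx_eventually[OF entire_add[OF assms] e, of x] by eventually_elim blast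
  then obtain N where N: "v (fps_eval f x - ?s f N) \<le> e" "v (fps_eval g x - ?s g N) \<le> e"
     "v (fps_eval (f + g) x - ?s (f + g) N) \<le> e" by (auto dest: eventually_happens)
  have "fps_eval (f + g) x - (fps_eval f x + fps_eval g x)
    = (fps_eval (f + g) x - ?s (f + g) N) - ((fps_eval f x - ?s f N) + (fps_eval g x - ?s g N))"
    by (simp add: sum.distrib algebra_simps)
  also have "v \<dots> \<le> e" by (rule v_diff_le[OF N(3) v_add_le[OF N(1,2)]])
  finally show "v (fps_eval (f + g) x - (fps_eval f x + fps_eval g x)) \<le> e" .
qed

lemma eval_mult [simp]:
  assumes f: "entire f" and g: "entire g" shows "fps_eval (f * g) x = fps_eval f x * fps_eval g x"
proof (rule v_eqI)
  fix e :: real assume e: "e > 0"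
  let ?s = "\<lambda>f N. \<Sum>n<N. f $ n * x ^ n"
  obtain k where k: "v x \<le> real p ^ k" by (rule p_power_large)
  obtain A where A: "A \<ge> 1" "gauss_le (real p ^ k) f A" using f by (rule entire_obtain)
  obtain B where B: "B \<ge> 1" "gauss_le (real p ^ k) g B" using g by (rule entire_obtain)
  \<comment> \<open>A truncation error of f is multiplied by values of g, of size up to B, and
    conversely; hence the tolerances e / B and e / A.\<close>
  have eA: "e / A > 0" and eB: "e / B > 0" using e A B by auto
  obtain N1 where N1: "\<forall>N\<ge>N1. v (fps_eval (f * g) x - ?s (f * g) N) \<le> e"
    using eval_approx_eventually[OF entire_mult[OF f g] e, of x] unfolding eventually_sequentially by blast
  have "\<forall>\<^sub>F N in sequentially. N1 \<le> N \<and> (v (fps_eval f x - ?s f N) \<le> e / B \<and> (\<forall>n\<ge>N. v (f $ n * x ^ n) \<le> e / B))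
     \<and> (v (fps_eval g x - ?s g N) \<le> e / A \<and> (\<forall>n\<ge>N. v (g $ n * x ^ n) \<le> e / A))"
    by (intro eventually_conj eval_approx_eventually f g eA eB eventually_ge_at_top)
  then obtain N where N: "N1 \<le> N" "v (fps_eval f x - ?s f N) \<le> e / B" "\<forall>n\<ge>N. v (f $ n * x ^ n) \<le> e / B"
    "v (fps_eval g x - ?s g N) \<le> e / A" "\<forall>n\<ge>N. v (g $ n * x ^ n) \<le> e / A"
    by (auto dest: eventually_happens)
  have fA: "v (f $ n * x ^ n) \<le> A" and gB: "v (g $ n * x ^ n) \<le> B" for n
    using gauss_le_term[OF A(2) k] gauss_le_term[OF B(2) k] by auto
  define a where "a = (\<lambda>n. f $ n * x ^ n)"
  define b where "b = (\<lambda>n. g $ n * x ^ n)"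
  \<comment> \<open>Truncation of the product at 2 N makes the triangle i + j < 2 N contain the
    square i, j < N. Every remaining pair has an index at least N, so its term is small.\<close>
  have "?s (f * g) (2 * N) = (\<Sum>n<2 * N. \<Sum>i\<le>n. a i * b (n - i))"
  proof (rule sum.cong)
    fix n
    show "(f * g) $ n * x ^ n = (\<Sum>i\<le>n. a i * b (n - i))"
      unfolding fps_mult_nth sum_distrib_right a_def b_def atLeast0AtMost
      by (intro sum.cong) (auto simp: mult_ac simp flip: power_add)
  qed simp
  also have "\<dots> = (\<Sum>(i,j)\<in>{(i,j). i + j < 2 * N}. a i * b j)"
    by (simp add: sum.triangle_reindex)
  finally have H: "?s (f * g) (2 * N) = \<dots>" .
  have prod: "?s f N * ?s g N = (\<Sum>(i,j)\<in>{..<N} \<times> {..<N}. a i * b j)"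
    by (simp add: sum_product sum.cartesian_product a_def b_def)
  have fin: "finite {(i,j). i + j < 2 * N}"
    by (rule finite_subset[of _ "{..<2 * N} \<times> {..<2 * N}"]) auto
  have sub: "{..<N} \<times> {..<N} \<subseteq> {(i,j). i + j < 2 * N}" by auto
  have "?s (f * g) (2 * N) - ?s f N * ?s g N
      = (\<Sum>(i,j)\<in>{(i,j). i + j < 2 * N} - {..<N} \<times> {..<N}. a i * b j)"
    unfolding H prod by (rule sum_diff[OF fin sub, symmetric])
  also have "v \<dots> \<le> e"
  proof (rule v_sum_le)
    fix ij assume "ij \<in> {(i,j). i + j < 2 * N} - {..<N} \<times> {..<N}"
    then obtain i j where ij: "ij = (i, j)" and "i \<ge> N \<or> j \<ge> N" by (cases ij) auto
    from this(2) have "v (a i * b j) \<le> e"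
    proof
      assume "i \<ge> N"
      then have "v (a i) * v (b j) \<le> (e / B) * B"
        using N(3) gB eB unfolding a_def b_def by (intro mult_mono) auto
      then show ?thesis using B by (simp add: vabs_mult)
    next
      assume "j \<ge> N"
      then have "v (a i) * v (b j) \<le> A * (e / A)"
        using N(5) fA A unfolding a_def b_def by (intro mult_mono) auto
      then show ?thesis using A by (simp add: vabs_mult)
    qed
    then show "v (case ij of (i, j) \<Rightarrow> a i * b j) \<le> e" by (simp add: ij)
  qed (use e in auto)
  finally have 1: "v (?s (f * g) (2 * N) - ?s f N * ?s g N) \<le> e" .
  have "v (?s f N * (fps_eval g x - ?s g N)) \<le> A * (e / A)"
    unfolding vabs_mult using N(4) A fA by (intro mult_mono v_sum_le) auto
  moreover have "v ((fps_eval f x - ?s f N) * fps_eval g x) \<le> (e / B) * B"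
    unfolding vabs_mult using N(2) eB eval_le[OF g B(2) k] by (intro mult_mono) auto
  ultimately have 2: "v (?s f N * (fps_eval g x - ?s g N) + (fps_eval f x - ?s f N) * fps_eval g x) \<le> e"
    using A B by (intro v_add_le) auto
  have 3: "v (fps_eval (f * g) x - ?s (f * g) (2 * N)) \<le> e" using N1 N(1) by auto
  have "fps_eval (f * g) x - fps_eval f x * fps_eval g x
    = (fps_eval (f * g) x - ?s (f * g) (2 * N)) + (?s (f * g) (2 * N) - ?s f N * ?s g N)
      - (?s f N * (fps_eval g x - ?s g N) + (fps_eval f x - ?s f N) * fps_eval g x)"
    by (simp add: algebra_simps)
  also have "v \<dots> \<le> e" by (rule v_diff_le[OF v_add_le[OF 3 1] 2])
  finally show "v (fps_eval (f * g) x - fps_eval f x * fps_eval g x) \<le> e" .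
qed

lemma eval_minus [simp]: "entire f \<Longrightarrow> fps_eval (- f) x = - fps_eval f x"
  using eval_add[of f "- f" x] by (simp add: eq_neg_iff_add_eq_0 add.commute)

lemma eval_diff [simp]: "entire f \<Longrightarrow> entire g \<Longrightarrow> fps_eval (f - g) x = fps_eval f x - fps_eval g x"
  using eval_add[of f "- g" x] by simp

lemma eval_power [simp]: "entire f \<Longrightarrow> fps_eval (f ^ m) x = fps_eval f x ^ m"
  by (induction m) auto

lemma eval_sum [simp]:
  "(\<And>i. i \<in> S \<Longrightarrow> entire (f i)) \<Longrightarrow> fps_eval (sum f S) x = (\<Sum>i\<in>S. fps_eval (f i) x)"
  by (induction S rule: infinite_finite_induct) auto

lemma eval_prod [simp]:
  "(\<And>i. i \<in> S \<Longrightarrow> entire (f i)) \<Longrightarrow> fps_eval (prod f S) x = (\<Prod>i\<in>S. fps_eval (f i) x)"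
  by (induction S rule: infinite_finite_induct) auto

lemma eval_Qp:
  assumes "f \<in> carrier entire_alg" "x \<in> Q" shows "fps_eval f x \<in> Q"
proof -
  have "(\<lambda>n. f $ n * x ^ n) sums fps_eval f x"
    using assms(1) unfolding fps_eval_def carrier_entire_alg entire_iff_summable by (simp add: summable_sums)
  then have "(\<lambda>N. \<Sum>n<N. f $ n * x ^ n) \<longlonglongrightarrow> fps_eval f x" by (simp add: sums_def)
  then show ?thesis
    by (rule closed_sequentially[OF closed_Qp, rotated])
      (use assms in \<open>auto simp: carrier_entire_alg intro!: Qp_sum\<close>)
qed

text \<open>Divided by c with |c| = p^k, both points lie in the unit disc, where u^n - w^n is u - w
  times an element of absolute value at most 1; the factor c^n is absorbed by the Gauss norm. Since
  |c| >= 1, the distance of the quotients is at most |x - y|.\<close>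

lemma eval_lipschitz:
  assumes f: "entire f" "gauss_le (real p ^ k) f A" and x: "v x \<le> real p ^ k" and y: "v y \<le> real p ^ k"
  shows "v (fps_eval f x - fps_eval f y) \<le> A * v (x - y)"
proof -
  define c :: 'c where "c = inverse (of_nat p ^ k)"
  have c: "v c = real p ^ k" by (simp add: c_def v_divide v_power vabs_p power_one_over inverse_eq_divide)
  then have c0: "c \<noteq> 0" by (metis p_neq_0 of_nat_eq_0_iff power_not_zero v_0)
  have termwise: "v (f $ n * x ^ n - f $ n * y ^ n) \<le> A * v (x - y)" for n
  proof -
    have xc: "v (x / c) \<le> 1" "v (y / c) \<le> 1" using x y c by (auto simp: v_divide)
    show ?thesis
    proof (cases "n = 0")
      case True
      then show ?thesis using gauss_le_nonneg[OF f(2)] by simp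
    next
      case False
      have "f $ n * x ^ n - f $ n * y ^ n = (f $ n * c ^ n) * ((x / c) ^ n - (y / c) ^ n)"
        using c0 by (simp add: power_divide field_simps)
      moreover have "v ((f $ n * c ^ n) * ((x / c) ^ n - (y / c) ^ n)) \<le> A * v (x / c - y / c)"
        unfolding vabs_mult[of "f $ n * c ^ n"]
        using v_power_diff_le[OF xc, of n] gauss_le_term[OF f(2), of c n] c gauss_le_nonneg[OF f(2)]
        by (intro mult_mono) auto
      moreover have "v (x / c - y / c) \<le> v (x - y)"
      proof -
        have "v (x / c - y / c) = v (x - y) / real p ^ k"
          by (simp add: c v_divide flip: diff_divide_distrib)
        also have "\<dots> \<le> v (x - y) / 1"
          using real_p_ge_2 by (intro divide_left_mono) auto
        finally show ?thesis by simp
      qed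
      ultimately show ?thesis
        using mult_left_mono[of _ _ A] gauss_le_nonneg[OF f(2)] by (metis order_trans)
    qed
  qed
  show ?thesis
  proof (rule field_le_epsilon)
    fix e :: real assume e: "e > 0"
    let ?s = "\<lambda>x N. \<Sum>n<N. f $ n * x ^ n"
    have "\<forall>\<^sub>F N in sequentially. v (fps_eval f x - ?s x N) \<le> e \<and> v (fps_eval f y - ?s y N) \<le> e"
      using eval_approx_eventually[OF f(1) e, of x] eval_approx_eventually[OF f(1) e, of y]
      by eventually_elim blast
    then obtain N where N: "v (fps_eval f x - ?s x N) \<le> e" "v (fps_eval f y - ?s y N) \<le> e"
      by (auto dest: eventually_happens)
    have nn: "0 \<le> A * v (x - y)" using gauss_le_nonneg[OF f(2)] by simp
    have "v (?s x N - ?s y N) \<le> A * v (x - y)"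
      unfolding sum_subtractf[symmetric] by (rule v_sum_le[OF termwise nn])
    then have "v (((fps_eval f x - ?s x N) - (fps_eval f y - ?s y N)) + (?s x N - ?s y N)) \<le> A * v (x - y) + e"
      using N e nn by (intro v_add_le[OF v_diff_le]) auto
    then show "v (fps_eval f x - fps_eval f y) \<le> A * v (x - y) + e" by simp
  qed
qed

lemma continuous_on_eval:
  assumes "entire f" shows "continuous_on S (fps_eval f :: 'c \<Rightarrow> 'c)"
  unfolding continuous_on_iff
proof (intro ballI allI impI)
  fix x and e :: real assume e: "e > 0"
  obtain k where k: "max 1 (v x) \<le> real p ^ k" by (rule p_power_large)
  obtain A where A: "A \<ge> 1" "gauss_le (real p ^ k) f A" using assms by (rule entire_obtain)
  show "\<exists>d>0. \<forall>x'\<in>S. dist x' x < d \<longrightarrow> dist (fps_eval f x') (fps_eval f x) < e"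
  proof (intro exI[of _ "min 1 (e / A)"] conjI ballI impI)
    show "0 < min 1 (e / A)" using e A by simp
    fix y assume "dist y x < min 1 (e / A)"
    then have d: "v (y - x) < 1" "v (y - x) < e / A" by (auto simp: dist_vabs)
    have "v y \<le> real p ^ k" using vabs_add[of "y - x" x] d k by auto
    then have "v (fps_eval f y - fps_eval f x) \<le> A * v (y - x)"
      using eval_lipschitz[OF assms A(2)] k by simp
    also have "\<dots> < e" using d(2) A(1) by (simp add: pos_less_divide_eq mult.commute)
    finally show "dist (fps_eval f y) (fps_eval f x) < e" by (simp add: dist_vabs)
  qed
qed

section \<open>Values of \<open>\<Psi>\<close> on the p-adic numbers\<close>

abbreviation Psi_fps :: "'c fps" where "Psi_fps \<equiv> fps_of_int (Psi p)"

abbreviation psi :: "'c \<Rightarrow> 'c" where "psi \<equiv> fps_eval Psi_fps"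

definition Psi_term :: "nat \<Rightarrow> 'c fps" where
  "Psi_term j = fps_const (1 / of_nat p ^ j) * fps_scale (of_nat p ^ j) Psi_fps ^ (p ^ j)"

lemma Psi_term_nth:
  assumes "n \<ge> 1"
  shows "Psi_term j $ n = of_int (int p ^ (j * (n - 1)) * (Psi p ^ (p ^ j)) $ n)"
proof -
  have "(of_nat p ^ j) ^ n = (of_nat p ^ j * of_nat p ^ (j * (n - 1)) :: 'c)"
    using assms by (cases n) (auto simp: power_mult power_add simp flip: power_mult power_Suc)
  then show ?thesis
    by (simp add: Psi_term_def fps_scale_power fps_scale_nth flip: fps_of_int_power)
qed

lemma Psi_term_nth_0: "Psi_term j $ 0 = 0"
  using p_ge_2 by (simp add: Psi_term_def fps_scale_power fps_scale_nth flip: fps_of_int_power)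

lemma Psi_term_0: "Psi_term 0 = Psi_fps"
  by (rule fps_ext) (simp add: Psi_term_def fps_scale_nth)

text \<open>Terms with j > N start in degree p^j > N, so the finite sum satisfies the functional
  equation exactly up to degree N.\<close>

lemma sum_Psi_term_nth:
  assumes "n \<le> N" shows "(\<Sum>j\<le>N. Psi_term j) $ n = fps_X $ n"
proof (cases "n = 0")
  case True
  then show ?thesis by (simp add: fps_sum_nth Psi_term_nth_0)
next
  case False
  then have n: "n \<ge> 1" by simp
  have "(\<Sum>j\<le>N. Psi_term j) $ n = of_int (\<Sum>j\<le>N. int p ^ (j * (n - 1)) * (Psi p ^ (p ^ j)) $ n)"
    using n by (simp add: fps_sum_nth Psi_term_nth)
  also have "\<dots> = fps_X $ n"
    unfolding Psi_coeff_identity[OF p_ge_2 n assms] by (simp add: fps_X_def)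
  finally show ?thesis .
qed

lemma gauss_le_Psi_small:
  assumes "0 \<le> R" "R \<le> 1" shows "gauss_le R Psi_fps R"
  unfolding gauss_le_def
proof
  fix n
  show "v (Psi_fps $ n) * R ^ n \<le> R"
  proof (cases n)
    case 0
    then show ?thesis using assms p_ge_2 by simp
  next
    case (Suc m)
    have "v (Psi_fps $ n) * R ^ n \<le> 1 * R ^ n"
      using assms by (intro mult_right_mono) (auto simp: v_of_int_le)
    also have "\<dots> \<le> R" using Suc assms by (simp add: mult_left_le power_le_one)
    finally show ?thesis .
  qed
qed

lemma gauss_le_Psi_term:
  assumes "gauss_le (R / real p ^ j) Psi_fps A" "0 \<le> R"
  shows "gauss_le R (Psi_term j) (real p ^ j * A ^ (p ^ j))"
proof -
  have "v (1 / of_nat p ^ j :: 'c) = real p ^ j"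
    by (simp add: v_divide v_power vabs_p power_one_over)
  moreover have "gauss_le R (fps_scale (of_nat p ^ j) Psi_fps) A"
    using assms by (intro gauss_le_scale) (simp add: v_power vabs_p power_one_over)
  ultimately show ?thesis
    unfolding Psi_term_def using assms(2) gauss_le_const[of R "1 / of_nat p ^ j"]
    by (metis gauss_le_mult gauss_le_power)
qed

text \<open>If |x| <= p^k and j >= k, then p^j x lies in the unit disc, where the Gauss norm of Psi
  is at most the radius. At j = k the radius is 1 and the denominator leaves p^k; for j > k the
  radius is at most 1 / p and its p^j-th power outweighs the denominator.\<close>

lemma gauss_le_Psi_term_large:
  assumes "k \<le> j" "1 \<le> j"
  shows "gauss_le (real p ^ k) (Psi_term j) (if j = k then real p ^ k else 1 / real p ^ j)"
proof -
  define R where "R = real p ^ k / real p ^ j"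
  have R: "R = 1 / real p ^ (j - k)" using assms(1) by (simp add: R_def power_diff)
  have R01: "0 \<le> R" "R \<le> 1" unfolding R using inv_p_power_le_1 by auto
  have 1: "gauss_le (real p ^ k) (Psi_term j) (real p ^ j * R ^ (p ^ j))"
    by (rule gauss_le_Psi_term) (use gauss_le_Psi_small[OF R01] in \<open>auto simp: R_def\<close>)
  show ?thesis
  proof (cases "j = k")
    case True
    with 1 R show ?thesis by simp
  next
    case False
    then have "j - k \<ge> 1" using assms by simp
    then have "R \<le> 1 / real p"
      unfolding R using self_le_power[of "real p" "j - k"] real_p_ge_2 by (intro divide_left_mono) auto
    then have "real p ^ j * R ^ (p ^ j) \<le> real p ^ j * (1 / real p) ^ (p ^ j)"
      using R01 by (intro mult_left_mono power_mono) auto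
    \<comment> \<open>This uses 2 j <= 2^j <= p^j. Half of the exponent 2 j cancels p^j, the other
      half remains as decay in j.\<close>
    also have "\<dots> \<le> real p ^ j * (1 / real p) ^ (j + j)"
    proof (intro mult_left_mono power_decreasing)
      have "2 * j \<le> 2 ^ j" using assms(2) by (induction j rule: dec_induct) auto
      also have "2 ^ j \<le> p ^ j" using p_ge_2 by (intro power_mono) auto
      finally show "j + j \<le> p ^ j" by simp
    qed (use inv_p_less_1 in auto)
    also have "\<dots> = 1 / real p ^ j" by (simp add: power_add power_one_over)
    finally show ?thesis using False 1 gauss_le_mono by simp
  qed
qed

text \<open>By the functional equation Psi is T minus the terms with j >= 1, and at radius p^k the
  j-th of these involves Psi at radius p^(k-j) only. Strong induction on k bounds the finitely many
  terms with j <= k; those with j > k are at most 1 by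
  \<open>gauss_le_Psi_term_large\<close>.\<close>

theorem entire_Psi [simp]: "entire Psi_fps"
proof (rule entireI)
  fix k
  show "\<exists>A. gauss_le (real p ^ k) Psi_fps A"
  proof (induction k rule: less_induct)
    case (less k)
    have "\<exists>A. gauss_le (real p ^ k) (Psi_term j) A" if "1 \<le> j" "j \<le> k" for j
    proof (cases "j = k")
      case True
      then show ?thesis using gauss_le_Psi_term_large[of k j] that by auto
    next
      case False
      have "k - j < k" using that by linarith
      then obtain A where "gauss_le (real p ^ (k - j)) Psi_fps A"
        using less by blast
      then have "gauss_le (real p ^ k / real p ^ j) Psi_fps A"
        using that by (simp add: power_diff)
      then show ?thesis using gauss_le_Psi_term by fastforce
    qed
    then have "\<forall>j\<in>{1..k}. \<exists>A. gauss_le (real p ^ k) (Psi_term j) A" by auto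
    then obtain M where M: "\<And>j. j \<in> {1..k} \<Longrightarrow> gauss_le (real p ^ k) (Psi_term j) (M j)"
      by metis
    define B where "B = Max (insert 1 (M ` {1..k}))"
    have B1: "1 \<le> B" unfolding B_def by (intro Max_ge) auto
    have B: "gauss_le (real p ^ k) (Psi_term j) B" if j: "1 \<le> j" for j
    proof (cases "j \<le> k")
      case True
      then have "M j \<le> B" unfolding B_def using j by (intro Max_ge) auto
      then show ?thesis using M[of j] True j gauss_le_mono by auto
    next
      case False
      then have "gauss_le (real p ^ k) (Psi_term j) (1 / real p ^ j)"
        using gauss_le_Psi_term_large[of k j] j by simp
      then show ?thesis using inv_p_power_le_1[of j] B1 gauss_le_mono order_trans by metis
    qed
    define D where "D = max B (real p ^ k)"
    \<comment> \<open>Coefficient n is read off from the sum truncated at n, while the bound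
      \<open>D\<close> does not depend on n.\<close>
    have "v (Psi_fps $ n) * (real p ^ k) ^ n \<le> D" for n
    proof -
      have split: "(\<Sum>j\<le>n. Psi_term j) = Psi_fps + (\<Sum>j=1..n. Psi_term j)"
        by (simp add: atMost_atLeast0 sum.atLeast_Suc_atMost Psi_term_0)
      have "Psi_fps $ n = (\<Sum>j\<le>n. Psi_term j) $ n - (\<Sum>j=1..n. Psi_term j) $ n"
        by (simp only: split fps_add_nth add_diff_cancel_right')
      then have "Psi_fps $ n = (fps_X - (\<Sum>j=1..n. Psi_term j)) $ n"
        by (simp only: sum_Psi_term_nth[OF order_refl] fps_sub_nth)
      moreover have "gauss_le (real p ^ k) (fps_X + - (\<Sum>j=1..n. Psi_term j)) D"
      proof (intro gauss_le_add gauss_le_uminus gauss_le_sum)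
        show "gauss_le (real p ^ k) fps_X D"
          by (rule gauss_le_mono[OF gauss_le_X]) (auto simp: D_def)
        show "gauss_le (real p ^ k) (Psi_term j) D" if "j \<in> {1..n}" for j
          by (rule gauss_le_mono[OF B]) (use that in \<open>auto simp: D_def\<close>)
      qed (use B1 in \<open>auto simp: D_def\<close>)
      ultimately show ?thesis by (simp add: gauss_le_def)
    qed
    then show ?case unfolding gauss_le_def by blast
  qed
qed

text \<open>Up to degree J the difference of T and the truncated sum vanishes. Each later
  coefficient is that of a finite sum of terms with j > J >= k, whose Gauss norm at radius p^k is at
  most 1 / p^J. The error is thus controlled coefficientwise, without an infinite sum of
  functions.\<close>

lemma Psi_functional_equation:
  assumes x: "v x \<le> real p ^ k" and J: "k \<le> J"
  shows "v (x - (\<Sum>j\<le>J. psi (of_nat p ^ j * x) ^ (p ^ j) / of_nat p ^ j)) \<le> 1 / real p ^ J"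
proof -
  define F where "F = fps_X - (\<Sum>j\<le>J. Psi_term j)"
  have ent [simp]: "entire (Psi_term j)" for j unfolding Psi_term_def by simp
  have "gauss_le (real p ^ k) F (1 / real p ^ J)"
    unfolding gauss_le_def
  proof
    fix n
    show "v (F $ n) * (real p ^ k) ^ n \<le> 1 / real p ^ J"
    proof (cases "n \<le> J")
      case True
      then show ?thesis by (simp add: F_def sum_Psi_term_nth)
    next
      case False
      have split: "(\<Sum>j\<le>n. Psi_term j) = (\<Sum>j\<le>J. Psi_term j) + (\<Sum>j=Suc J..n. Psi_term j)"
        using False sum.ub_add_nat[of 0 J Psi_term "n - J"] by (simp add: atMost_atLeast0)
      have "F $ n = (\<Sum>j\<le>n. Psi_term j) $ n - (\<Sum>j\<le>J. Psi_term j) $ n"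
        by (simp only: F_def fps_sub_nth sum_Psi_term_nth[OF order_refl])
      then have "F $ n = (\<Sum>j=Suc J..n. Psi_term j) $ n"
        by (simp only: split fps_add_nth add_diff_cancel_left')
      moreover have "gauss_le (real p ^ k) (\<Sum>j=Suc J..n. Psi_term j) (1 / real p ^ J)"
      proof (rule gauss_le_sum)
        fix j assume j: "j \<in> {Suc J..n}"
        then have "gauss_le (real p ^ k) (Psi_term j) (1 / real p ^ j)"
          using gauss_le_Psi_term_large[of k j] J by simp
        moreover have "1 / real p ^ j \<le> 1 / real p ^ J"
          using j real_p_ge_2 by (intro divide_left_mono power_increasing) auto
        ultimately show "gauss_le (real p ^ k) (Psi_term j) (1 / real p ^ J)"
          by (rule gauss_le_mono)
      qed auto
      ultimately show ?thesis by (simp add: gauss_le_def)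
    qed
  qed
  then have "v (fps_eval F x) \<le> 1 / real p ^ J"
    using x by (intro eval_le) (auto simp: F_def)
  moreover have "fps_eval F x = x - (\<Sum>j\<le>J. psi (of_nat p ^ j * x) ^ (p ^ j) / of_nat p ^ j)"
    by (simp add: F_def) (simp add: Psi_term_def)
  ultimately show ?thesis by simp
qed

lemma psi_Qp [simp]: "x \<in> Q \<Longrightarrow> psi x \<in> Q"
  by (rule eval_Qp) (auto simp: carrier_entire_alg)

lemma v_psi_le: assumes "v x \<le> 1" shows "v (psi x) \<le> v x"
  by (rule eval_le[OF entire_Psi gauss_le_Psi_small]) (use assms in auto)

text \<open>Beyond j = k the values Psi(p^j x) are divisible by p, which is why finitely many of
  them determine x modulo p.\<close>

lemma v_psi_p_power_le:
  assumes "v x \<le> real p ^ k" "k < j" shows "v (psi (of_nat p ^ j * x)) \<le> 1 / real p"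
proof -
  have "v (of_nat p ^ j * x) = v x / real p ^ j"
    by (simp add: vabs_mult v_power vabs_p power_one_over)
  also have "\<dots> \<le> real p ^ k / real p ^ j" using assms by (intro divide_right_mono) auto
  also have "\<dots> = 1 / real p ^ (j - k)" using assms by (simp add: power_diff)
  also have "\<dots> \<le> 1 / real p"
    using self_le_power[of "real p" "j - k"] real_p_ge_2 assms(2) by (intro divide_left_mono) auto
  finally have le: "v (of_nat p ^ j * x) \<le> 1 / real p" .
  then have "v (psi (of_nat p ^ j * x)) \<le> v (of_nat p ^ j * x)"
    using inv_p_less_1 by (intro v_psi_le) linarith
  with le show ?thesis by linarith
qed

lemma v_div_p_power: "v (y / of_nat p ^ j) = v y * real p ^ j"
  by (simp add: v_divide v_power vabs_p power_one_over)

lemma psi_Zp: assumes "x \<in> Q" shows "psi x \<in> Z"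
proof -
  \<comment> \<open>Induction on the size of x: multiplication by p lowers k, so a_1, a_2, ... are
    integral by the induction hypothesis.\<close>
  have "v (psi x) \<le> 1" if "x \<in> Q" "v x \<le> real p ^ k" for k x
    using that
  proof (induction k arbitrary: x)
    case 0
    then show ?case using v_psi_le[of x] by simp
  next
    case (Suc k)
    define a where "a j = psi (of_nat p ^ j * x)" for j
    have px: "v (of_nat p * x) \<le> real p ^ k" using Suc.prems by (simp add: vabs_mult vabs_p field_simps)
    have a: "a (Suc j) \<in> Z" for j
    proof -
      have "v (of_nat p ^ j * (of_nat p * x)) \<le> 1 * real p ^ k"
        unfolding vabs_mult[of "of_nat p ^ j"]
        using px by (intro mult_mono) (auto simp: v_power vabs_p power_le_one less_imp_le[OF inv_p_less_1])
      then have "v (psi (of_nat p ^ j * (of_nat p * x))) \<le> 1"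
        using Suc.prems by (intro Suc.IH) auto
      then show ?thesis using Suc.prems by (simp add: a_def Zp_iff mult_ac)
    qed
    \<comment> \<open>The equation at x is truncated at K + 1 and the one at p x at K, so that the
      terms of \<open>S\<close> and \<open>T\<close> pair off. The first error is at most 1 and
      becomes at most 1 / p when the equation is multiplied by p; the second is at most 1 / p
      because K >= 1.\<close>
    define K where "K = Suc k"
    have K1: "1 / real p ^ K \<le> 1 / real p"
      using real_p_ge_2 by (intro divide_left_mono) (auto simp: K_def self_le_power)
    define S where "S = (\<Sum>j\<le>K. a (Suc j) ^ (p ^ Suc j) / of_nat p ^ j)"
    define T where "T = (\<Sum>j\<le>K. a (Suc j) ^ (p ^ j) / of_nat p ^ j)"
    have "v (x - (\<Sum>j\<le>Suc K. a j ^ (p ^ j) / of_nat p ^ j)) \<le> 1 / real p ^ Suc K"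
      unfolding a_def by (rule Psi_functional_equation[of x "Suc k"]) (use Suc.prems in \<open>auto simp: K_def\<close>)
    moreover have "(\<Sum>j\<le>Suc K. a j ^ (p ^ j) / of_nat p ^ j) = a 0 + S / of_nat p"
      unfolding sum.atMost_Suc_shift S_def sum_divide_distrib by (simp add: mult.commute)
    ultimately have "v (x - (a 0 + S / of_nat p)) \<le> 1 / real p ^ Suc K" by simp
    then have "v (x - (a 0 + S / of_nat p)) \<le> 1" using inv_p_power_le_1[of "Suc K"] by linarith
    then have "v (of_nat p * (x - (a 0 + S / of_nat p))) \<le> 1 / real p * 1"
      unfolding vabs_mult vabs_p by (intro mult_left_mono) auto
    then have 1: "v (of_nat p * x - of_nat p * a 0 - S) \<le> 1 / real p"
      by (simp add: algebra_simps)
    have "v (of_nat p * x - (\<Sum>j\<le>K. psi (of_nat p ^ j * (of_nat p * x)) ^ (p ^ j) / of_nat p ^ j)) \<le> 1 / real p ^ K"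
      by (rule Psi_functional_equation[OF px]) (simp add: K_def)
    then have 2: "v (of_nat p * x - T) \<le> 1 / real p"
      using K1 by (simp add: T_def a_def mult_ac)
    have 3: "v (S - T) \<le> 1 / real p"
      unfolding S_def T_def sum_subtractf[symmetric]
    proof (rule v_sum_le)
      fix j
      have aj: "v (a (Suc j)) \<le> 1" using a by (simp add: Zp_iff)
      \<comment> \<open>By Fermat a^p and a agree modulo p, hence their p^j-th powers agree modulo
        p^(j+1); division by p^j leaves one factor p.\<close>
      have "v ((a (Suc j) ^ p) ^ (p ^ j) - a (Suc j) ^ (p ^ j)) \<le> 1 / real p ^ Suc j"
        using aj Zp_power_p_diff[OF a] by (intro v_power_p_power_diff_le) (auto simp: v_power power_le_one)
      then have "v (a (Suc j) ^ (p ^ Suc j) - a (Suc j) ^ (p ^ j)) * real p ^ j \<le> 1 / real p ^ Suc j * real p ^ j"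
        by (intro mult_right_mono) (auto simp: power_mult[symmetric])
      then show "v (a (Suc j) ^ (p ^ Suc j) / of_nat p ^ j - a (Suc j) ^ (p ^ j) / of_nat p ^ j) \<le> 1 / real p"
        by (simp add: v_div_p_power flip: diff_divide_distrib)
    qed simp
    have "of_nat p * a 0 = (of_nat p * x - T) - (of_nat p * x - of_nat p * a 0 - S) - (S - T)"
      by simp
    also have "v \<dots> \<le> 1 / real p" by (rule v_diff_le[OF v_diff_le[OF 2 1] 3])
    finally have "v (a 0) \<le> 1" by (simp add: vabs_mult vabs_p field_simps)
    then show ?case by (simp add: a_def)
  qed
  moreover obtain k where "v x \<le> real p ^ k" by (rule p_power_large)
  ultimately show ?thesis using assms by (simp add: Zp_iff)
qed

lemma v_psi_le_1: "x \<in> Q \<Longrightarrow> v (psi x) \<le> 1"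
  using psi_Zp by (simp add: Zp_iff)

text \<open>Subtract the functional equations at x and y. For j >= 1 the p^j-th powers of the values
  agree modulo p^(j+1), so after division by p^j only the term j = 0 is left modulo p.\<close>

lemma psi_diff_cong:
  assumes x: "x \<in> Q" and y: "y \<in> Q"
    and *: "\<And>j. j \<ge> 1 \<Longrightarrow> v (psi (of_nat p ^ j * x) - psi (of_nat p ^ j * y)) \<le> 1 / real p"
  shows "v ((x - y) - (psi x - psi y)) \<le> 1 / real p"
proof -
  obtain k where "max (v x) (v y) \<le> real p ^ k" by (rule p_power_large)
  \<comment> \<open>With the exponent k + 1 the truncation error 1 / p^(k+1) is at most 1 / p, even
    for k = 0.\<close>
  then have k: "v x \<le> real p ^ Suc k" "v y \<le> real p ^ Suc k"
    using power_increasing[of k "Suc k" "real p"] real_p_ge_2 by linarith+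
  define a where "a j = psi (of_nat p ^ j * x)" for j
  define b where "b j = psi (of_nat p ^ j * y)" for j
  define D where "D = (\<Sum>j\<le>k. a (Suc j) ^ (p ^ Suc j) / of_nat p ^ Suc j - b (Suc j) ^ (p ^ Suc j) / of_nat p ^ Suc j)"
  have le: "1 / real p ^ Suc k \<le> 1 / real p"
    using real_p_ge_2 by (intro divide_left_mono) (auto simp: self_le_power)
  have "v (x - (\<Sum>j\<le>Suc k. a j ^ (p ^ j) / of_nat p ^ j)) \<le> 1 / real p"
    using Psi_functional_equation[OF k(1) order_refl] le unfolding a_def by linarith
  moreover have "v (y - (\<Sum>j\<le>Suc k. b j ^ (p ^ j) / of_nat p ^ j)) \<le> 1 / real p"
    using Psi_functional_equation[OF k(2) order_refl] le unfolding b_def by linarith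
  ultimately have 1: "v ((x - (\<Sum>j\<le>Suc k. a j ^ (p ^ j) / of_nat p ^ j)) - (y - (\<Sum>j\<le>Suc k. b j ^ (p ^ j) / of_nat p ^ j))) \<le> 1 / real p"
    by (rule v_diff_le)
  have 2: "v D \<le> 1 / real p"
    unfolding D_def
  proof (rule v_sum_le)
    fix j
    have "v (a (Suc j) ^ (p ^ Suc j) - b (Suc j) ^ (p ^ Suc j)) \<le> 1 / real p ^ Suc (Suc j)"
      unfolding a_def b_def by (rule v_power_p_power_diff_le) (use x y * in \<open>auto intro!: v_psi_le_1 simp del: power_Suc\<close>)
    then have "v (a (Suc j) ^ (p ^ Suc j) - b (Suc j) ^ (p ^ Suc j)) * real p ^ Suc j \<le> 1 / real p ^ Suc (Suc j) * real p ^ Suc j"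
      by (intro mult_right_mono) auto
    then show "v (a (Suc j) ^ (p ^ Suc j) / of_nat p ^ Suc j - b (Suc j) ^ (p ^ Suc j) / of_nat p ^ Suc j) \<le> 1 / real p"
      unfolding diff_divide_distrib[symmetric] v_div_p_power by simp
  qed simp
  have "(x - y) - (psi x - psi y) = ((x - (\<Sum>j\<le>Suc k. a j ^ (p ^ j) / of_nat p ^ j)) - (y - (\<Sum>j\<le>Suc k. b j ^ (p ^ j) / of_nat p ^ j))) + D"
    unfolding sum.atMost_Suc_shift D_def sum_subtractf by (simp add: a_def b_def)
  also have "v \<dots> \<le> 1 / real p" by (rule v_add_le[OF 1 2])
  finally show ?thesis .
qed

text \<open>Multiplication by p shifts the values Psi(p^j x) by one place and lowers k. If x and y
  agree modulo p, so do p x and p y, and the induction hypothesis yields agreement for j >= 1. Once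
  this holds, \<open>psi_diff_cong\<close> makes agreement of x and y equivalent to agreement at j =
  0.\<close>

lemma psi_digits:
  assumes "x \<in> Q" "y \<in> Q" "v x \<le> real p ^ k" "v y \<le> real p ^ k"
  shows "v (x - y) \<le> 1 / real p \<longleftrightarrow>
    (\<forall>j\<le>k. v (psi (of_nat p ^ j * x) - psi (of_nat p ^ j * y)) \<le> 1 / real p)"
  using assms
proof (induction k arbitrary: x y)
  case 0
  \<comment> \<open>For k = 0 all values with j >= 1 are divisible by p, so they agree modulo
    p.\<close>
  have "v ((x - y) - (psi x - psi y)) \<le> 1 / real p"
    by (rule psi_diff_cong) (use 0 v_psi_p_power_le[of x 0] v_psi_p_power_le[of y 0] in \<open>auto intro!: v_diff_le\<close>)
  then show ?case
    using v_diff_le[of "x - y" "1 / real p" "(x - y) - (psi x - psi y)"]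
      v_add_le[of "(x - y) - (psi x - psi y)" "1 / real p" "psi x - psi y"] by auto
next
  case (Suc k)
  let ?P = "\<lambda>j. v (psi (of_nat p ^ j * x) - psi (of_nat p ^ j * y)) \<le> 1 / real p"
  have "v (of_nat p * x) \<le> real p ^ k" "v (of_nat p * y) \<le> real p ^ k"
    using Suc.prems by (simp_all add: vabs_mult vabs_p field_simps)
  then have IH: "v (of_nat p * x - of_nat p * y) \<le> 1 / real p \<longleftrightarrow> (\<forall>j\<le>k. ?P (Suc j))"
    using Suc.IH[of "of_nat p * x" "of_nat p * y"] Suc.prems by (simp add: mult_ac)
  have large: "?P j" if "Suc k < j" for j
    using that Suc.prems by (intro v_diff_le v_psi_p_power_le)
  have step: "v ((x - y) - (psi x - psi y)) \<le> 1 / real p" if "\<forall>j\<le>k. ?P (Suc j)"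
  proof (rule psi_diff_cong)
    fix j :: nat assume "j \<ge> 1"
    then obtain i where "j = Suc i" by (cases j) auto
    then show "?P j" using that[rule_format, of i] large[of j] by fastforce
  qed (use Suc.prems in auto)
  have all: "(\<forall>j\<le>Suc k. ?P j) \<longleftrightarrow> ?P 0 \<and> (\<forall>j\<le>k. ?P (Suc j))"
    by (metis Suc_le_mono not0_implies_Suc zero_le)
  show ?case
  proof
    assume xy: "v (x - y) \<le> 1 / real p"
    have "v (of_nat p * x - of_nat p * y) \<le> 1 / real p"
      using mult_mono[of "1 / real p" 1 "v (x - y)" "1 / real p"] xy inv_p_less_1
      by (simp add: vabs_mult vabs_p flip: right_diff_distrib)
    then have hyp: "\<forall>j\<le>k. ?P (Suc j)" using IH by simp
    have "v ((x - y) - ((x - y) - (psi x - psi y))) \<le> 1 / real p"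
      by (rule v_diff_le[OF xy step[OF hyp]])
    then have "?P 0" by simp
    with hyp all show "\<forall>j\<le>Suc k. ?P j" by blast
  next
    assume "\<forall>j\<le>Suc k. ?P j"
    then have hyp: "\<forall>j\<le>k. ?P (Suc j)" and "?P 0" using all by blast+
    then have "v (psi x - psi y) \<le> 1 / real p" by simp
    from v_add_le[OF step[OF hyp] this] show "v (x - y) \<le> 1 / real p" by simp
  qed
qed

section \<open>The ring generated by \<open>\<Psi>\<close> and approximation on compact sets\<close>

lemma entire_alg_sel [simp]:
  "mult (entire_alg\<lparr>carrier := S\<rparr>) = (*)" "one (entire_alg\<lparr>carrier := S\<rparr>) = 1"
  "add (entire_alg\<lparr>carrier := S\<rparr>) = (+)" "zero (entire_alg\<lparr>carrier := S\<rparr>) = 0"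
  "smult (entire_alg\<lparr>carrier := S\<rparr>) = (\<lambda>c f. fps_const (c :: 'c) * f)"
  by (simp_all add: entire_alg_def)

text \<open>The entire series, \<open>psi_ring\<close>, \<open>E_int p\<close> and
  \<open>E_bd p\<close> share the operations of \<open>entire_alg\<close> and differ in the carrier,
  so their ring axioms reduce to closure under these operations.\<close>

definition fps_subring :: "'c fps set \<Rightarrow> bool" where
  "fps_subring S \<longleftrightarrow> 1 \<in> S \<and> (\<forall>f\<in>S. - f \<in> S) \<and> (\<forall>f\<in>S. \<forall>g\<in>S. f + g \<in> S \<and> f * g \<in> S)"

lemma fps_subring_0: "fps_subring S \<Longrightarrow> 0 \<in> S"
  unfolding fps_subring_def by (metis add.right_inverse)

lemma fps_subring_cring:
  assumes "fps_subring S" shows "cring (entire_alg\<lparr>carrier := S\<rparr>)"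
proof (rule cringI)
  show "abelian_group (entire_alg\<lparr>carrier := S\<rparr>)"
  proof (rule abelian_groupI; simp add: fps_subring_0[OF assms])
    show "\<exists>y\<in>S. y + x = 0" if "x \<in> S" for x
      using that assms by (auto simp: fps_subring_def intro!: bexI[of _ "- x"])
  qed (use assms in \<open>auto simp: fps_subring_def algebra_simps\<close>)
  show "comm_monoid (entire_alg\<lparr>carrier := S\<rparr>)"
    by (rule comm_monoidI) (use assms in \<open>auto simp: fps_subring_def mult_ac\<close>)
qed (auto simp: algebra_simps)

lemma fps_subring_a_inv:
  assumes "fps_subring S" "f \<in> S" shows "\<ominus>\<^bsub>entire_alg\<lparr>carrier := S\<rparr>\<^esub> f = - f"
proof -
  interpret cring "entire_alg\<lparr>carrier := S\<rparr>" by (rule fps_subring_cring[OF assms(1)])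
  show ?thesis using assms by (intro minus_equality) (auto simp: fps_subring_def)
qed

lemma fps_subring_a_minus:
  assumes "fps_subring S" "f \<in> S" "g \<in> S" shows "f \<ominus>\<^bsub>entire_alg\<lparr>carrier := S\<rparr>\<^esub> g = f - g"
  using assms by (simp add: a_minus_def fps_subring_a_inv)

lemma fps_subring_entire: "fps_subring (carrier entire_alg)"
  by (auto simp: fps_subring_def carrier_entire_alg fps_mult_nth intro!: Qp_sum)

lemma entire_alg_minus:
  assumes "f \<in> carrier entire_alg" "g \<in> carrier entire_alg"
  shows "f \<ominus>\<^bsub>entire_alg\<^esub> g = f - (g :: 'c fps)"
  using fps_subring_a_minus[OF fps_subring_entire assms] by simp

text \<open>The ring whose closure is \<open>E_int p\<close>; the approximating functions are found
  in it.\<close>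

definition psi_ring :: "'c fps set" where
  "psi_ring = generate_ring entire_alg (fps_const ` Zp \<union> E_gens p)"

lemma fps_const_carrier: "c \<in> Q \<Longrightarrow> fps_const c \<in> carrier entire_alg"
  by (auto simp: carrier_entire_alg)

lemma E_gens_carrier: "E_gens p \<subseteq> carrier (entire_alg :: ('c, 'c fps) module)"
  by (auto simp: E_gens_def carrier_entire_alg fps_scale_nth)

text \<open>Induction principle for \<open>psi_ring\<close>: a property is proved for all its
  elements by checking that the entire series with this property form a subring that contains the
  generators.\<close>

lemma psi_ring_least:
  assumes "fps_subring S" "S \<subseteq> carrier entire_alg" "fps_const ` Z \<subseteq> S" "E_gens p \<subseteq> S"
  shows "psi_ring \<subseteq> S"
proof
  fix f assume "f \<in> psi_ring"
  then show "f \<in> S" unfolding psi_ring_def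
  proof (induction rule: generate_ring.induct)
    case (a_inv h)
    then show ?case
      using assms(1,2) fps_subring_a_inv[OF fps_subring_entire, of h] by (auto simp: fps_subring_def)
  qed (use assms in \<open>auto simp: fps_subring_def entire_alg_def\<close>)
qed

lemma psi_ring_carrier: "psi_ring \<subseteq> carrier entire_alg"
  by (rule psi_ring_least[OF fps_subring_entire])
    (use E_gens_carrier in \<open>auto intro!: fps_const_carrier simp: Zp_iff\<close>)

lemma psi_ring_entire [simp]: "f \<in> psi_ring \<Longrightarrow> entire f"
  using psi_ring_carrier by (auto simp: carrier_entire_alg)

lemma psi_ring_Zp:
  assumes "f \<in> psi_ring" "x \<in> Q" shows "fps_eval f x \<in> Z"
proof -
  have "psi_ring \<subseteq> {f \<in> carrier entire_alg. \<forall>x\<in>Q. fps_eval f x \<in> Z}"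
    by (rule psi_ring_least)
      (use fps_subring_entire E_gens_carrier in
        \<open>auto simp: fps_subring_def carrier_entire_alg Zp_iff[of "_ :: 'c"] E_gens_def fps_scale_nth
          v_add_le vabs_mult mult_le_one v_psi_le_1\<close>)
  then show ?thesis using assms by blast
qed

lemma fps_subring_psi_ring: "fps_subring psi_ring"
  unfolding fps_subring_def
proof (intro conjI ballI)
  show "1 \<in> psi_ring"
    using generate_ring.one[of "entire_alg :: ('c, 'c fps) module"] by (simp add: psi_ring_def entire_alg_def)
  fix f assume f: "f \<in> psi_ring"
  have "\<ominus>\<^bsub>entire_alg\<^esub> f \<in> psi_ring" using f unfolding psi_ring_def by (rule generate_ring.a_inv)
  then show "- f \<in> psi_ring"
    using fps_subring_a_inv[OF fps_subring_entire, of f] psi_ring_carrier f by auto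
  fix g assume g: "g \<in> psi_ring"
  show "f + g \<in> psi_ring" using f g generate_ring.eng_add[of f entire_alg _ g]
    by (simp add: psi_ring_def entire_alg_def)
  show "f * g \<in> psi_ring" using f g generate_ring.eng_mult[of f entire_alg _ g]
    by (simp add: psi_ring_def entire_alg_def)
qed

lemma psi_ring_const [simp]: "c \<in> Z \<Longrightarrow> fps_const c \<in> psi_ring"
  unfolding psi_ring_def by (rule generate_ring.incl) auto

lemma psi_ring_Psi [simp]:
  assumes "c \<in> Q" "c \<noteq> 0" shows "fps_scale c Psi_fps \<in> psi_ring"
  unfolding psi_ring_def
proof (rule generate_ring.incl)
  \<comment> \<open>The generator with lambda = 1 / c and j = 0.\<close>
  have "fps_scale (inverse (inverse c) * of_nat p ^ 0) Psi_fps \<in> E_gens p"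
    unfolding E_gens_def using assms by (intro CollectI exI[of _ "inverse c"] exI[of _ 0]) auto
  then show "fps_scale c Psi_fps \<in> fps_const ` Zp \<union> E_gens p" by simp
qed

lemma psi_ring_closed [simp]:
  shows psi_ring_0: "0 \<in> psi_ring" and psi_ring_1: "1 \<in> psi_ring"
    and psi_ring_add: "f \<in> psi_ring \<Longrightarrow> g \<in> psi_ring \<Longrightarrow> f + g \<in> psi_ring"
    and psi_ring_mult: "f \<in> psi_ring \<Longrightarrow> g \<in> psi_ring \<Longrightarrow> f * g \<in> psi_ring"
    and psi_ring_uminus: "f \<in> psi_ring \<Longrightarrow> - f \<in> psi_ring"
  using fps_subring_psi_ring fps_subring_0 by (auto simp: fps_subring_def)

lemma psi_ring_diff [simp]: "f \<in> psi_ring \<Longrightarrow> g \<in> psi_ring \<Longrightarrow> f - g \<in> psi_ring"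
  using psi_ring_add[of f "- g"] psi_ring_uminus[of g] by simp

lemma psi_ring_power [simp]: "f \<in> psi_ring \<Longrightarrow> f ^ n \<in> psi_ring"
  by (induction n) auto

lemma psi_ring_sum: "(\<And>i. i \<in> S \<Longrightarrow> f i \<in> psi_ring) \<Longrightarrow> sum f S \<in> psi_ring"
  by (induction S rule: infinite_finite_induct) auto

lemma psi_ring_prod: "(\<And>i. i \<in> S \<Longrightarrow> f i \<in> psi_ring) \<Longrightarrow> prod f S \<in> psi_ring"
  by (induction S rule: infinite_finite_induct) auto

text \<open>By Fermat's little theorem a factor is congruent to 1 modulo \<open>p\<close> if the corresponding values
  of \<open>\<Psi>\<close> agree modulo \<open>p\<close>, and to 0 otherwise. So on the ball of all \<open>x\<close> with
  \<open>\<bar>s x\<bar> \<le> p\<^sup>k\<close> the product is, modulo \<open>p\<close>, the indicator function of \<open>c + p Z_p / s\<close>.\<close>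

definition coset_ind :: "'c \<Rightarrow> nat \<Rightarrow> 'c \<Rightarrow> 'c fps" where
  "coset_ind s k c = (\<Prod>j\<le>k. 1 - (fps_scale (s * of_nat p ^ j) Psi_fps
     - fps_const (psi (of_nat p ^ j * (s * c)))) ^ (p - 1))"

lemma coset_ind_psi_ring:
  assumes "s \<in> Q" "s \<noteq> 0" "c \<in> Q" shows "coset_ind s k c \<in> psi_ring"
  unfolding coset_ind_def using assms
  by (intro psi_ring_prod psi_ring_diff psi_ring_power psi_ring_1 psi_ring_Psi psi_ring_const psi_Zp) auto

lemma coset_ind_eval:
  "fps_eval (coset_ind s k c) x =
    (\<Prod>j\<le>k. 1 - (psi (of_nat p ^ j * (s * x)) - psi (of_nat p ^ j * (s * c))) ^ (p - 1))"
  by (simp add: coset_ind_def mult_ac)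

lemma v_prod_diff_1:
  assumes "\<And>i. i \<in> S \<Longrightarrow> v (f i - 1) \<le> 1 / real p" shows "v (prod f S - 1) \<le> 1 / real p"
  using assms
proof (induction S rule: infinite_finite_induct)
  case (insert i S)
  have "v (f i - 1) \<le> 1 / real p" using insert.prems by blast
  then have "v (f i - 1) \<le> 1" using inv_p_less_1 by linarith
  then have "v (f i) \<le> 1" using v_add_le[of "f i - 1" 1 1] by simp
  then have 1: "v (f i * (prod f S - 1)) \<le> 1 * (1 / real p)"
    unfolding vabs_mult using insert by (intro mult_mono) auto
  have 2: "v (f i - 1) \<le> 1 / real p" using insert by simp
  have "prod f (insert i S) - 1 = f i * (prod f S - 1) + (f i - 1)"
    using insert.hyps by (simp add: algebra_simps)
  then show ?case using v_add_le[OF _ 2] 1 by (simp only: mult_1)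
qed auto

lemma coset_ind_cong:
  assumes x: "x \<in> Q" "v (s * x) \<le> real p ^ k" and c: "c \<in> Q" "v (s * c) \<le> real p ^ k" and s: "s \<in> Q"
  shows "v (fps_eval (coset_ind s k c) x - (if v (s * x - s * c) \<le> 1 / real p then 1 else 0)) \<le> 1 / real p"
proof -
  define d where "d j = psi (of_nat p ^ j * (s * x)) - psi (of_nat p ^ j * (s * c))" for j
  have dZ: "d j \<in> Z" for j
    unfolding d_def diff_conv_add_uminus using x c s by (intro Zp_add Zp_minus psi_Zp) auto
  then have d1: "v (d j) \<le> 1" for j by (simp add: Zp_iff)
  have iff: "v (s * x - s * c) \<le> 1 / real p \<longleftrightarrow> (\<forall>j\<le>k. v (d j) \<le> 1 / real p)"
    unfolding d_def using x c s by (intro psi_digits) auto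
  have eval: "fps_eval (coset_ind s k c) x = (\<Prod>j\<le>k. 1 - d j ^ (p - 1))"
    by (simp add: coset_ind_eval d_def)
  show ?thesis
  proof (cases "v (s * x - s * c) \<le> 1 / real p")
    case True
    have "v (d j ^ (p - 1)) \<le> 1 / real p" if "j \<le> k" for j
    proof -
      have "v (d j) ^ (p - 1) \<le> v (d j) ^ 1"
        using p_ge_2 d1 by (intro power_decreasing) auto
      also have "\<dots> \<le> 1 / real p" using True iff that by simp
      finally show ?thesis by (simp add: v_power)
    qed
    then have "v ((\<Prod>j\<le>k. 1 - d j ^ (p - 1)) - 1) \<le> 1 / real p"
      by (intro v_prod_diff_1) simp
    with True show ?thesis by (simp add: eval)
  next
    case False
    \<comment> \<open>One index at which the values differ modulo p suffices: its factor is
      divisible by p by Fermat, and the other factors are integral.\<close>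
    then obtain i where i: "i \<le> k" "\<not> v (d i) \<le> 1 / real p" using iff by auto
    have "v (d i ^ (p - 1) - 1) \<le> 1 / real p" using Zp_fermat[OF dZ, of i] i by simp
    then have "v (1 - d i ^ (p - 1)) \<le> 1 / real p" by (simp add: v_commute)
    moreover have "v (\<Prod>j\<in>{..k} - {i}. 1 - d j ^ (p - 1)) \<le> 1"
      by (intro v_prod_le v_diff_le) (auto simp: v_power power_le_one d1)
    ultimately have "v (1 - d i ^ (p - 1)) * v (\<Prod>j\<in>{..k} - {i}. 1 - d j ^ (p - 1)) \<le> 1 / real p * 1"
      by (intro mult_mono) auto
    then have "v (\<Prod>j\<le>k. 1 - d j ^ (p - 1)) \<le> 1 / real p"
      using i by (simp add: prod.remove[of "{..k}" i] vabs_mult)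
    with False show ?thesis by (simp add: eval)
  qed
qed

lemma v_of_int_le_imp_dvd: "v (of_int n) \<le> 1 / real p ^ N \<Longrightarrow> int p ^ N dvd n"
proof (induction N arbitrary: n)
  case (Suc N)
  have "1 / real p ^ Suc N \<le> 1 / real p"
    using real_p_ge_2 by (intro divide_left_mono) (auto simp: self_le_power)
  then have "v (of_int n) \<noteq> 1" using Suc.prems inv_p_less_1 by linarith
  then obtain m where m: "n = int p * m" using v_of_int_coprime[of n] by blast
  have "v (of_int m) \<le> 1 / real p ^ N" using Suc.prems by (simp add: m vabs_mult vabs_p field_simps)
  then show ?case using Suc.IH by (simp add: m)
qed simp

lemma continuous_on_diff_v:
  fixes f g :: "'c \<Rightarrow> 'c"
  assumes "continuous_on S f" "continuous_on S g" shows "continuous_on S (\<lambda>x. f x - g x)"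
  unfolding continuous_on_iff
proof (intro ballI allI impI)
  fix x and e :: real assume "x \<in> S" "e > 0"
  then obtain a b where a: "a > 0" "\<And>y. y \<in> S \<Longrightarrow> dist y x < a \<Longrightarrow> v (f y - f x) < e"
    and b: "b > 0" "\<And>y. y \<in> S \<Longrightarrow> dist y x < b \<Longrightarrow> v (g y - g x) < e"
    using assms unfolding continuous_on_iff by (metis dist_vabs)
  show "\<exists>d>0. \<forall>y\<in>S. dist y x < d \<longrightarrow> dist (f y - g y) (f x - g x) < e"
  proof (intro exI[of _ "min a b"] conjI ballI impI)
    fix y assume "y \<in> S" "dist y x < min a b"
    then have "v ((f y - f x) - (g y - g x)) < e"
      using v_diff[of "f y - f x" "g y - g x"] a(2)[of y] b(2)[of y] by simp
    then show "dist (f y - g y) (f x - g x) < e" by (simp add: dist_vabs algebra_simps)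
  qed (use a b in simp)
qed

text \<open>By uniform continuity \<open>f\<close> is constant modulo p on the cosets of a small
  ball, and modulo p the indicators of these cosets lie in \<open>psi_ring\<close>. The sum of the
  indicators, weighted by the values of \<open>f\<close> at the centres, is therefore congruent to
  \<open>f\<close>.\<close>

lemma approx_mod_p:
  assumes cont: "continuous_on (pball p (- int m)) f" and fZ: "\<And>x. x \<in> pball p (- int m) \<Longrightarrow> f x \<in> Z"
  shows "\<exists>g\<in>psi_ring. \<forall>x\<in>pball p (- int m). v (f x - fps_eval g x) \<le> 1 / real p"
proof -
  let ?B = "pball p (- int m) :: 'c set"
  have "uniformly_continuous_on ?B f" by (rule compact_uniformly_continuous[OF cont compact_pball])
  then obtain d where d: "d > 0" "\<And>x y. x \<in> ?B \<Longrightarrow> y \<in> ?B \<Longrightarrow> v (x - y) < d \<Longrightarrow> v (f x - f y) < 1 / real p"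
    unfolding uniformly_continuous_on_def dist_vabs by (metis of_nat_0_less_iff p_pos zero_less_divide_1_iff v_commute)
  obtain M where M: "1 / real p ^ M < d" using d(1) by (rule inv_p_power_small)
  \<comment> \<open>Scaling by p^(-M) turns cosets of p^(M+1) Z_p into cosets of p Z_p, which
    \<open>coset_ind\<close> detects. It also enlarges the ball to radius p^(m+M), whence the
    argument m + M of \<open>coset_ind\<close>.\<close>
  define s :: 'c where "s = 1 / of_nat p ^ M"
  \<comment> \<open>p^N is the number of cosets of p^(M+1) Z_p in p^(-m) Z_p; their centres are the
    i / p^m with i < p^N.\<close>
  define N where "N = m + Suc M"
  define c :: "nat \<Rightarrow> 'c" where "c i = of_nat i / of_nat p ^ m" for i
  define g where "g = (\<Sum>i<p ^ N. fps_const (f (c i)) * coset_ind s (m + M) (c i))"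
  have p0: "of_nat p \<noteq> (0 :: 'c)" by simp
  have sQ: "s \<in> Q" "s \<noteq> 0" by (auto simp: s_def)
  have vs: "v (s * z) = v z * real p ^ M" for z
    using v_div_p_power[of z M] by (simp add: s_def)
  have cQ: "c i \<in> Q" for i by (simp add: c_def)
  have cB: "c i \<in> ?B" for i
    using mult_right_mono[OF v_of_nat_le[of i], of "real p ^ m"] cQ by (simp add: pball_neg c_def v_div_p_power)
  have near: "v (s * x - s * y) \<le> 1 / real p \<longleftrightarrow> v (x - y) \<le> 1 / real p ^ Suc M" for x y
    using vs[of "x - y"] by (simp add: right_diff_distrib pos_le_divide_eq mult_ac)
  have "g \<in> psi_ring"
    unfolding g_def using cB cQ sQ fZ
    by (intro psi_ring_sum psi_ring_mult psi_ring_const coset_ind_psi_ring) auto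
  moreover have "v (f x - fps_eval g x) \<le> 1 / real p" if x: "x \<in> ?B" for x
  proof -
    have xQ: "x \<in> Q" "v x \<le> real p ^ m" using x by (auto simp: pball_neg)
    have "of_nat p ^ m * x \<in> Z"
      using xQ by (simp add: Zp_iff vabs_mult v_power vabs_p power_one_over field_simps)
    then obtain i where i: "i < p ^ N" "v (of_nat p ^ m * x - of_nat i) \<le> 1 / real p ^ N"
      using Zp_nat_approx by blast
    have "x - c i = (of_nat p ^ m * x - of_nat i) / of_nat p ^ m"
      by (simp add: c_def field_simps)
    then have "v (x - c i) = v (of_nat p ^ m * x - of_nat i) * real p ^ m"
      by (simp only: v_div_p_power)
    also have "\<dots> \<le> 1 / real p ^ N * real p ^ m" using i by (intro mult_right_mono) auto
    also have "\<dots> = 1 / real p ^ Suc M" by (simp add: N_def power_add)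
    finally have xi: "v (x - c i) \<le> 1 / real p ^ Suc M" .
    have ind: "v (fps_eval (coset_ind s (m + M) (c j)) x - (if v (s * x - s * c j) \<le> 1 / real p then 1 else 0)) \<le> 1 / real p" for j
      using xQ cB[of j] sQ by (intro coset_ind_cong) (auto simp: vs pball_neg power_add)
    have term1: "v (f x - f (c i) * fps_eval (coset_ind s (m + M) (c i)) x) \<le> 1 / real p"
    proof -
      have "1 / real p ^ Suc M \<le> 1 / real p ^ M"
        using real_p_ge_2 by (intro divide_left_mono power_increasing) auto
      then have "v (x - c i) < d" using xi M by linarith
      then have "v (f x - f (c i)) \<le> 1 / real p" using d(2)[OF x cB, of i] by simp
      moreover have "v (fps_eval (coset_ind s (m + M) (c i)) x - 1) \<le> 1 / real p"
        using ind[of i] xi near by simp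
      then have "v (f (c i) * (fps_eval (coset_ind s (m + M) (c i)) x - 1)) \<le> 1 * (1 / real p)"
        unfolding vabs_mult using fZ[OF cB] by (intro mult_mono) (auto simp: Zp_iff)
      then have "v (f (c i) * (fps_eval (coset_ind s (m + M) (c i)) x - 1)) \<le> 1 / real p" by simp
      ultimately have "v ((f x - f (c i)) - f (c i) * (fps_eval (coset_ind s (m + M) (c i)) x - 1)) \<le> 1 / real p"
        by (rule v_diff_le)
      then show ?thesis by (simp add: algebra_simps)
    qed
    have term2: "v (\<Sum>j\<in>{..<p ^ N} - {i}. f (c j) * fps_eval (coset_ind s (m + M) (c j)) x) \<le> 1 / real p"
    proof (rule v_sum_le)
      fix j assume j: "j \<in> {..<p ^ N} - {i}"
      \<comment> \<open>Two centres in one coset would have numerators congruent modulo p^N, hence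
        equal, both being below p^N.\<close>
      have "\<not> v (x - c j) \<le> 1 / real p ^ Suc M"
      proof
        assume "v (x - c j) \<le> 1 / real p ^ Suc M"
        then have "v ((x - c j) - (x - c i)) \<le> 1 / real p ^ Suc M" using xi by (rule v_diff_le)
        moreover have "(x - c j) - (x - c i) = of_int (int i - int j) / of_nat p ^ m"
          by (simp add: c_def diff_divide_distrib)
        ultimately have "v (of_int (int i - int j)) * real p ^ m \<le> 1 / real p ^ Suc M"
          by (simp only: v_div_p_power)
        then have "v (of_int (int i - int j)) \<le> 1 / real p ^ N"
          by (simp add: N_def power_add field_simps)
        then have "int p ^ N dvd int i - int j" by (rule v_of_int_le_imp_dvd)
        then have "int i mod int p ^ N = int j mod int p ^ N" by (simp add: mod_eq_dvd_iff)
        moreover have "int i < int p ^ N" "int j < int p ^ N"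
          using i(1) j by (simp_all flip: of_nat_power)
        ultimately show False using j by simp
      qed
      then have "v (fps_eval (coset_ind s (m + M) (c j)) x) \<le> 1 / real p" using ind[of j] near by simp
      then have "v (f (c j)) * v (fps_eval (coset_ind s (m + M) (c j)) x) \<le> 1 * (1 / real p)"
        using fZ[OF cB] by (intro mult_mono) (auto simp: Zp_iff)
      then show "v (f (c j) * fps_eval (coset_ind s (m + M) (c j)) x) \<le> 1 / real p" by (simp add: vabs_mult)
    qed simp
    have ent: "entire (coset_ind s (m + M) (c j))" for j
      using coset_ind_psi_ring[OF sQ cQ] by simp
    have "fps_eval g x = (\<Sum>j<p ^ N. f (c j) * fps_eval (coset_ind s (m + M) (c j)) x)"
      unfolding g_def by (simp add: ent)
    also have "\<dots> = f (c i) * fps_eval (coset_ind s (m + M) (c i)) x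
        + (\<Sum>j\<in>{..<p ^ N} - {i}. f (c j) * fps_eval (coset_ind s (m + M) (c j)) x)"
      using i(1) by (intro sum.remove) auto
    finally have "f x - fps_eval g x = (f x - f (c i) * fps_eval (coset_ind s (m + M) (c i)) x)
        - (\<Sum>j\<in>{..<p ^ N} - {i}. f (c j) * fps_eval (coset_ind s (m + M) (c j)) x)" by simp
    then show ?thesis using v_diff_le[OF term1 term2] by (simp only:)
  qed
  ultimately show ?thesis by blast
qed

text \<open>The error of an approximation modulo p, divided by p, is again continuous and Z_p-valued
  on the ball. Approximating it modulo p^N and adding p times the result gains one more power of
  p.\<close>

lemma approx:
  assumes "continuous_on (pball p (- int m)) f" and "\<And>x. x \<in> pball p (- int m) \<Longrightarrow> f x \<in> Z"
  shows "\<exists>g\<in>psi_ring. \<forall>x\<in>pball p (- int m). v (f x - fps_eval g x) \<le> 1 / real p ^ N"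
  using assms
proof (induction N arbitrary: f)
  case 0
  then show ?case by (intro bexI[of _ 0]) (auto simp: Zp_iff)
next
  case (Suc N)
  let ?B = "pball p (- int m) :: 'c set"
  obtain g0 where g0: "g0 \<in> psi_ring" "\<And>x. x \<in> ?B \<Longrightarrow> v (f x - fps_eval g0 x) \<le> 1 / real p"
    using approx_mod_p[OF Suc.prems] by blast
  define h where "h x = inverse (of_nat p) * (f x - fps_eval g0 x)" for x
  have "continuous_on ?B h"
    unfolding h_def using Suc.prems(1) g0(1)
    by (intro continuous_on_compose2[OF continuous_on_mult_left_v[of UNIV]] continuous_on_diff_v continuous_on_eval) auto
  moreover have "h x \<in> Z" if "x \<in> ?B" for x
  proof -
    have "x \<in> Q" using that by (simp add: pball_eq)
    then have "h x \<in> Q" using Suc.prems(2)[OF that] psi_ring_Zp[OF g0(1)]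
      by (auto simp: h_def Zp_iff simp del: inverse_eq_divide)
    moreover have "v (h x) \<le> 1" using g0(2)[OF that] by (simp add: h_def vabs_mult v_inverse v_divide vabs_p field_simps)
    ultimately show ?thesis by (simp add: Zp_iff)
  qed
  ultimately obtain g1 where g1: "g1 \<in> psi_ring" "\<And>x. x \<in> ?B \<Longrightarrow> v (h x - fps_eval g1 x) \<le> 1 / real p ^ N"
    using Suc.IH by blast
  have "v (f x - fps_eval (g0 + fps_const (of_nat p) * g1) x) \<le> 1 / real p ^ Suc N" if "x \<in> ?B" for x
  proof -
    have eq: "f x - fps_eval (g0 + fps_const (of_nat p) * g1) x = of_nat p * (h x - fps_eval g1 x)"
      using g0(1) g1(1) by (simp add: h_def field_simps)
    show ?thesis unfolding eq vabs_mult vabs_p using g1(2)[OF that] by (simp add: field_simps)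
  qed
  then show ?case using g0(1) g1(1) by (intro bexI[of _ "g0 + fps_const (of_nat p) * g1"]) auto
qed

section \<open>The rings \<open>\<E>\<degree>\<close> and \<open>\<E>\<^sup>b\<^sup>d\<close>\<close>

lemma vp_ge_iff: "ereal (real N) \<le> vp p z \<longleftrightarrow> v z \<le> 1 / real p ^ N"
proof (cases "z = 0")
  case False
  have "real N \<le> - log p (v z) \<longleftrightarrow> log p (v z) \<le> - real N" by linarith
  also have "\<dots> \<longleftrightarrow> v z \<le> real p powr (- real N)" using False real_p_ge_2 by (intro log_le_iff) auto
  also have "real p powr (- real N) = 1 / real p ^ N"
    by (simp add: powr_minus powr_realpow inverse_eq_divide)
  finally show ?thesis using False by (simp add: vp_def)
qed (simp add: vp_def)

lemma image_unit_ball: "(\<lambda>x. of_nat p powi (- r) * x) ` {x :: 'c. v x \<le> 1} = {x. v x \<le> real p powi r}"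
proof (intro equalityI subsetI)
  fix x assume "x \<in> (\<lambda>x. of_nat p powi (- r) * x) ` {x :: 'c. v x \<le> 1}"
  then obtain y where "x = of_nat p powi (- r) * y" "v y \<le> 1" by auto
  then show "x \<in> {x. v x \<le> real p powi r}"
    using mult_left_mono[of "v y" 1 "real p powi r"] v_p_powi[of "- r"] by (simp add: vabs_mult)
next
  fix x :: 'c assume x: "x \<in> {x. v x \<le> real p powi r}"
  have "v (of_nat p powi r * x) = real p powi (- r) * v x" by (simp only: vabs_mult v_p_powi)
  also have "\<dots> \<le> real p powi (- r) * real p powi r" using x by (intro mult_left_mono) auto
  also have "\<dots> = 1" by (simp add: power_int_minus)
  finally have "v (of_nat p powi r * x) \<le> 1" .
  moreover have "x = of_nat p powi (- r) * (of_nat p powi r * x)" by (simp add: power_int_minus)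
  ultimately show "x \<in> (\<lambda>x. of_nat p powi (- r) * x) ` {x :: 'c. v x \<le> 1}" by blast
qed

lemma w_val_ge_iff:
  "ereal (real N) \<le> w_val p r f \<longleftrightarrow> (\<forall>x. v x \<le> real p powi r \<longrightarrow> v (fps_eval f x) \<le> 1 / real p ^ N)"
  unfolding w_val_def image_unit_ball le_INF_iff vp_ge_iff by auto

text \<open>Here x ranges over a disc of C_p, not of Q_p: this is closeness in the Frechet topology
  of entire functions, to be contrasted with \<open>cont_nb\<close>.\<close>

definition close_on_ball :: "nat \<Rightarrow> nat \<Rightarrow> 'c fps \<Rightarrow> 'c fps \<Rightarrow> bool" where
  "close_on_ball k N f g \<longleftrightarrow> (\<forall>x. v x \<le> real p ^ k \<longrightarrow> v (fps_eval f x - fps_eval g x) \<le> 1 / real p ^ N)"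

lemma close_on_ballD: "close_on_ball k N f g \<Longrightarrow> v x \<le> real p ^ k \<Longrightarrow> v (fps_eval f x - fps_eval g x) \<le> 1 / real p ^ N"
  by (simp add: close_on_ball_def)

lemma topspace_entire: "topspace (entire_topology p) = carrier (entire_alg :: ('c, 'c fps) module)"
proof
  show "topspace (entire_topology p) \<subseteq> carrier (entire_alg :: ('c, 'c fps) module)"
    using openin_topspace[of "entire_topology p :: 'c fps topology"]
    unfolding entire_topology_def openin_valuation_topology by blast
  have "openin (entire_topology p) (carrier (entire_alg :: ('c, 'c fps) module))"
    unfolding entire_topology_def openin_valuation_topology
    by (auto intro!: exI[of _ "{}"])
  then show "carrier (entire_alg :: ('c, 'c fps) module) \<subseteq> topspace (entire_topology p)"
    by (rule openin_subset)
qed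

text \<open>A basic neighbourhood involves finitely many valuations \<open>w_val p i\<close>. As
  \<open>w_val p i\<close> decreases when the radius p^i grows, they are all controlled by one large
  radius p^k, and the real threshold by a natural number N.\<close>

lemma E_int_iff:
  "f \<in> E_int p \<longleftrightarrow> f \<in> carrier entire_alg \<and> (\<forall>k N. \<exists>g\<in>psi_ring. close_on_ball k N g f)"
proof
  assume f: "f \<in> E_int p"
  then have fc: "f \<in> carrier entire_alg"
    unfolding E_int_def in_closure_of topspace_entire by blast
  moreover have "\<exists>g\<in>psi_ring. close_on_ball k N g f" for k N
  proof -
    let ?U = "{g \<in> carrier entire_alg. close_on_ball k N g f}"
    have U: "openin (entire_topology p) ?U"
      unfolding entire_topology_def openin_valuation_topology
    proof (intro conjI ballI)
      fix g assume g: "g \<in> ?U"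
      have "h \<in> ?U" if h: "h \<in> carrier entire_alg" "w_val p (int k) (h \<ominus>\<^bsub>entire_alg\<^esub> g) > ereal (real N)" for h
      proof -
        have "ereal (real N) \<le> w_val p (int k) (h - g)"
          using h g by (auto simp: entire_alg_minus)
        then have "v (fps_eval h x - fps_eval g x) \<le> 1 / real p ^ N" if "v x \<le> real p ^ k" for x
          using that h(1) g by (auto simp: w_val_ge_iff carrier_entire_alg)
        then show ?thesis using g h(1) unfolding close_on_ball_def by (auto intro: v_trans_le)
      qed
      then show "\<exists>F M. finite F \<and> F \<subseteq> UNIV \<and> {y \<in> carrier entire_alg. \<forall>i\<in>F. ereal M < w_val p i (y \<ominus>\<^bsub>entire_alg\<^esub> g)} \<subseteq> ?U"
        by (intro exI[of _ "{int k}"] exI[of _ "real N"]) auto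
    qed auto
    have fU: "f \<in> ?U" using fc by (simp add: close_on_ball_def)
    have "\<forall>T. f \<in> T \<and> openin (entire_topology p) T \<longrightarrow> (\<exists>g. g \<in> psi_ring \<and> g \<in> T)"
      using f unfolding E_int_def in_closure_of psi_ring_def[symmetric] by (rule conjunct2)
    from this[rule_format, OF conjI[OF fU U]] show ?thesis by blast
  qed
  ultimately show "f \<in> carrier entire_alg \<and> (\<forall>k N. \<exists>g\<in>psi_ring. close_on_ball k N g f)" by blast
next
  assume *: "f \<in> carrier entire_alg \<and> (\<forall>k N. \<exists>g\<in>psi_ring. close_on_ball k N g f)"
  show "f \<in> E_int p"
    unfolding E_int_def in_closure_of topspace_entire psi_ring_def[symmetric]
  proof (intro conjI allI impI)
    show "f \<in> carrier entire_alg" using * by blast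
    fix U assume U: "f \<in> U \<and> openin (entire_topology p) U"
    then obtain F M where F: "finite F" "{y \<in> carrier entire_alg. \<forall>i\<in>F. ereal M < w_val p i (y \<ominus>\<^bsub>entire_alg\<^esub> f)} \<subseteq> U"
      unfolding entire_topology_def openin_valuation_topology by blast
    obtain k where k: "\<And>i. i \<in> F \<Longrightarrow> i \<le> int k"
    proof -
      \<comment> \<open>\<open>F\<close> may be empty, so 0 is inserted before taking
        \<open>Max\<close>.\<close>
      have "\<forall>i\<in>F. i \<le> int (nat (Max (insert 0 F)))" using F(1) by (auto simp: Max_ge_iff)
      then show thesis using that by blast
    qed
    obtain N :: nat where N: "M < real N" using reals_Archimedean2 by blast
    obtain g where g: "g \<in> psi_ring" "close_on_ball k N g f" using * by blast
    have gc: "g \<in> carrier entire_alg" using g(1) psi_ring_carrier by blast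
    have "ereal M < w_val p i (g \<ominus>\<^bsub>entire_alg\<^esub> f)" if i: "i \<in> F" for i
    proof -
      have "real p powi i \<le> real p powi (int k)"
        using k[OF i] real_p_ge_2 by (intro power_int_increasing) auto
      then have "ereal (real N) \<le> w_val p i (g - f)"
        using g gc * by (auto simp: w_val_ge_iff close_on_ball_def carrier_entire_alg)
      then have "ereal M < w_val p i (g - f)" 
        by (rule order.strict_trans2[rotated]) (simp add: N)
      then show ?thesis using gc * by (simp add: entire_alg_minus)
    qed
    then have "g \<in> U" using F(2) gc by blast
    then show "\<exists>y. y \<in> psi_ring \<and> y \<in> U" using g(1) by blast
  qed
qed

lemma E_int_carrier: "E_int p \<subseteq> carrier (entire_alg :: ('c, 'c fps) module)"
  using E_int_iff by blast

lemma E_int_entire [simp]: "f \<in> E_int p \<Longrightarrow> entire f"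
  using E_int_carrier by (auto simp: carrier_entire_alg)

lemma psi_ring_E_int: "psi_ring \<subseteq> E_int p"
proof
  fix f assume f: "f \<in> psi_ring"
  have "close_on_ball k N f f" for k N by (simp add: close_on_ball_def)
  with f psi_ring_carrier show "f \<in> E_int p" unfolding E_int_iff by blast
qed

lemma E_int_Zp:
  assumes f: "f \<in> E_int p" and x: "x \<in> Q" shows "fps_eval f x \<in> Z"
proof -
  obtain k where k: "v x \<le> real p ^ k" by (rule p_power_large)
  \<comment> \<open>Precision 1 suffices, as Z_p is the closed unit ball of Q_p and the ultrametric
    inequality keeps values inside it.\<close>
  obtain g where g: "g \<in> psi_ring" "close_on_ball k 0 g f" using f unfolding E_int_iff by blast
  have "v (fps_eval g x - (fps_eval g x - fps_eval f x)) \<le> 1"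
    by (rule v_diff_le) (use psi_ring_Zp[OF g(1) x] close_on_ballD[OF g(2) k] in \<open>auto simp: Zp_iff\<close>)
  moreover have "fps_eval f x \<in> Q" using f x E_int_carrier by (intro eval_Qp) auto
  ultimately show ?thesis by (simp add: Zp_iff)
qed

lemma entire_bounded:
  assumes "entire f" shows "\<exists>M. \<forall>x. v x \<le> real p ^ k \<longrightarrow> v (fps_eval f x) \<le> real p ^ M"
proof -
  obtain A where A: "gauss_le (real p ^ k) f A" using assms by (auto simp: entire_def)
  obtain M where "A \<le> real p ^ M" by (rule p_power_large)
  then show ?thesis using eval_le[OF assms A] order_trans by blast
qed

lemma fps_subring_E_int: "fps_subring (E_int p)"
  unfolding fps_subring_def
proof (intro conjI ballI)
  show "(1 :: 'c fps) \<in> E_int p" by (rule subsetD[OF psi_ring_E_int psi_ring_1])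
  fix f :: "'c fps" assume f: "f \<in> E_int p"
  have fc: "f \<in> carrier entire_alg" using f E_int_carrier by blast
  show "- f \<in> E_int p" unfolding E_int_iff
  proof (intro conjI allI)
    show "- f \<in> carrier entire_alg" using fps_subring_entire fc by (auto simp: fps_subring_def)
    fix k N
    obtain g where "g \<in> psi_ring" "close_on_ball k N g f" using f unfolding E_int_iff by blast
    then show "\<exists>g\<in>psi_ring. close_on_ball k N g (- f)"
      using f by (intro bexI[of _ "- g"]) (auto simp: close_on_ball_def v_commute)
  qed
  fix g :: "'c fps" assume g: "g \<in> E_int p"
  have gc: "g \<in> carrier entire_alg" using g E_int_carrier by blast
  show "f + g \<in> E_int p" unfolding E_int_iff
  proof (intro conjI allI)
    show "f + g \<in> carrier entire_alg" using fps_subring_entire fc gc by (auto simp: fps_subring_def)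
    fix k N
    obtain f' where f': "f' \<in> psi_ring" "close_on_ball k N f' f" using f unfolding E_int_iff by blast
    obtain g' where g': "g' \<in> psi_ring" "close_on_ball k N g' g" using g unfolding E_int_iff by blast
    have "close_on_ball k N (f' + g') (f + g)"
      unfolding close_on_ball_def
    proof (intro allI impI)
      fix x assume "v x \<le> real p ^ k"
      then have "v ((fps_eval f' x - fps_eval f x) + (fps_eval g' x - fps_eval g x)) \<le> 1 / real p ^ N"
        using f' g' by (intro v_add_le close_on_ballD)
      then show "v (fps_eval (f' + g') x - fps_eval (f + g) x) \<le> 1 / real p ^ N"
        using f g f' g' by (simp add: algebra_simps)
    qed
    then show "\<exists>h\<in>psi_ring. close_on_ball k N h (f + g)" using f' g' by (intro bexI[of _ "f' + g'"]) auto
  qed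
  show "f * g \<in> E_int p" unfolding E_int_iff
  proof (intro conjI allI)
    show "f * g \<in> carrier entire_alg" using fps_subring_entire fc gc by (auto simp: fps_subring_def)
    fix k N
    obtain A where A: "\<forall>x. v x \<le> real p ^ k \<longrightarrow> v (fps_eval f x) \<le> real p ^ A"
      using entire_bounded[OF E_int_entire[OF f]] by blast
    obtain B where B: "\<forall>x. v x \<le> real p ^ k \<longrightarrow> v (fps_eval g x) \<le> real p ^ B"
      using entire_bounded[OF E_int_entire[OF g]] by blast
    \<comment> \<open>The error of f' is multiplied by g, of size up to p^B, and that of g' by f, of
      size up to p^A; hence the precisions N + B and N + A.\<close>
    obtain f' where f': "f' \<in> psi_ring" "close_on_ball k (N + B) f' f" using f unfolding E_int_iff by blast
    obtain g' where g': "g' \<in> psi_ring" "close_on_ball k (N + A) g' g" using g unfolding E_int_iff by blast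
    have "close_on_ball k N (f' * g') (f * g)"
      unfolding close_on_ball_def
    proof (intro allI impI)
      fix x assume x: "v x \<le> real p ^ k"
      have d1: "v (fps_eval f' x - fps_eval f x) \<le> 1 / real p ^ (N + B)" by (rule close_on_ballD[OF f'(2) x])
      have d2: "v (fps_eval g' x - fps_eval g x) \<le> 1 / real p ^ (N + A)" by (rule close_on_ballD[OF g'(2) x])
      have "v ((fps_eval f' x - fps_eval f x) * fps_eval g x) \<le> 1 / real p ^ (N + B) * real p ^ B"
        unfolding vabs_mult using d1 B x by (intro mult_mono) auto
      then have 1: "v ((fps_eval f' x - fps_eval f x) * fps_eval g x) \<le> 1 / real p ^ N"
        by (simp add: power_add)
      have "v (fps_eval f x * (fps_eval g' x - fps_eval g x)) \<le> real p ^ A * (1 / real p ^ (N + A))"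
        unfolding vabs_mult using d2 A x by (intro mult_mono) auto
      then have 2: "v (fps_eval f x * (fps_eval g' x - fps_eval g x)) \<le> 1 / real p ^ N"
        by (simp add: power_add)
      have "v ((fps_eval f' x - fps_eval f x) * (fps_eval g' x - fps_eval g x)) \<le> 1 / real p ^ (N + B) * 1"
        unfolding vabs_mult using d1 order_trans[OF d2 inv_p_power_le_1] by (intro mult_mono) auto
      also have "\<dots> \<le> 1 / real p ^ N"
        using real_p_ge_2 by (simp add: divide_left_mono power_increasing)
      finally have 3: "v ((fps_eval f' x - fps_eval f x) * (fps_eval g' x - fps_eval g x)) \<le> 1 / real p ^ N" .
      have "fps_eval (f' * g') x - fps_eval (f * g) x = ((fps_eval f' x - fps_eval f x) * fps_eval g x
          + fps_eval f x * (fps_eval g' x - fps_eval g x))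
          + (fps_eval f' x - fps_eval f x) * (fps_eval g' x - fps_eval g x)"
        using f g f' g' by (simp add: algebra_simps)
      then show "v (fps_eval (f' * g') x - fps_eval (f * g) x) \<le> 1 / real p ^ N"
        using v_add_le[OF v_add_le[OF 1 2] 3] by simp
    qed
    then show "\<exists>h\<in>psi_ring. close_on_ball k N h (f * g)" using f' g' by (intro bexI[of _ "f' * g'"]) auto
  qed
qed

lemma E_int_const_mult: "c \<in> Z \<Longrightarrow> f \<in> E_int p \<Longrightarrow> fps_const c * f \<in> E_int p"
  using fps_subring_E_int psi_ring_E_int psi_ring_const unfolding fps_subring_def by blast

text \<open>Clearing denominators: closure properties of \<open>E_bd p\<close> are then verified
  inside \<open>E_int p\<close>, after multiplication by a common power of p.\<close>

lemma E_bd_iff: "f \<in> E_bd p \<longleftrightarrow> (\<exists>n. fps_const (of_nat p ^ n) * f \<in> (E_int p :: 'c fps set))"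
proof
  assume "f \<in> E_bd p"
  then obtain n g where "f = fps_const (1 / of_nat p ^ n) * g" "g \<in> E_int p" by (auto simp: E_bd_def)
  then have "fps_const (of_nat p ^ n) * f = g"
    by (simp flip: mult.assoc)
  with \<open>g \<in> E_int p\<close> show "\<exists>n. fps_const (of_nat p ^ n) * f \<in> E_int p" by blast
next
  assume "\<exists>n. fps_const (of_nat p ^ n) * f \<in> (E_int p :: 'c fps set)"
  then obtain n where n: "fps_const (of_nat p ^ n) * f \<in> E_int p" by blast
  have "f = fps_const (1 / of_nat p ^ n) * (fps_const (of_nat p ^ n) * f)"
    by (simp flip: mult.assoc)
  with n show "f \<in> E_bd p" unfolding E_bd_def by blast
qed

lemma E_bd_carrier: "E_bd p \<subseteq> carrier (entire_alg :: ('c, 'c fps) module)"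
proof
  fix f :: "'c fps" assume "f \<in> E_bd p"
  then obtain n g where "f = fps_const (1 / of_nat p ^ n) * g" "g \<in> E_int p" by (auto simp: E_bd_def)
  moreover have "fps_const (1 / of_nat p ^ n :: 'c) \<in> carrier entire_alg" by (rule fps_const_carrier) simp
  ultimately show "f \<in> carrier entire_alg"
    using fps_subring_entire E_int_carrier by (auto simp: fps_subring_def)
qed

lemma E_bd_const_mult:
  assumes "c \<in> Q" "f \<in> E_bd p" shows "fps_const c * f \<in> E_bd p"
proof -
  obtain n where n: "fps_const (of_nat p ^ n) * f \<in> E_int p" using assms(2) unfolding E_bd_iff by blast
  obtain m where m: "v c \<le> real p ^ m" by (rule p_power_large)
  have "of_nat p ^ m * c \<in> Z"
    using m assms(1) by (simp add: Zp_iff vabs_mult v_power vabs_p power_one_over field_simps)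
  then have "fps_const (of_nat p ^ m * c) * (fps_const (of_nat p ^ n) * f) \<in> E_int p"
    using n by (rule E_int_const_mult)
  moreover have "fps_const (of_nat p ^ m * c) * (fps_const (of_nat p ^ n) * f)
      = fps_const (of_nat p ^ (m + n)) * (fps_const c * f)"
    by (simp add: power_add algebra_simps flip: fps_const_mult)
  ultimately show ?thesis unfolding E_bd_iff by metis
qed

lemma E_int_subset_E_bd: "E_int p \<subseteq> (E_bd p :: 'c fps set)"
  unfolding E_bd_iff by (auto simp: E_bd_iff intro!: exI[of _ 0])

lemma fps_subring_E_bd: "fps_subring (E_bd p)"
  unfolding fps_subring_def
proof (intro conjI ballI)
  have "(1 :: 'c fps) \<in> E_int p" using fps_subring_E_int by (simp add: fps_subring_def)
  then show "(1 :: 'c fps) \<in> E_bd p" by (rule subsetD[OF E_int_subset_E_bd])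
  fix f :: "'c fps" assume f: "f \<in> E_bd p"
  show "- f \<in> E_bd p" using E_bd_const_mult[of "-1" f] f by (simp flip: fps_const_neg)
  fix g :: "'c fps" assume g: "g \<in> E_bd p"
  obtain n where n: "fps_const (of_nat p ^ n) * f \<in> E_int p" using f unfolding E_bd_iff by blast
  obtain m where m: "fps_const (of_nat p ^ m) * g \<in> E_int p" using g unfolding E_bd_iff by blast
  have "fps_const (of_nat p ^ m) * (fps_const (of_nat p ^ n) * f)
      + fps_const (of_nat p ^ n) * (fps_const (of_nat p ^ m) * g) \<in> E_int p"
    using n m fps_subring_E_int Zp_of_nat[of "p ^ m"] Zp_of_nat[of "p ^ n"]
      E_int_const_mult[of "of_nat p ^ m"] E_int_const_mult[of "of_nat p ^ n"]
    by (simp add: fps_subring_def)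
  moreover have "fps_const (of_nat p ^ m) * (fps_const (of_nat p ^ n) * f)
      + fps_const (of_nat p ^ n) * (fps_const (of_nat p ^ m) * g) = fps_const (of_nat p ^ (n + m)) * (f + g)"
    by (simp add: power_add algebra_simps flip: fps_const_mult)
  ultimately show "f + g \<in> E_bd p" unfolding E_bd_iff by metis
  have "(fps_const (of_nat p ^ n) * f) * (fps_const (of_nat p ^ m) * g) \<in> E_int p"
    using n m fps_subring_E_int by (simp add: fps_subring_def)
  moreover have "(fps_const (of_nat p ^ n) * f) * (fps_const (of_nat p ^ m) * g)
      = fps_const (of_nat p ^ (n + m)) * (f * g)"
    by (simp add: power_add algebra_simps flip: fps_const_mult)
  ultimately show "f * g \<in> E_bd p" unfolding E_bd_iff by metis
qed

lemma E_bd_Qp: "f \<in> E_bd p \<Longrightarrow> (x :: 'c) \<in> Q \<Longrightarrow> fps_eval f x \<in> Q"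
  using E_bd_carrier by (intro eval_Qp) auto

section \<open>Algebras of continuous functions\<close>

lemma continuous_on_minus_v:
  fixes f :: "'c \<Rightarrow> 'c" assumes "continuous_on S f" shows "continuous_on S (\<lambda>x. - f x)"
  using continuous_on_diff_v[of S "\<lambda>_. 0" f] assms by simp

lemma continuous_on_add_v:
  fixes f g :: "'c \<Rightarrow> 'c"
  assumes "continuous_on S f" "continuous_on S g" shows "continuous_on S (\<lambda>x. f x + g x)"
  using continuous_on_diff_v[OF assms(1) continuous_on_minus_v[OF assms(2)]] by simp

lemma continuous_on_mult_v:
  fixes f g :: "'c \<Rightarrow> 'c"
  assumes "continuous_on S f" "continuous_on S g" shows "continuous_on S (\<lambda>x. f x * g x)"
  unfolding continuous_on_iff
proof (intro ballI allI impI)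
  fix x and e :: real assume x: "x \<in> S" and e: "e > 0"
  define B where "B = v (f x) + v (g x) + 1"
  have B: "B > 0" "v (f x) \<le> B" "v (g x) + 1 \<le> B"
    using v_nonneg[of "f x"] v_nonneg[of "g x"] unfolding B_def by linarith+
  have eB: "e / B > 0" using e B by simp
  obtain a where a: "a > 0" "\<And>y. y \<in> S \<Longrightarrow> dist y x < a \<Longrightarrow> v (f y - f x) < e / B"
    using assms(1) x eB unfolding continuous_on_iff dist_vabs by metis
  obtain b where b: "b > 0" "\<And>y. y \<in> S \<Longrightarrow> dist y x < b \<Longrightarrow> v (g y - g x) < min 1 (e / B)"
    using assms(2) x eB unfolding continuous_on_iff dist_vabs by (metis min_less_iff_conj zero_less_one)
  show "\<exists>d>0. \<forall>y\<in>S. dist y x < d \<longrightarrow> dist (f y * g y) (f x * g x) < e"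
  proof (intro exI[of _ "min a b"] conjI ballI impI)
    fix y assume y: "y \<in> S" "dist y x < min a b"
    have f: "v (f y - f x) < e / B" using a(2) y by simp
    have g: "v (g y - g x) < 1" "v (g y - g x) < e / B" using b(2)[OF y(1)] y(2) by auto
    have "v (g y) \<le> max (v (g y - g x)) (v (g x))"
      using vabs_add[of "g y - g x" "g x"] by simp
    then have "v (g y) \<le> B"
      using g(1) B(3) v_nonneg[of "g x"] by linarith
    then have "v ((f y - f x) * g y) \<le> v (f y - f x) * B"
      unfolding vabs_mult by (intro mult_left_mono) auto
    also have "\<dots> < e" using f B(1) by (simp add: pos_less_divide_eq)
    finally have 1: "v ((f y - f x) * g y) < e" .
    have "v (f x * (g y - g x)) \<le> B * v (g y - g x)"
      unfolding vabs_mult using B by (intro mult_right_mono) auto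
    also have "\<dots> < e" using g(2) B(1) by (simp add: pos_less_divide_eq mult.commute)
    finally have 2: "v (f x * (g y - g x)) < e" .
    have "f y * g y - f x * g x = (f y - f x) * g y + f x * (g y - g x)" by (simp add: algebra_simps)
    then show "dist (f y * g y) (f x * g x) < e"
      using 1 2 vabs_add[of "(f y - f x) * g y" "f x * (g y - g x)"] unfolding dist_vabs by simp
  qed (use a b in simp)
qed

text \<open>Treats Q_p and Z_p at once. Closedness returns pointwise limits of Y-valued functions to
  Y, which completeness of the function algebra relies on.\<close>

definition val_subring :: "'c set \<Rightarrow> bool" where
  "val_subring Y \<longleftrightarrow> Y \<subseteq> Q \<and> closed Y \<and> 1 \<in> Y \<and>
     (\<forall>x\<in>Y. - x \<in> Y \<and> (\<forall>y\<in>Y. x + y \<in> Y \<and> x * y \<in> Y))"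

lemma val_subring_Q: "val_subring Q" and val_subring_Z: "val_subring Z"
  using closed_Qp closed_Zp by (auto simp: val_subring_def Zp_iff v_add_le vabs_mult mult_le_one)

lemma val_subring_closed:
  assumes "val_subring Y"
  shows "0 \<in> Y" "1 \<in> Y" "x \<in> Y \<Longrightarrow> - x \<in> Y" "x \<in> Y \<Longrightarrow> y \<in> Y \<Longrightarrow> x + y \<in> Y"
    "x \<in> Y \<Longrightarrow> y \<in> Y \<Longrightarrow> x * y \<in> Y"
proof -
  show "1 \<in> Y" "x \<in> Y \<Longrightarrow> - x \<in> Y" "x \<in> Y \<Longrightarrow> y \<in> Y \<Longrightarrow> x + y \<in> Y"
    "x \<in> Y \<Longrightarrow> y \<in> Y \<Longrightarrow> x * y \<in> Y"
    using assms by (simp_all add: val_subring_def)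
  have "1 + - 1 \<in> Y" using assms unfolding val_subring_def by blast
  then show "0 \<in> Y" by simp
qed

definition scalar_ring :: "'c set \<Rightarrow> 'c ring" where
  "scalar_ring Y = \<lparr>carrier = Y, mult = (*), one = 1, zero = 0, add = (+)\<rparr>"

lemma scalar_ring_sel [simp]:
  "carrier (scalar_ring Y) = Y" "mult (scalar_ring Y) = (*)" "one (scalar_ring Y) = 1"
  "zero (scalar_ring Y) = 0" "add (scalar_ring Y) = (+)"
  by (simp_all add: scalar_ring_def)

lemma cring_scalar_ring:
  assumes "val_subring Y" shows "cring (scalar_ring Y)"
proof (rule cringI)
  show "abelian_group (scalar_ring Y)"
  proof (rule abelian_groupI; simp)
    show "\<exists>y\<in>Y. y + x = 0" if "x \<in> Y" for x
      using that val_subring_closed[OF assms] by (intro bexI[of _ "- x"]) auto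
  qed (use val_subring_closed[OF assms] in \<open>auto simp: algebra_simps\<close>)
  show "comm_monoid (scalar_ring Y)"
    by (rule comm_monoidI) (auto intro: val_subring_closed[OF assms] simp: mult_ac)
qed (auto simp: algebra_simps)

lemma cont_alg_sel [simp]:
  "mult (cont_alg Y) = (\<lambda>f g. \<lambda>x\<in>Q. f x * g x)" "one (cont_alg Y) = (\<lambda>x\<in>Q. 1)"
  "zero (cont_alg Y) = (\<lambda>x\<in>Q. 0)" "add (cont_alg Y) = (\<lambda>f g. \<lambda>x\<in>Q. f x + g x)"
  "smult (cont_alg Y) = (\<lambda>c f. \<lambda>x\<in>Q. c * f x)"
  by (simp_all add: cont_alg_def)

lemma cont_alg_carrier:
  "f \<in> carrier (cont_alg Y) \<longleftrightarrow> (\<forall>x\<in>Q. f x \<in> Y) \<and> (\<forall>x. x \<notin> Q \<longrightarrow> f x = undefined) \<and> continuous_on Q f"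
  by (auto simp: cont_alg_def PiE_def extensional_def)

lemma cont_alg_restrict:
  "(\<lambda>x\<in>Q. f x) \<in> carrier (cont_alg Y) \<longleftrightarrow> (\<forall>x\<in>Q. f x \<in> Y) \<and> continuous_on Q f"
  by (auto simp: cont_alg_carrier cong: continuous_on_cong)

lemma cont_alg_ext:
  assumes "f \<in> carrier (cont_alg Y)" "\<And>x. x \<in> Q \<Longrightarrow> f x = g x" shows "(\<lambda>x\<in>Q. g x) = f"
  using assms by (auto simp: cont_alg_carrier restrict_def)

lemma cont_alg_add_closed:
  assumes "val_subring Y" "f \<in> carrier (cont_alg Y)" "g \<in> carrier (cont_alg Y)"
  shows "(\<lambda>x\<in>Q. f x + g x) \<in> carrier (cont_alg Y)"
  using assms val_subring_closed[OF assms(1)] unfolding cont_alg_restrict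
  by (auto simp: cont_alg_carrier intro!: continuous_on_add_v)

lemma cont_alg_mult_closed:
  assumes "val_subring Y" "f \<in> carrier (cont_alg Y)" "g \<in> carrier (cont_alg Y)"
  shows "(\<lambda>x\<in>Q. f x * g x) \<in> carrier (cont_alg Y)"
  using assms val_subring_closed[OF assms(1)] unfolding cont_alg_restrict
  by (auto simp: cont_alg_carrier intro!: continuous_on_mult_v)

lemma cont_alg_minus_closed:
  assumes "val_subring Y" "f \<in> carrier (cont_alg Y)"
  shows "(\<lambda>x\<in>Q. - f x) \<in> carrier (cont_alg Y)"
  using assms val_subring_closed[OF assms(1)] unfolding cont_alg_restrict
  by (auto simp: cont_alg_carrier intro!: continuous_on_minus_v)

lemma cont_alg_const_closed:
  assumes "c \<in> Y" shows "(\<lambda>x\<in>Q. c) \<in> carrier (cont_alg Y)"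
  using assms unfolding cont_alg_restrict by auto

lemma cring_cont_alg:
  assumes Y: "val_subring Y" shows "cring (cont_alg Y)"
proof (rule cringI)
  note cl = val_subring_closed[OF Y]
  show "abelian_group (cont_alg Y)"
  proof (rule abelian_groupI)
    fix f assume f: "f \<in> carrier (cont_alg Y)"
    show "\<zero>\<^bsub>cont_alg Y\<^esub> \<oplus>\<^bsub>cont_alg Y\<^esub> f = f"
      unfolding cont_alg_sel by (rule cont_alg_ext[OF f]) simp
    show "\<exists>g\<in>carrier (cont_alg Y). g \<oplus>\<^bsub>cont_alg Y\<^esub> f = \<zero>\<^bsub>cont_alg Y\<^esub>"
      using cont_alg_minus_closed[OF Y f] by (intro bexI[of _ "\<lambda>x\<in>Q. - f x"]) (auto simp: fun_eq_iff)
  qed (auto simp: fun_eq_iff add_ac cont_alg_add_closed[OF Y] cont_alg_const_closed cl)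
  show "comm_monoid (cont_alg Y)"
  proof (rule comm_monoidI)
    fix f assume f: "f \<in> carrier (cont_alg Y)"
    show "\<one>\<^bsub>cont_alg Y\<^esub> \<otimes>\<^bsub>cont_alg Y\<^esub> f = f"
      unfolding cont_alg_sel by (rule cont_alg_ext[OF f]) simp
  qed (auto simp: fun_eq_iff mult_ac cont_alg_mult_closed[OF Y] cont_alg_const_closed cl)
qed (auto simp: fun_eq_iff algebra_simps)

lemma cont_alg_minus:
  assumes Y: "val_subring Y" and f: "f \<in> carrier (cont_alg Y)" and g: "g \<in> carrier (cont_alg Y)"
  shows "f \<ominus>\<^bsub>cont_alg Y\<^esub> g = (\<lambda>x\<in>Q. f x - g x)"
proof -
  interpret cring "cont_alg Y" by (rule cring_cont_alg[OF Y])
  have "\<ominus>\<^bsub>cont_alg Y\<^esub> g = (\<lambda>x\<in>Q. - g x)"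
    using g cont_alg_minus_closed[OF Y g] by (intro minus_equality) (auto simp: fun_eq_iff)
  then show ?thesis by (auto simp: a_minus_def fun_eq_iff)
qed

lemma algebra_cont_alg:
  assumes Y: "val_subring Y" shows "Module.algebra (scalar_ring Y) (cont_alg Y)"
proof (rule algebraI[OF cring_scalar_ring[OF Y] cring_cont_alg[OF Y]])
  fix f assume f: "f \<in> carrier (cont_alg Y)"
  show "\<one>\<^bsub>scalar_ring Y\<^esub> \<odot>\<^bsub>cont_alg Y\<^esub> f = f"
    unfolding cont_alg_sel scalar_ring_sel by (rule cont_alg_ext[OF f]) simp
  fix a assume "a \<in> carrier (scalar_ring Y)"
  then show "a \<odot>\<^bsub>cont_alg Y\<^esub> f \<in> carrier (cont_alg Y)"
    using f val_subring_closed[OF Y] unfolding cont_alg_sel cont_alg_restrict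
    by (auto simp: cont_alg_carrier intro!: continuous_on_mult_v)
qed (auto simp: fun_eq_iff algebra_simps)

lemma algebra_entire_sub:
  assumes Y: "val_subring Y" and S: "fps_subring S" and "\<And>c f. c \<in> Y \<Longrightarrow> f \<in> S \<Longrightarrow> fps_const c * f \<in> S"
  shows "Module.algebra (scalar_ring Y) (entire_alg\<lparr>carrier := S\<rparr>)"
  by (rule algebraI[OF cring_scalar_ring[OF Y] fps_subring_cring[OF S]]; simp add: assms(3))
    (auto simp: algebra_simps simp flip: fps_const_add fps_const_mult)

lemma supnorm_le_iff: "0 \<le> B \<Longrightarrow> supnorm X f \<le> ennreal B \<longleftrightarrow> (\<forall>x\<in>X. v (f x) \<le> B)"
  by (simp add: supnorm_def SUP_le_iff)

lemma supnorm_ge: "x \<in> X \<Longrightarrow> ennreal (v (f x)) \<le> supnorm X f"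
  unfolding supnorm_def by (rule SUP_upper)

lemma supnorm_cong: "(\<And>x. x \<in> X \<Longrightarrow> f x = g x) \<Longrightarrow> supnorm X f = supnorm X (g :: 'c \<Rightarrow> 'c)"
  unfolding supnorm_def by (rule SUP_cong) auto

text \<open>The map \<open>ev\<close> covers both sides of the completion: \<open>fps_eval\<close>
  for entire series and the identity for continuous functions. Finiteness of the seminorms comes
  from compactness of the balls.\<close>

lemma multivalued_ringI:
  fixes A :: "('a, 'm) ring_scheme" and ev :: "'a \<Rightarrow> 'c \<Rightarrow> 'c" and r :: "'i \<Rightarrow> int"
  assumes A: "cring A"
    and 0: "\<And>x. x \<in> Q \<Longrightarrow> ev \<zero>\<^bsub>A\<^esub> x = 0" and 1: "\<And>x. x \<in> Q \<Longrightarrow> ev \<one>\<^bsub>A\<^esub> x = 1"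
    and diff: "\<And>f g x. f \<in> carrier A \<Longrightarrow> g \<in> carrier A \<Longrightarrow> x \<in> Q \<Longrightarrow> ev (f \<ominus>\<^bsub>A\<^esub> g) x = ev f x - ev g x"
    and mult: "\<And>f g x. f \<in> carrier A \<Longrightarrow> g \<in> carrier A \<Longrightarrow> x \<in> Q \<Longrightarrow> ev (f \<otimes>\<^bsub>A\<^esub> g) x = ev f x * ev g x"
    and cont: "\<And>f. f \<in> carrier A \<Longrightarrow> continuous_on Q (ev f)"
  shows "multivalued_ring A UNIV (\<lambda>i f. supnorm (pball p (r i)) (ev f))"
  unfolding multivalued_ring_def
proof (intro conjI ballI A)
  fix i
  let ?B = "pball p (r i) :: 'c set"
  have B: "x \<in> Q" if "x \<in> ?B" for x using that by (simp add: pball_eq)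
  have "supnorm ?B (ev \<zero>\<^bsub>A\<^esub>) \<le> ennreal 0" by (subst supnorm_le_iff) (auto simp: 0 B)
  then show "supnorm ?B (ev \<zero>\<^bsub>A\<^esub>) = 0" by simp
  have "supnorm ?B (ev \<one>\<^bsub>A\<^esub>) \<le> ennreal 1" by (subst supnorm_le_iff) (auto simp: 1 B)
  then show "supnorm ?B (ev \<one>\<^bsub>A\<^esub>) \<le> 1" by simp
  fix f assume f: "f \<in> carrier A"
  have "compact (ev f ` ?B)"
    using continuous_on_subset[OF cont[OF f]] B by (intro compact_continuous_image compact_pball) blast
  then obtain b where b: "\<And>y. y \<in> ev f ` ?B \<Longrightarrow> v y \<le> b"
    by (rule compact_v_bounded) blast
  have "supnorm ?B (ev f) \<le> ennreal (max b 0)"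
    by (subst supnorm_le_iff) (auto simp: le_max_iff_disj b)
  then show "supnorm ?B (ev f) < \<infinity>" by (simp add: le_less_trans)
  fix g assume g: "g \<in> carrier A"
  show "supnorm ?B (ev (f \<ominus>\<^bsub>A\<^esub> g)) \<le> max (supnorm ?B (ev f)) (supnorm ?B (ev g))"
    unfolding supnorm_def[of _ "ev (f \<ominus>\<^bsub>A\<^esub> g)"]
  proof (rule SUP_least)
    fix x assume x: "x \<in> ?B"
    have "ennreal (v (ev (f \<ominus>\<^bsub>A\<^esub> g) x)) \<le> ennreal (max (v (ev f x)) (v (ev g x)))"
      using v_diff[of "ev f x" "ev g x"] diff[OF f g B[OF x]] by (simp add: ennreal_leI)
    also have "\<dots> \<le> max (supnorm ?B (ev f)) (supnorm ?B (ev g))"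
      using supnorm_ge[OF x, of "ev f"] supnorm_ge[OF x, of "ev g"] by (auto simp: max_def intro: order_trans)
    finally show "ennreal (v (ev (f \<ominus>\<^bsub>A\<^esub> g) x)) \<le> max (supnorm ?B (ev f)) (supnorm ?B (ev g))" .
  qed
  show "supnorm ?B (ev (f \<otimes>\<^bsub>A\<^esub> g)) \<le> supnorm ?B (ev f) * supnorm ?B (ev g)"
    unfolding supnorm_def[of _ "ev (f \<otimes>\<^bsub>A\<^esub> g)"]
  proof (rule SUP_least)
    fix x assume x: "x \<in> ?B"
    have "ennreal (v (ev (f \<otimes>\<^bsub>A\<^esub> g) x)) = ennreal (v (ev f x)) * ennreal (v (ev g x))"
      using mult[OF f g B[OF x]] by (simp add: vabs_mult ennreal_mult)
    also have "\<dots> \<le> supnorm ?B (ev f) * supnorm ?B (ev g)"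
      by (intro mult_mono supnorm_ge x) auto
    finally show "ennreal (v (ev (f \<otimes>\<^bsub>A\<^esub> g) x)) \<le> supnorm ?B (ev f) * supnorm ?B (ev g)" .
  qed
qed

lemma multivalued_cont_alg:
  assumes Y: "val_subring Y"
  shows "multivalued_ring (cont_alg Y) UNIV (\<lambda>i. supnorm (pball p (r i)))"
  by (rule multivalued_ringI[where ev = "\<lambda>f. f", OF cring_cont_alg[OF Y]])
    (auto simp: cont_alg_minus[OF Y] cont_alg_carrier)

lemma multivalued_entire_sub:
  assumes S: "fps_subring S" "S \<subseteq> carrier entire_alg"
  shows "multivalued_ring (entire_alg\<lparr>carrier := S\<rparr>) UNIV (\<lambda>i f. supnorm (pball p (r i)) (fps_eval f))"
  by (rule multivalued_ringI[OF fps_subring_cring[OF S(1)]])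
    (use S(2) in \<open>auto simp: fps_subring_a_minus[OF S(1)] carrier_entire_alg subset_iff continuous_on_eval\<close>)

section \<open>Uniform convergence on compact sets: neighbourhoods, separation, completeness\<close>

definition cont_nb :: "'c set \<Rightarrow> ('c \<Rightarrow> 'c) \<Rightarrow> nat \<Rightarrow> nat \<Rightarrow> ('c \<Rightarrow> 'c) set" where
  "cont_nb Y f k N = {g \<in> carrier (cont_alg Y). \<forall>x\<in>pball p (- int k). v (g x - f x) \<le> 1 / real p ^ N}"

text \<open>A common criterion for three families: all compact subsets of Q_p, all balls p^r Z_p
  with r an integer, and the balls p^(-n) Z_p. Each is cofinal with the last one, so all three
  define the same open sets.\<close>

lemma openin_seminorm_cont_alg:
  fixes K :: "'i \<Rightarrow> 'c set"
  assumes Y: "val_subring Y"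
    and K: "\<And>i. i \<in> I \<Longrightarrow> \<exists>k. K i \<subseteq> pball p (- int k)"
    and cofinal: "\<And>k. \<exists>i\<in>I. pball p (- int k) \<subseteq> K i"
  shows "openin (seminorm_topology (cont_alg Y) I (\<lambda>i. supnorm (K i))) U \<longleftrightarrow>
    U \<subseteq> carrier (cont_alg Y) \<and> (\<forall>f\<in>U. \<exists>k N. cont_nb Y f k N \<subseteq> U)"
  unfolding openin_seminorm_topology
proof (intro conj_cong ball_cong refl)
  fix f assume "U \<subseteq> carrier (cont_alg Y)" "f \<in> U"
  then have f: "f \<in> carrier (cont_alg Y)" by blast
  have Kin: "K i \<subseteq> Q" if "i \<in> I" for i using K[OF that] pball_subset_Qp by blast
  have sup: "supnorm (K i) (g \<ominus>\<^bsub>cont_alg Y\<^esub> f) = supnorm (K i) (\<lambda>x. g x - f x)"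
    if "i \<in> I" "g \<in> carrier (cont_alg Y)" for i g
    by (rule supnorm_cong) (use Kin[OF that(1)] in \<open>auto simp: cont_alg_minus[OF Y that(2) f]\<close>)
  show "(\<exists>F e. finite F \<and> F \<subseteq> I \<and> 0 < e \<and>
      {g \<in> carrier (cont_alg Y). \<forall>i\<in>F. supnorm (K i) (g \<ominus>\<^bsub>cont_alg Y\<^esub> f) < e} \<subseteq> U) \<longleftrightarrow>
    (\<exists>k N. cont_nb Y f k N \<subseteq> U)"
  proof safe
    fix F and e :: ennreal
    assume F: "finite F" "F \<subseteq> I" and e: "0 < e"
      and U: "{g \<in> carrier (cont_alg Y). \<forall>i\<in>F. supnorm (K i) (g \<ominus>\<^bsub>cont_alg Y\<^esub> f) < e} \<subseteq> U"
    obtain k where k: "\<And>i. i \<in> F \<Longrightarrow> K i \<subseteq> pball p (- int k)"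
    proof -
      obtain m where m: "\<And>i. i \<in> F \<Longrightarrow> K i \<subseteq> pball p (- int (m i))" using K F(2) by (metis subsetD)
      have "K i \<subseteq> pball p (- int (Max (m ` F)))" if "i \<in> F" for i
        using m[OF that] pball_mono[of "- int (Max (m ` F))" "- int (m i)"] that F(1) by auto
      then show thesis using that by blast
    qed
    obtain N where N: "ennreal (1 / real p ^ N) < e"
    \<comment> \<open>The radius \<open>e\<close> may be infinite, and then every N will do.\<close>
    proof (cases e)
      case (real r)
      with e have "r > 0" by simp
      then obtain N where "1 / real p ^ N < r" by (rule inv_p_power_small)
      then show thesis using that[of N] real by (simp add: ennreal_less_iff)
    qed (use that in simp)
    have "cont_nb Y f k N \<subseteq> U"
    proof
      fix g assume g: "g \<in> cont_nb Y f k N"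
      then have gc: "g \<in> carrier (cont_alg Y)" by (simp add: cont_nb_def)
      have "supnorm (K i) (g \<ominus>\<^bsub>cont_alg Y\<^esub> f) < e" if i: "i \<in> F" for i
      proof -
        have "supnorm (K i) (\<lambda>x. g x - f x) \<le> ennreal (1 / real p ^ N)"
          using g k[OF i] by (subst supnorm_le_iff) (auto simp: cont_nb_def)
        then show ?thesis using sup[OF _ gc] i F(2) N by (auto intro: le_less_trans)
      qed
      then show "g \<in> U" using U gc by blast
    qed
    then show "\<exists>k N. cont_nb Y f k N \<subseteq> U" by blast
  next
    fix k N assume U: "cont_nb Y f k N \<subseteq> U"
    obtain i where i: "i \<in> I" "pball p (- int k) \<subseteq> K i" using cofinal by blast
    have "{g \<in> carrier (cont_alg Y). \<forall>j\<in>{i}. supnorm (K j) (g \<ominus>\<^bsub>cont_alg Y\<^esub> f) < ennreal (1 / real p ^ N)} \<subseteq> U"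
    proof
      fix g assume g: "g \<in> {g \<in> carrier (cont_alg Y). \<forall>j\<in>{i}. supnorm (K j) (g \<ominus>\<^bsub>cont_alg Y\<^esub> f) < ennreal (1 / real p ^ N)}"
      then have "supnorm (K i) (\<lambda>x. g x - f x) \<le> ennreal (1 / real p ^ N)"
        using sup[OF i(1)] by auto
      then have "\<forall>x\<in>K i. v (g x - f x) \<le> 1 / real p ^ N" by (subst (asm) supnorm_le_iff) auto
      then have "g \<in> cont_nb Y f k N" using g i(2) by (auto simp: cont_nb_def)
      then show "g \<in> U" using U by blast
    qed
    moreover have "0 < ennreal (1 / real p ^ N)" by simp
    ultimately show "\<exists>F e. finite F \<and> F \<subseteq> I \<and> 0 < e \<and>
        {g \<in> carrier (cont_alg Y). \<forall>i\<in>F. supnorm (K i) (g \<ominus>\<^bsub>cont_alg Y\<^esub> f) < e} \<subseteq> U"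
      using i(1) by (intro exI[of _ "{i}"] exI[of _ "ennreal (1 / real p ^ N)"]) blast
  qed
qed

lemma openin_cont_topology:
  assumes Y: "val_subring Y"
  shows "openin (cont_topology Y) U \<longleftrightarrow>
    U \<subseteq> carrier (cont_alg Y) \<and> (\<forall>f\<in>U. \<exists>k N. cont_nb Y f k N \<subseteq> U)"
  unfolding cont_topology_def
proof (rule openin_seminorm_cont_alg[OF Y])
  show "\<exists>i\<in>{K :: 'c set. compact K \<and> K \<subseteq> Qp}. pball p (- int k) \<subseteq> i" for k
    by (rule bexI[of _ "pball p (- int k)"]) (simp_all add: compact_pball pball_subset_Qp)
qed (rule compact_subset_pball, auto)

lemma seminorm_topology_pball_int:
  assumes Y: "val_subring Y"
  shows "seminorm_topology (cont_alg Y) UNIV (\<lambda>r :: int. supnorm (pball p r)) = cont_topology Y"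
  unfolding topology_eq openin_cont_topology[OF Y]
proof
  fix U
  show "openin (seminorm_topology (cont_alg Y) UNIV (\<lambda>r :: int. supnorm (pball p r))) U \<longleftrightarrow>
    U \<subseteq> carrier (cont_alg Y) \<and> (\<forall>f\<in>U. \<exists>k N. cont_nb Y f k N \<subseteq> U)"
  proof (rule openin_seminorm_cont_alg[OF Y])
    fix r :: int
    show "\<exists>k. pball p r \<subseteq> (pball p (- int k) :: 'c set)"
      by (rule exI[of _ "nat (- r)"]) (rule pball_mono, simp)
  qed auto
qed

text \<open>Supplies the countable family of seminorms that a Frechet algebra requires.\<close>

lemma seminorm_topology_pball_nat:
  assumes Y: "val_subring Y"
  shows "seminorm_topology (cont_alg Y) UNIV (\<lambda>n :: nat. supnorm (pball p (- int n))) = cont_topology Y"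
  unfolding topology_eq openin_cont_topology[OF Y]
proof
  fix U
  show "openin (seminorm_topology (cont_alg Y) UNIV (\<lambda>n :: nat. supnorm (pball p (- int n)))) U \<longleftrightarrow>
    U \<subseteq> carrier (cont_alg Y) \<and> (\<forall>f\<in>U. \<exists>k N. cont_nb Y f k N \<subseteq> U)"
    by (rule openin_seminorm_cont_alg[OF Y]) auto
qed

lemma cont_nb_refl: "f \<in> carrier (cont_alg Y) \<Longrightarrow> f \<in> cont_nb Y f k N"
  by (simp add: cont_nb_def)

lemma openin_cont_nb:
  assumes Y: "val_subring Y" shows "openin (cont_topology Y) (cont_nb Y f k N)"
  unfolding openin_cont_topology[OF Y]
proof (intro conjI ballI)
  show "cont_nb Y f k N \<subseteq> carrier (cont_alg Y)" by (auto simp: cont_nb_def)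
  fix g assume "g \<in> cont_nb Y f k N"
  then have "cont_nb Y g k N \<subseteq> cont_nb Y f k N" by (auto simp: cont_nb_def intro: v_trans_le)
  then show "\<exists>k' N'. cont_nb Y g k' N' \<subseteq> cont_nb Y f k N" by blast
qed

lemma topspace_cont_topology:
  assumes Y: "val_subring Y" shows "topspace (cont_topology Y) = carrier (cont_alg Y)"
proof
  show "topspace (cont_topology Y) \<subseteq> carrier (cont_alg Y)"
    using openin_topspace[of "cont_topology Y"] openin_cont_topology[OF Y] by blast
  have "openin (cont_topology Y) (carrier (cont_alg Y))"
    unfolding openin_cont_topology[OF Y] by (auto simp: cont_nb_def)
  then show "carrier (cont_alg Y) \<subseteq> topspace (cont_topology Y)" by (rule openin_subset)
qed

lemma Hausdorff_cont_topology:
  assumes Y: "val_subring Y" shows "Hausdorff_space (cont_topology Y)"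
  unfolding Hausdorff_space_def topspace_cont_topology[OF Y]
proof (intro allI impI)
  fix f g assume fg: "f \<in> carrier (cont_alg Y) \<and> g \<in> carrier (cont_alg Y) \<and> f \<noteq> g"
  then obtain x where x: "x \<in> Q" "f x \<noteq> g x"
    unfolding cont_alg_carrier by (metis ext)
  obtain k where k: "x \<in> pball p (- int k)" using Qp_bounded_mem[OF x(1)] by blast
  have "v (f x - g x) > 0" using x(2) by simp
  then obtain N where N: "1 / real p ^ N < v (f x - g x)" by (rule inv_p_power_small)
  have "disjnt (cont_nb Y f k N) (cont_nb Y g k N)"
    unfolding disjnt_iff
  proof (intro allI notI)
    fix h assume "h \<in> cont_nb Y f k N \<and> h \<in> cont_nb Y g k N"
    then have "v (h x - f x) \<le> 1 / real p ^ N" "v (h x - g x) \<le> 1 / real p ^ N"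
      using k by (auto simp: cont_nb_def)
    then have "v ((h x - g x) - (h x - f x)) \<le> 1 / real p ^ N" using v_diff_le by blast
    with N show False by simp
  qed
  then show "\<exists>U V. openin (cont_topology Y) U \<and> openin (cont_topology Y) V \<and> f \<in> U \<and> g \<in> V \<and> disjnt U V"
    by (intro exI[of _ "cont_nb Y f k N"] exI[of _ "cont_nb Y g k N"])
      (simp add: fg openin_cont_nb[OF Y] cont_nb_refl)
qed

text \<open>The topology has a countable neighbourhood basis at 0, so a sequence can be extracted
  from the Cauchy filter. Its pointwise limit is uniform on each ball, hence continuous, and the
  whole filter converges to it.\<close>

lemma complete_cont_topology:
  assumes Y: "val_subring Y" shows "complete_group_topology (cont_alg Y) (cont_topology Y)"
  unfolding complete_group_topology_def
proof (intro allI impI, elim conjE)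
  let ?C = "carrier (cont_alg Y)"
  fix F :: "('c \<Rightarrow> 'c) filter"
  assume nb: "F \<noteq> bot" and FC: "\<forall>\<^sub>F f in F. f \<in> ?C"
    and Cauchy: "\<forall>U. openin (cont_topology Y) U \<and> \<zero>\<^bsub>cont_alg Y\<^esub> \<in> U \<longrightarrow>
      (\<exists>P. eventually P F \<and> (\<forall>f g. P f \<and> P g \<longrightarrow> f \<ominus>\<^bsub>cont_alg Y\<^esub> g \<in> U))"
  interpret R: cring "cont_alg Y" by (rule cring_cont_alg[OF Y])
  \<comment> \<open>Radius p^n and precision 1 / p^n grow together, so that one index n controls
    both.\<close>
  have "\<exists>P. eventually P F \<and> (\<forall>f g. P f \<and> P g \<longrightarrow> f \<ominus>\<^bsub>cont_alg Y\<^esub> g \<in> cont_nb Y \<zero>\<^bsub>cont_alg Y\<^esub> n n)" for n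
    using Cauchy[rule_format, OF conjI[OF openin_cont_nb[OF Y] cont_nb_refl[OF R.zero_closed]]] .
  then obtain P where P: "\<And>n. eventually (P n) F"
    "\<And>n f g. P n f \<Longrightarrow> P n g \<Longrightarrow> f \<ominus>\<^bsub>cont_alg Y\<^esub> g \<in> cont_nb Y \<zero>\<^bsub>cont_alg Y\<^esub> n n"
    by metis
  have close: "v (f x - g x) \<le> 1 / real p ^ n"
    if "P n f" "P n g" "f \<in> ?C" "g \<in> ?C" "x \<in> pball p (- int n)" for n f g x
  proof -
    have "x \<in> Q" using that(5) by (simp add: pball_eq)
    moreover have "v ((f \<ominus>\<^bsub>cont_alg Y\<^esub> g) x - \<zero>\<^bsub>cont_alg Y\<^esub> x) \<le> 1 / real p ^ n"
      using P(2)[OF that(1,2)] that(5) unfolding cont_nb_def by blast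
    ultimately show ?thesis by (simp add: cont_alg_minus[OF Y that(3,4)])
  qed
  have "\<exists>f. P n f \<and> f \<in> ?C" for n
    using eventually_happens'[OF nb eventually_conj[OF P(1)[of n] FC]] by simp
  then obtain s where s: "\<And>n. P n (s n)" "\<And>n. s n \<in> ?C" by metis
  have sclose: "v (s m x - s n x) \<le> 1 / real p ^ m" if mn: "m \<le> n" and x: "x \<in> pball p (- int m)" for m n x
  proof -
    \<comment> \<open>The sets \<open>P m\<close> and \<open>P n\<close> need not be nested, so
      \<open>s m\<close> and \<open>s n\<close> are compared through an element of both, which
      exists because the filter is proper.\<close>
    obtain h where h: "P m h" "P n h" "h \<in> ?C"
      using eventually_happens'[OF nb eventually_conj[OF P(1)[of m] eventually_conj[OF P(1)[of n] FC]]] by blast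
    have xn: "x \<in> pball p (- int n)" using x mn pball_mono[of "- int n" "- int m"] by auto
    have "1 / real p ^ n \<le> 1 / real p ^ m"
      using mn real_p_ge_2 by (intro divide_left_mono power_increasing) auto
    then have "v (h x - s n x) \<le> 1 / real p ^ m" using close[OF h(2) s(1) h(3) s(2) xn] by linarith
    then show ?thesis using close[OF s(1) h(1) s(2) h(3) x] v_trans_le by blast
  qed
  have "\<exists>l. (\<lambda>n. s n x) \<longlonglongrightarrow> l" if x: "x \<in> Q" for x
  proof -
    obtain k where k: "x \<in> pball p (- int k)" using Qp_bounded_mem[OF x] by blast
    have "Cauchy (\<lambda>n. s n x)" unfolding Cauchy_altdef2
    proof (intro allI impI)
      fix e :: real assume "e > 0"
      then obtain N where N: "1 / real p ^ N < e" by (rule inv_p_power_small)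
      let ?M = "max N k"
      have xM: "x \<in> pball p (- int ?M)" using k pball_mono[of "- int ?M" "- int k"] by auto
      have "1 / real p ^ ?M \<le> 1 / real p ^ N"
        using real_p_ge_2 by (intro divide_left_mono power_increasing) auto
      then have "dist (s n x) (s ?M x) < e" if "n \<ge> ?M" for n
        using sclose[OF that xM] N by (simp add: dist_vabs v_commute[of "s n x"])
      then show "\<exists>M. \<forall>n\<ge>M. dist (s n x) (s M x) < e" by blast
    qed
    then show ?thesis by (auto dest: Cauchy_convergent convergentD)
  qed
  then obtain l0 where l0: "\<And>x. x \<in> Q \<Longrightarrow> (\<lambda>n. s n x) \<longlonglongrightarrow> l0 x" by metis
  define l where "l = (\<lambda>x\<in>Q. l0 x)"
  have lim: "v (l x - s n x) \<le> 1 / real p ^ n" if x: "x \<in> pball p (- int n)" for n x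
  proof (rule v_lim_mem_le)
    have xQ: "x \<in> Q" using x by (simp add: pball_eq)
    show "(\<lambda>n. s n x) \<longlonglongrightarrow> l x" using l0[OF xQ] xQ by (simp add: l_def)
    show "\<forall>\<^sub>F m in sequentially. v (s m x - s n x) \<le> 1 / real p ^ n"
      using eventually_ge_at_top[of n]
    proof eventually_elim
      case (elim m)
      then show ?case using sclose[OF elim x] by (simp add: v_commute)
    qed
  qed
  have lC: "l \<in> ?C"
    unfolding l_def cont_alg_restrict
  proof (intro conjI ballI)
    fix x assume x: "x \<in> Q"
    show "l0 x \<in> Y"
      using Y s(2) x by (intro closed_sequentially[OF _ _ l0[OF x]]) (auto simp: val_subring_def cont_alg_carrier)
  next
    show "continuous_on Q l0" unfolding continuous_on_iff
    proof (intro ballI allI impI)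
      fix x and e :: real assume x: "x \<in> Q" and e: "e > 0"
      obtain N where N: "1 / real p ^ N < e" using e by (rule inv_p_power_small)
      \<comment> \<open>The 1 keeps every y at distance less than 1 from x in the ball on which
        \<open>s n\<close> is close to \<open>l\<close>.\<close>
      obtain k where k: "max 1 (v x) \<le> real p ^ k" by (rule p_power_large)
      define n where "n = max N k"
      have "1 / real p ^ n \<le> 1 / real p ^ N"
        using real_p_ge_2 by (intro divide_left_mono power_increasing) (auto simp: n_def)
      then have ne: "1 / real p ^ n < e" using N by linarith
      have "real p ^ k \<le> real p ^ n" using real_p_ge_2 by (intro power_increasing) (auto simp: n_def)
      then have n: "1 \<le> real p ^ n" "v x \<le> real p ^ n" using k by auto
      have "continuous_on Q (s n)" using s(2)[of n] by (simp add: cont_alg_carrier)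
      then obtain d where d: "d > 0" "\<And>y. y \<in> Q \<Longrightarrow> dist y x < d \<Longrightarrow> v (s n y - s n x) < e"
        using x e unfolding continuous_on_iff dist_vabs by metis
      show "\<exists>d>0. \<forall>y\<in>Q. dist y x < d \<longrightarrow> dist (l0 y) (l0 x) < e"
      proof (intro exI[of _ "min d 1"] conjI ballI impI)
        fix y assume y: "y \<in> Q" "dist y x < min d 1"
        have "v y \<le> real p ^ n" using vabs_add[of "y - x" x] y n by (auto simp: dist_vabs)
        then have "v (l y - s n y) < e" "v (l x - s n x) < e"
          using lim[of y n] lim[of x n] x y n ne by (auto simp: pball_neg)
        moreover have "v (s n y - s n x) < e" using d(2) y by simp
        ultimately have "v (l y - l x) < e" using v_trans_less v_commute by metis
        then show "dist (l0 y) (l0 x) < e" using x y by (simp add: l_def dist_vabs)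
      qed (use d in simp)
    qed
  qed
  have "limitin (cont_topology Y) (\<lambda>f. f) l F"
    unfolding limitin_def topspace_cont_topology[OF Y]
  proof (intro conjI allI impI lC)
    fix U assume "openin (cont_topology Y) U \<and> l \<in> U"
    then obtain k N where U: "cont_nb Y l k N \<subseteq> U" unfolding openin_cont_topology[OF Y] by blast
    define n where "n = max k N"
    show "\<forall>\<^sub>F f in F. f \<in> U"
      using P(1)[of n] FC
    proof eventually_elim
      case (elim f)
      have "v (f x - l x) \<le> 1 / real p ^ N" if x: "x \<in> pball p (- int k)" for x
      proof -
        have xn: "x \<in> pball p (- int n)" using x pball_mono[of "- int n" "- int k"] by (auto simp: n_def)
        have "v (f x - s n x) \<le> 1 / real p ^ n" by (rule close[OF elim(1) s(1) elim(2) s(2) xn])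
        then have "v (f x - l x) \<le> 1 / real p ^ n" using lim[OF xn] v_trans_le v_commute by metis
        also have "\<dots> \<le> 1 / real p ^ N"
          using real_p_ge_2 by (intro divide_left_mono power_increasing) (auto simp: n_def)
        finally show ?thesis .
      qed
      then have "f \<in> cont_nb Y l k N" using elim(2) by (simp add: cont_nb_def)
      then show ?case using U by blast
    qed
  qed
  then show "\<exists>l. limitin (cont_topology Y) (\<lambda>f. f) l F" by (rule exI[of _ l])
qed

section \<open>Frechet structure and the two completions\<close>

lemma Frechet_cont_alg:
  assumes Y: "val_subring Y" shows "Frechet_algebra (scalar_ring Y) (cont_alg Y) (cont_topology Y)"
  unfolding Frechet_algebra_def
proof (intro conjI algebra_cont_alg Hausdorff_cont_topology complete_cont_topology Y
    exI[of _ "\<lambda>n. supnorm (pball p (- int n))"] multivalued_cont_alg allI ballI)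
  show "cont_topology Y = seminorm_topology (cont_alg Y) UNIV (\<lambda>n :: nat. supnorm (pball p (- int n)))"
    by (rule seminorm_topology_pball_nat[OF Y, symmetric])
  fix n :: nat and a f assume "a \<in> carrier (scalar_ring Y)" "f \<in> carrier (cont_alg Y)"
  let ?B = "pball p (- int n) :: 'c set"
  have "ennreal (v (a * f x)) \<le> ennreal (v a) * supnorm ?B f" if "x \<in> ?B" for x
    using mult_left_mono[OF supnorm_ge[OF that, of f], of "ennreal (v a)"] by (simp add: vabs_mult ennreal_mult)
  then show "supnorm ?B (a \<odot>\<^bsub>cont_alg Y\<^esub> f) \<le> ennreal (v a) * supnorm ?B f"
    unfolding supnorm_def[of _ "a \<odot>\<^bsub>cont_alg Y\<^esub> f"] by (intro SUP_least) (auto simp: pball_eq)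
qed

text \<open>Separates what depends on the particular ring of entire series, namely its closure
  properties, its values on Q_p and density on each ball, from the topology of the target, which is
  the same argument for Q_p and Z_p.\<close>

lemma completion_is_cont_algI:
  assumes Y: "val_subring Y" and S: "fps_subring S" "S \<subseteq> carrier entire_alg"
    and smult: "\<And>c f. c \<in> Y \<Longrightarrow> f \<in> S \<Longrightarrow> fps_const c * f \<in> S"
    and vals: "\<And>f x. f \<in> S \<Longrightarrow> x \<in> Q \<Longrightarrow> fps_eval f x \<in> Y"
    and dense: "\<And>f k N. f \<in> carrier (cont_alg Y) \<Longrightarrow>
      \<exists>g\<in>S. \<forall>x\<in>pball p (- int k). v (f x - fps_eval g x) \<le> 1 / real p ^ N"
  shows "completion_is_cont_alg p (scalar_ring Y) (entire_alg\<lparr>carrier := S\<rparr>) Y"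
  unfolding completion_is_cont_alg_def is_completion_def
proof (intro conjI algebra_entire_sub Frechet_cont_alg multivalued_entire_sub Y S smult)
  have ent [simp]: "entire f" if "f \<in> S" for f using S(2) that by (auto simp: carrier_entire_alg)
  have restr: "restr f \<in> carrier (cont_alg Y)" if "f \<in> S" for f
    unfolding restr_def cont_alg_restrict using vals that by (auto intro: continuous_on_eval)
  show "multivalued_ring (cont_alg Y) UNIV (\<lambda>r. supnorm (pball p r))"
    using multivalued_cont_alg[OF Y, of "\<lambda>r. r"] by simp
  show "restr \<in> ring_hom (entire_alg\<lparr>carrier := S\<rparr>) (cont_alg Y)"
    by (rule ring_hom_memI) (use restr in \<open>auto simp: restr_def\<close>)
  show "\<forall>r\<in>UNIV. \<forall>f\<in>carrier (entire_alg\<lparr>carrier := S\<rparr>).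
      supnorm (pball p r) (restr f) = supnorm (pball p r) (fps_eval f)"
    by (intro ballI supnorm_cong) (auto simp: restr_def pball_eq)
  have "cont_topology Y closure_of (restr ` S) = carrier (cont_alg Y)"
  proof
    show "cont_topology Y closure_of (restr ` S) \<subseteq> carrier (cont_alg Y)"
      using closure_of_subset_topspace topspace_cont_topology[OF Y] by metis
    show "carrier (cont_alg Y) \<subseteq> cont_topology Y closure_of (restr ` S)"
    proof
      fix f assume f: "f \<in> carrier (cont_alg Y)"
      show "f \<in> cont_topology Y closure_of (restr ` S)"
        unfolding in_closure_of topspace_cont_topology[OF Y]
      proof (intro conjI allI impI f)
        fix U assume "f \<in> U \<and> openin (cont_topology Y) U"
        then obtain k N where U: "cont_nb Y f k N \<subseteq> U" unfolding openin_cont_topology[OF Y] by blast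
        obtain g where g: "g \<in> S" "\<forall>x\<in>pball p (- int k). v (f x - fps_eval g x) \<le> 1 / real p ^ N"
          using dense[OF f] by blast
        then have "restr g \<in> cont_nb Y f k N"
          using restr by (auto simp: cont_nb_def restr_def pball_eq v_commute)
        then show "\<exists>h. h \<in> restr ` S \<and> h \<in> U" using U g(1) by blast
      qed
    qed
  qed
  then show "seminorm_topology (cont_alg Y) UNIV (\<lambda>r. supnorm (pball p r)) closure_of
      (restr ` carrier (entire_alg\<lparr>carrier := S\<rparr>)) = carrier (cont_alg Y)"
    by (simp add: seminorm_topology_pball_int[OF Y])
  show "Hausdorff_space (seminorm_topology (cont_alg Y) UNIV (\<lambda>r. supnorm (pball p r)))"
    unfolding seminorm_topology_pball_int[OF Y] by (rule Hausdorff_cont_topology[OF Y])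
  show "complete_group_topology (cont_alg Y) (seminorm_topology (cont_alg Y) UNIV (\<lambda>r. supnorm (pball p r)))"
    unfolding seminorm_topology_pball_int[OF Y] by (rule complete_cont_topology[OF Y])
  show "\<forall>c\<in>carrier (scalar_ring Y). \<forall>f\<in>carrier (entire_alg\<lparr>carrier := S\<rparr>).
      restr (c \<odot>\<^bsub>entire_alg\<lparr>carrier := S\<rparr>\<^esub> f) = c \<odot>\<^bsub>cont_alg Y\<^esub> restr f"
    by (auto simp: restr_def)
  show "seminorm_topology (cont_alg Y) UNIV (\<lambda>r. supnorm (pball p r)) = cont_topology Y"
    by (rule seminorm_topology_pball_int[OF Y])
qed

lemma completion_E_int: "completion_is_cont_alg p Zp_ring (E_int_alg p) Z"
proof -
  have "completion_is_cont_alg p (scalar_ring Z) (entire_alg\<lparr>carrier := E_int p\<rparr>) Z"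
  proof (rule completion_is_cont_algI[OF val_subring_Z fps_subring_E_int E_int_carrier E_int_const_mult E_int_Zp])
    fix f k N assume f: "f \<in> carrier (cont_alg Z)"
    then have "continuous_on (pball p (- int k)) f"
      unfolding cont_alg_carrier using continuous_on_subset pball_subset_Qp by blast
    then have "\<exists>g\<in>psi_ring. \<forall>x\<in>pball p (- int k). v (f x - fps_eval g x) \<le> 1 / real p ^ N"
      by (rule approx) (use f in \<open>auto simp: cont_alg_carrier pball_eq\<close>)
    then show "\<exists>g\<in>E_int p. \<forall>x\<in>pball p (- int k). v (f x - fps_eval g x) \<le> 1 / real p ^ N"
      using psi_ring_E_int by blast
  qed
  then show ?thesis by (simp add: E_int_alg_def Zp_ring_def scalar_ring_def)
qed

lemma completion_E_bd: "completion_is_cont_alg p Qp_ring (E_bd_alg p) Q"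
proof -
  have "completion_is_cont_alg p (scalar_ring Q) (entire_alg\<lparr>carrier := E_bd p\<rparr>) Q"
  proof (rule completion_is_cont_algI[OF val_subring_Q fps_subring_E_bd E_bd_carrier E_bd_const_mult E_bd_Qp])
    fix f k N assume f: "f \<in> carrier (cont_alg Q)"
    let ?B = "pball p (- int k) :: 'c set"
    have B: "x \<in> Q" if "x \<in> ?B" for x using that by (simp add: pball_eq)
    have cont: "continuous_on ?B f"
      using f unfolding cont_alg_carrier using continuous_on_subset pball_subset_Qp by blast
    then have "compact (f ` ?B)" by (intro compact_continuous_image compact_pball)
    then obtain b where "\<And>y. y \<in> f ` ?B \<Longrightarrow> v y \<le> b" by (rule compact_v_bounded) blast
    then have b: "v (f x) \<le> b" if "x \<in> ?B" for x using that by blast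
    \<comment> \<open>On the compact ball \<open>f\<close> is bounded, so p^n f is Z_p-valued there;
      the exponent n depends on the ball.\<close>
    obtain n where n: "b \<le> real p ^ n" by (rule p_power_large)
    have "continuous_on ?B (\<lambda>x. of_nat p ^ n * f x)"
      by (intro continuous_on_mult_v cont) simp
    \<comment> \<open>Dividing by p^n afterwards costs n powers of p, hence the precision N +
      n.\<close>
    then have "\<exists>g\<in>psi_ring. \<forall>x\<in>?B. v (of_nat p ^ n * f x - fps_eval g x) \<le> 1 / real p ^ (N + n)"
    proof (rule approx)
      fix x assume x: "x \<in> ?B"
      have "v (f x) \<le> real p ^ n" using b[OF x] n by linarith
      then show "of_nat p ^ n * f x \<in> Z"
        using f B[OF x] by (simp add: Zp_iff cont_alg_carrier vabs_mult v_power vabs_p power_one_over field_simps)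
    qed
    then obtain g where g: "g \<in> psi_ring" "\<And>x. x \<in> ?B \<Longrightarrow> v (of_nat p ^ n * f x - fps_eval g x) \<le> 1 / real p ^ (N + n)"
      by blast
    define h where "h = fps_const (1 / of_nat p ^ n) * g"
    have "h \<in> E_bd p" unfolding h_def E_bd_def using g(1) psi_ring_E_int by blast
    moreover have "v (f x - fps_eval h x) \<le> 1 / real p ^ N" if x: "x \<in> ?B" for x
    proof -
      have eq: "f x - fps_eval h x = (of_nat p ^ n * f x - fps_eval g x) / of_nat p ^ n"
        using g(1) by (simp add: h_def field_simps)
      have "v (of_nat p ^ n * f x - fps_eval g x) * real p ^ n \<le> 1 / real p ^ (N + n) * real p ^ n"
        using g(2)[OF x] by (intro mult_right_mono) auto
      then show ?thesis unfolding eq v_div_p_power by (simp add: power_add)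
    qed
    ultimately show "\<exists>g\<in>E_bd p. \<forall>x\<in>?B. v (f x - fps_eval g x) \<le> 1 / real p ^ N" by blast
  qed
  then show ?thesis by (simp add: E_bd_alg_def Qp_ring_def scalar_ring_def)
qed

end

theorem theorem1p17:
  fixes p :: nat
  assumes "prime p"
    and "is_Cp p TYPE('c :: {alg_closed_field, field_char_0, complete_space})"
  shows "completion_is_cont_alg p Qp_ring (E_bd_alg p) (Qp :: 'c set)
       \<and> completion_is_cont_alg p Zp_ring (E_int_alg p) (Zp :: 'c set)"
proof -
  interpret padic_field p "TYPE('c)"
    using assms by unfold_locales (auto simp: is_Cp_def)
  show ?thesis using completion_E_bd completion_E_int by blast
qed

end
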